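(* Let $n\ge1$, let $D\subset\mathbf R^n$ be a bounded domain, let $V\in L^r(D)$ be real-valued, and suppose that for some constant $E\le 0$ the differential equation $$-\Delta u-Vu=Eu$$ has a nontrivial distributional solution $u\in W^{1,2}_0(D)$. (1) If $\max\{1,\frac n2\}<r\le\infty$ and $q=r^*$ is the Hölder conjugate exponent of $r$, then $K_q(D)^2\,\|V_+\|_r\ge 1$. (2) If $n\ge 3$ and $r=\frac n2$, then, with $\overline q=\frac{n}{n-2}$, $K_{\overline q}^2\,\|V_+\|_{\frac n2}>1$.
   Context: $W^{1,2}_0(D)$ is the closure of $C_0^\infty(D)$ with respect to the norm $\|\nabla u\|_2$. $\|\cdot\|_p$ is the norm of $L^p(D)$, $V_+=\max\{V,0\}$, and $\frac1q+\frac1r=1$ with $\infty^*=1$. The Sobolev constant is $K_q(D)=\sup\{\|u\|_{2q}/\|\nabla u\|_2 : u\in W^{1,2}_0(D),\ u\ne0\}$. For $n\ge3$ and $q=\overline q=\frac n{n-2}$ this constant is independent of $D$ and is written $K_{\overline q}$. Distributional solution means $\int_D\nabla u\cdot\nabla\psi\,dx=\int_D (V+E)u\psi\,dx$ for all $\psi\in C_0^\infty(D)$; nontrivial means not a.e. zero. Solutions may be complex-valued. *)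

theory Defs
  imports "HOL-Analysis.Analysis" "HOL-Probability.Essential_Supremum"
begin

definition bounded_domain :: "(real^'n) set \<Rightarrow> bool" where
  "bounded_domain D \<longleftrightarrow> D \<noteq> {} \<and> open D \<and> connected D \<and> bounded D"

text \<open>Functions on \<open>D\<close> are represented by functions on the whole space; only their values on
  \<open>D\<close> matter, and functions that agree almost everywhere on \<open>D\<close> are not distinguished.\<close>

text \<open>The \<open>L\<^sup>p\<close> norm with values in \<open>[0,\<infinity>]\<close>; it is meant for \<open>1 \<le> p \<le> \<infinity>\<close>.\<close>

definition Lp_norm :: "ennreal \<Rightarrow> (real^'n) set \<Rightarrow> (real^'n \<Rightarrow> 'b::euclidean_space) \<Rightarrow> ennreal" where
  "Lp_norm p D f =
    (if p = \<infinity> then esssup (lebesgue_on D) (\<lambda>x. ennreal (norm (f x)))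
     else let I = (\<integral>\<^sup>+ x. ennreal (norm (f x) powr enn2real p) \<partial>lebesgue_on D)
          in if I = \<infinity> then \<infinity> else ennreal (enn2real I powr (1 / enn2real p)))"

definition Lp_space :: "ennreal \<Rightarrow> (real^'n) set \<Rightarrow> (real^'n \<Rightarrow> 'b::euclidean_space) set" where
  "Lp_space p D = {f. f \<in> borel_measurable (lebesgue_on D) \<and> Lp_norm p D f < \<infinity>}"

definition partial_deriv :: "'n \<Rightarrow> (real^'n \<Rightarrow> complex) \<Rightarrow> real^'n \<Rightarrow> complex" where
  "partial_deriv i f x = frechet_derivative f (at x) (axis i 1)"

definition grad :: "(real^'n \<Rightarrow> complex) \<Rightarrow> real^'n \<Rightarrow> complex^'n" where
  "grad f x = (\<chi> i. partial_deriv i f x)"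

text \<open>Smoothness: every iterated partial derivative is (totally) differentiable everywhere, and
  hence also continuous.\<close>

definition smooth :: "(real^'n \<Rightarrow> complex) \<Rightarrow> bool" where
  "smooth f \<longleftrightarrow> (\<forall>is x. foldr partial_deriv is f differentiable (at x))"

definition test_functions :: "(real^'n) set \<Rightarrow> (real^'n \<Rightarrow> complex) set" where
  "test_functions D =
    {\<psi>. smooth \<psi> \<and> compact (closure {x. \<psi> x \<noteq> 0}) \<and> closure {x. \<psi> x \<noteq> 0} \<subseteq> D}"

definition has_weak_gradient ::
    "(real^'n) set \<Rightarrow> (real^'n \<Rightarrow> complex) \<Rightarrow> (real^'n \<Rightarrow> complex^'n) \<Rightarrow> bool" where
  "has_weak_gradient D u g \<longleftrightarrow>
    (\<forall>K. compact K \<and> K \<subseteq> D \<longrightarrow> u absolutely_integrable_on K \<and> g absolutely_integrable_on K) \<and>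
    (\<forall>\<psi>\<in>test_functions D. \<forall>i.
      (LINT x|lebesgue_on D. u x * partial_deriv i \<psi> x) = - (LINT x|lebesgue_on D. g x $ i * \<psi> x))"

text \<open>The weak gradient is unique up to equality almost everywhere on \<open>D\<close>; the operator picks a
  representative and is meaningful only where a weak gradient exists.\<close>

definition weak_gradient ::
    "(real^'n) set \<Rightarrow> (real^'n \<Rightarrow> complex) \<Rightarrow> real^'n \<Rightarrow> complex^'n" where
  "weak_gradient D u = (SOME g. has_weak_gradient D u g)"

text \<open>The closure of the test functions in the norm \<open>\<parallel>\<nabla>u\<parallel>\<^sub>2\<close>, for bounded open \<open>D\<close>. On the space of
  all weakly differentiable functions \<open>\<parallel>\<nabla>u\<parallel>\<^sub>2\<close> is only a seminorm (it vanishes on constants), so an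
  element of the closure is identified as the \<open>L\<^sup>2(D)\<close> limit of the approximating test functions.
  By Poincare's inequality that limit exists for every sequence that is Cauchy in \<open>\<parallel>\<nabla>u\<parallel>\<^sub>2\<close>, so that
  this is the completion of the test functions in that norm.\<close>

definition W012 :: "(real^'n) set \<Rightarrow> (real^'n \<Rightarrow> complex) set" where
  "W012 D = {u. u \<in> Lp_space 2 D \<and> (\<exists>g. has_weak_gradient D u g) \<and>
    weak_gradient D u \<in> Lp_space 2 D \<and>
    (\<exists>\<phi>. (\<forall>k::nat. \<phi> k \<in> test_functions D) \<and>
      (\<lambda>k. Lp_norm 2 D (\<lambda>x. grad (\<phi> k) x - weak_gradient D u x)) \<longlonglongrightarrow> 0 \<and>
      (\<lambda>k. Lp_norm 2 D (\<lambda>x. \<phi> k x - u x)) \<longlonglongrightarrow> 0)}"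

definition nontrivial_on :: "(real^'n) set \<Rightarrow> (real^'n \<Rightarrow> complex) \<Rightarrow> bool" where
  "nontrivial_on D u \<longleftrightarrow> \<not> (AE x in lebesgue_on D. u x = 0)"

text \<open>The supremum is taken in \<open>[0,\<infinity>]\<close>. The denominators are positive and finite: for bounded \<open>D\<close> the
  only element of \<open>W012 D\<close> with vanishing weak gradient is \<open>0\<close>.\<close>

definition sobolev_const :: "ennreal \<Rightarrow> (real^'n) set \<Rightarrow> ennreal" where
  "sobolev_const q D =
    (SUP u\<in>{u \<in> W012 D. nontrivial_on D u}. Lp_norm (2 * q) D u / Lp_norm 2 D (weak_gradient D u))"

text \<open>\<open>-\<Delta>u - V u = E u\<close> in the sense of distributions; the product of gradients is bilinear, with no
  complex conjugation.\<close>

definition distributional_solution ::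
    "(real^'n) set \<Rightarrow> (real^'n \<Rightarrow> real) \<Rightarrow> real \<Rightarrow> (real^'n \<Rightarrow> complex) \<Rightarrow> bool" where
  "distributional_solution D V E u \<longleftrightarrow>
    (\<forall>\<psi>\<in>test_functions D.
      (LINT x|lebesgue_on D. (\<Sum>i\<in>UNIV. weak_gradient D u x $ i * grad \<psi> x $ i)) =
      (LINT x|lebesgue_on D. complex_of_real (V x + E) * u x * \<psi> x))"

end

theory Submission
  imports Defs
begin

text \<open>Testing the equation with \<open>u\<close> itself gives
  \<open>\<parallel>\<nabla>u\<parallel>\<^sub>2\<^sup>2 \<le> \<integral>V\<^sub>+\<bar>u\<bar>\<^sup>2 \<le> \<parallel>V\<^sub>+\<parallel>\<^sub>r \<parallel>u\<parallel>\<^sub>2\<^sub>q\<^sup>2 \<le> K\<^sup>2 \<parallel>V\<^sub>+\<parallel>\<^sub>r \<parallel>\<nabla>u\<parallel>\<^sub>2\<^sup>2\<close>. The approximation of \<open>u\<close>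
  by test functions needed here converges in \<open>L\<^sup>2\<^sup>q\<close> by the Sobolev inequality, which is obtained from
  the Gagliardo--Loomis--Whitney inequality.

  In the critical case, equality would make \<open>u\<close> an extremal of the Sobolev inequality on the
  bounded set \<open>D\<close>. By dilation invariance a copy \<open>v\<close> of \<open>\<bar>u\<bar>\<close> fits into a small ball of \<open>D\<close> on which some
  nonnegative test function \<open>\<eta>\<close> satisfies \<open>\<Delta>\<eta> \<ge> \<delta> > 0\<close>. Then \<open>v + t\<eta>\<close> has at least the \<open>L\<^sup>2\<^sup>q\<close> norm of \<open>v\<close>,
  while its energy drops by at least \<open>2t\<delta>\<integral>v - O(t\<^sup>2)\<close>, which contradicts the definition of \<open>K\<close>.
  The argument is carried out with test functions approximating \<open>\<bar>u\<bar>\<close>.\<close>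

section \<open>Powers of extended nonnegative reals and the weighted Hoelder inequality\<close>

text \<open>Two gaps separate the definitions from this plan. First, \<open>weak_gradient\<close> is
  an arbitrary choice, so even for a test function it says nothing until weak gradients are known to
  be unique almost everywhere. Uniqueness needs a supply of test functions. It comes from u itself:
  a nontrivial u has a nonzero approximant, whose dilates and translates act as bump functions and
  whose squared modulus serves as \<eta>. That \<eta> is strictly subharmonic somewhere, because the
  integral of |x|^2 times its Laplacian is 2n times the integral of \<eta>, which is positive.
  Second, \<open>sobolev_const\<close> takes values in [0,\<infinity>]. If it is infinite, so is the
  product in the claim, since the energy inequality forces the norm of V_+ to be positive; the
  Sobolev inequality with a non-sharp constant serves the passage to the limit and shows that the
  gradient of u is nonzero.

  A common route to the strict inequality extends an extremal by zero and invokes unique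
  continuation or the strong maximum principle. The perturbation by \<eta> replaces both. Its gain
  is of first order in t with constants that do not depend on the approximant, so it survives the
  limit.\<close>

definition epow :: "ennreal \<Rightarrow> real \<Rightarrow> ennreal" where
  "epow x a = (if x = \<infinity> then \<infinity> else ennreal (enn2real x powr a))"

lemma epow_ennreal [simp]: "0 \<le> x \<Longrightarrow> epow (ennreal x) a = ennreal (x powr a)"
  by (simp add: epow_def)

lemma epow_top [simp]: "epow \<infinity> a = \<infinity>" "epow top a = top"
  by (simp_all add: epow_def)

lemma epow_zero [simp]: "epow 0 a = 0"
  by (simp add: epow_def)

lemma epow_one [simp]: "epow x 1 = x"
  by (cases x) (simp_all add: epow_def)

lemma epow_eq_0_iff [simp]: "epow x a = 0 \<longleftrightarrow> x = 0"
  by (cases x) (auto simp: epow_def)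

lemma epow_eq_top_iff: "epow x a = top \<longleftrightarrow> x = top"
  by (cases x) (auto simp: epow_def)

lemma epow_less_top_iff: "epow x a < top \<longleftrightarrow> x < top"
  by (simp add: less_top[symmetric] epow_eq_top_iff)

lemma epow_mono: "x \<le> y \<Longrightarrow> 0 \<le> a \<Longrightarrow> epow x a \<le> epow y a"
  by (cases x; cases y) (auto simp: top_unique intro!: ennreal_leI powr_mono2)

text \<open>The values 0 and \<infinity> are fixed by every exponent, zero and negative ones
  included, and 0 * \<infinity> = 0. This convention matches the case distinction in
  \<open>Lp_norm\<close> and makes the exponent laws hold without side conditions.\<close>

lemma epow_mult: "epow (x * y) a = epow x a * epow y a"
proof (cases "x = \<infinity> \<or> y = \<infinity>")
  case True
  then show ?thesis
    by (cases "x = 0"; cases "y = 0") (auto simp: ennreal_mult_top ennreal_top_mult)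
next
  case False
  then obtain r s where "x = ennreal r" "0 \<le> r" "y = ennreal s" "0 \<le> s"
    by (cases x; cases y) auto
  then show ?thesis
    by (simp add: ennreal_mult[symmetric] powr_mult)
qed

lemma epow_epow: "epow (epow x a) b = epow x (a * b)"
  by (cases x) (simp_all add: powr_powr)

lemma epow_add: "epow x (a + b) = epow x a * epow x b"
  by (cases x) (simp_all add: powr_add ennreal_mult[symmetric] ennreal_top_mult)

lemma epow_2: "epow x 2 = x\<^sup>2"
  by (cases x) (simp_all add: ennreal_power powr_numeral)

lemma powr_square: "(y powr a)\<^sup>2 = y powr (2 * a)" for y a :: real
  by (simp add: power2_eq_square flip: powr_add)

text \<open>Nonemptiness matters: the empty product is 1, whereas \<open>epow 0 0\<close> is 0 and
  \<open>epow top 0\<close> is \<open>top\<close>.\<close>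

lemma epow_prod_const:
  "finite A \<Longrightarrow> A \<noteq> {} \<Longrightarrow> (\<Prod>i\<in>A. epow x a) = epow x (real (card A) * a)"
proof (induction A rule: finite_ne_induct)
  case (insert i F)
  then show ?case by (simp add: epow_add[symmetric] algebra_simps)
qed simp

lemma borel_measurable_epow [measurable (raw)]:
  assumes [measurable]: "f \<in> borel_measurable M"
  shows "(\<lambda>x. epow (f x) a) \<in> borel_measurable M"
  unfolding epow_def by measurable

text \<open>For positive finite values this is Jensen's inequality for the logarithm, exponentiated.
  An infinite value makes the right side infinite, and otherwise a zero makes the left side
  vanish.\<close>

lemma weighted_AM_GM_ennreal:
  assumes "finite I" and a: "\<And>i. i \<in> I \<Longrightarrow> a i > 0" and sum: "(\<Sum>i\<in>I. a i) = 1"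
  shows "(\<Prod>i\<in>I. epow (y i) (a i)) \<le> (\<Sum>i\<in>I. ennreal (a i) * y i)"
proof -
  have ne: "I \<noteq> {}" using sum by auto
  consider "\<exists>i\<in>I. y i = \<infinity>" | "\<exists>i\<in>I. y i = 0" | "\<forall>i\<in>I. y i \<noteq> \<infinity> \<and> y i \<noteq> 0" by blast
  then show ?thesis
  proof cases
    case 1
    then obtain i where i: "i \<in> I" "y i = \<infinity>" by blast
    have "ennreal (a i) * y i \<le> (\<Sum>i\<in>I. ennreal (a i) * y i)"
      using assms(1) i(1) by (intro member_le_sum) auto
    then have "(\<Sum>i\<in>I. ennreal (a i) * y i) = \<infinity>"
      using i a[OF i(1)] by (simp add: ennreal_mult_top top_unique)
    then show ?thesis by simp
  next
    case 2
    then have "(\<Prod>i\<in>I. epow (y i) (a i)) = 0" using assms(1) by (auto intro!: prod_zero)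
    then show ?thesis by (metis zero_le)
  next
    case 3
    define z where "z i = enn2real (y i)" for i
    have y: "y i = ennreal (z i)" "z i > 0" if "i \<in> I" for i
      using 3 that by (cases "y i"; auto simp: z_def)+
    have zi: "(\<Sum>i\<in>I. a i * z i) > 0"
      using y a ne assms(1) by (intro sum_pos) auto
    have "ln (\<Sum>i\<in>I. a i *\<^sub>R z i) \<ge> (\<Sum>i\<in>I. a i * ln (z i))"
      using assms y ne by (intro concave_on_sum[OF assms(1) _ ln_concave]) (auto intro: less_imp_le)
    then have "exp (\<Sum>i\<in>I. a i * ln (z i)) \<le> (\<Sum>i\<in>I. a i * z i)"
      using zi by (simp add: ln_ge_iff)
    then have *: "(\<Prod>i\<in>I. z i powr a i) \<le> (\<Sum>i\<in>I. a i * z i)"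
      using y(2) assms(1) by (simp add: exp_sum powr_def order_less_imp_not_eq2 cong: prod.cong)
    have "(\<Prod>i\<in>I. epow (y i) (a i)) = (\<Prod>i\<in>I. ennreal (z i powr a i))"
      using y by (intro prod.cong) (auto simp: less_imp_le)
    also have "\<dots> = ennreal (\<Prod>i\<in>I. z i powr a i)"
      by (simp add: prod_ennreal)
    also have "\<dots> \<le> ennreal (\<Sum>i\<in>I. a i * z i)"
      using * by (rule ennreal_leI)
    also have "\<dots> = (\<Sum>i\<in>I. ennreal (a i * z i))"
      using y a by (subst sum_ennreal) (auto simp: less_imp_le)
    also have "\<dots> = (\<Sum>i\<in>I. ennreal (a i) * y i)"
      using y a by (intro sum.cong) (auto simp: ennreal_mult less_imp_le)
    finally show ?thesis .
  qed
qed

text \<open>Dividing each function by its integral reduces the claim to the pointwise AM-GM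
  inequality, whose right side then integrates to the sum of the weights. A zero integral has to be
  dealt with before an infinite one, because 0 * \<infinity> = 0 in the product on the
  right.\<close>

lemma weighted_Holder:
  assumes "finite I" and a: "\<And>i. i \<in> I \<Longrightarrow> a i > 0" and sum: "(\<Sum>i\<in>I. a i) = 1"
    and [measurable]: "\<And>i. i \<in> I \<Longrightarrow> f i \<in> borel_measurable M"
  shows "(\<integral>\<^sup>+x. (\<Prod>i\<in>I. epow (f i x) (a i)) \<partial>M) \<le> (\<Prod>i\<in>I. epow (\<integral>\<^sup>+x. f i x \<partial>M) (a i))"
proof -
  define c where "c i = (\<integral>\<^sup>+x. f i x \<partial>M)" for i
  consider (z) "\<exists>i\<in>I. c i = 0" | (inf) "\<forall>i\<in>I. c i \<noteq> 0" "\<exists>i\<in>I. c i = \<infinity>"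
    | (fin) "\<forall>i\<in>I. c i \<noteq> 0 \<and> c i \<noteq> \<infinity>" by blast
  then show ?thesis
  proof cases
    case z
    then obtain i where i: "i \<in> I" "c i = 0" by blast
    have "AE x in M. f i x = 0"
      using i by (simp add: c_def nn_integral_0_iff_AE)
    then have "AE x in M. (\<Prod>i\<in>I. epow (f i x) (a i)) = 0"
      by eventually_elim (use assms(1) i in \<open>auto intro!: prod_zero\<close>)
    then have "(\<integral>\<^sup>+x. (\<Prod>i\<in>I. epow (f i x) (a i)) \<partial>M) = (\<integral>\<^sup>+x. 0 \<partial>M)"
      by (rule nn_integral_cong_AE)
    then show ?thesis by simp
  next
    case inf
    then obtain i where i: "i \<in> I" "c i = \<infinity>" by blast
    have "(\<Prod>i\<in>I. epow (c i) (a i)) = \<infinity>"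
      using i inf(1) assms(1) by (subst prod.remove[of _ i]) (auto simp: ennreal_top_mult)
    then show ?thesis by (simp add: c_def)
  next
    case fin
    define k where "k i = enn2real (c i)" for i
    have c: "c i = ennreal (k i)" "k i > 0" if "i \<in> I" for i
      using fin that by (cases "c i"; auto simp: k_def)+
    have "(\<integral>\<^sup>+x. (\<Prod>i\<in>I. epow (f i x) (a i)) \<partial>M)
        = (\<integral>\<^sup>+x. (\<Prod>i\<in>I. epow (c i) (a i)) * (\<Prod>i\<in>I. epow (ennreal (1 / k i) * f i x) (a i)) \<partial>M)"
    proof (intro nn_integral_cong)
      fix x
      show "(\<Prod>i\<in>I. epow (f i x) (a i)) =
          (\<Prod>i\<in>I. epow (c i) (a i)) * (\<Prod>i\<in>I. epow (ennreal (1 / k i) * f i x) (a i))"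
        unfolding prod.distrib[symmetric]
      proof (intro prod.cong refl)
        fix i assume "i \<in> I"
        then have "c i * ennreal (1 / k i) = 1"
          using c[of i] by (simp add: ennreal_mult[symmetric])
        then have "f i x = c i * (ennreal (1 / k i) * f i x)"
          by (simp add: mult.assoc[symmetric])
        then show "epow (f i x) (a i) = epow (c i) (a i) * epow (ennreal (1 / k i) * f i x) (a i)"
          by (metis epow_mult)
      qed
    qed
    also have "\<dots> = (\<Prod>i\<in>I. epow (c i) (a i)) * (\<integral>\<^sup>+x. (\<Prod>i\<in>I. epow (ennreal (1 / k i) * f i x) (a i)) \<partial>M)"
      by (rule nn_integral_cmult) measurable
    also have "\<dots> \<le> (\<Prod>i\<in>I. epow (c i) (a i)) * (\<integral>\<^sup>+x. (\<Sum>i\<in>I. ennreal (a i) * (ennreal (1 / k i) * f i x)) \<partial>M)"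
      by (intro mult_left_mono nn_integral_mono weighted_AM_GM_ennreal assms) auto
    also have "(\<integral>\<^sup>+x. (\<Sum>i\<in>I. ennreal (a i) * (ennreal (1 / k i) * f i x)) \<partial>M) = (\<Sum>i\<in>I. ennreal (a i) * (ennreal (1 / k i) * c i))"
      by (simp add: nn_integral_sum nn_integral_cmult c_def)
    also have "\<dots> = (\<Sum>i\<in>I. ennreal (a i))"
    proof (intro sum.cong refl)
      fix i assume "i \<in> I"
      then have "ennreal (1 / k i) * c i = 1"
        using c[of i] by (simp add: ennreal_mult[symmetric])
      then show "ennreal (a i) * (ennreal (1 / k i) * c i) = ennreal (a i)" by simp
    qed
    also have "\<dots> = 1"
      using a sum by (subst sum_ennreal) (auto simp: less_imp_le)
    finally show ?thesis by (simp add: c_def)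
  qed
qed

lemma Holder_epow:
  assumes "0 < a" "a < 1" and [measurable]: "f \<in> borel_measurable M" "g \<in> borel_measurable M"
  shows "(\<integral>\<^sup>+x. epow (f x) a * epow (g x) (1 - a) \<partial>M) \<le> epow (\<integral>\<^sup>+x. f x \<partial>M) a * epow (\<integral>\<^sup>+x. g x \<partial>M) (1 - a)"
proof -
  have "(\<integral>\<^sup>+x. (\<Prod>i\<in>UNIV. epow ((if i then f else g) x) (if i then a else 1 - a)) \<partial>M)
      \<le> (\<Prod>i\<in>UNIV. epow (\<integral>\<^sup>+x. (if i then f else g) x \<partial>M) (if i then a else 1 - a))"
    using assms(1,2) by (intro weighted_Holder) (auto simp: UNIV_bool)
  then show ?thesis by (simp add: UNIV_bool mult.commute)
qed

lemma Cauchy_Schwarz_ennreal: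
  assumes [measurable]: "f \<in> borel_measurable M" "g \<in> borel_measurable M"
  shows "(\<integral>\<^sup>+x. f x * g x \<partial>M) \<le> epow (\<integral>\<^sup>+x. (f x)\<^sup>2 \<partial>M) (1/2) * epow (\<integral>\<^sup>+x. (g x)\<^sup>2 \<partial>M) (1/2)"
proof -
  have "epow (y\<^sup>2) (1/2) = y" for y by (simp add: epow_2[symmetric] epow_epow)
  then show ?thesis
    using Holder_epow[of "1/2" "\<lambda>x. (f x)\<^sup>2" M "\<lambda>x. (g x)\<^sup>2"] by simp
qed

section \<open>Smooth functions and test functions\<close>

text \<open>The smooth functions form the largest set of differentiable functions that is closed
  under partial derivatives. Exhibiting any such set replaces an induction over lists of
  directions.\<close>

lemma smooth_coinduct:
  assumes "f \<in> S" and "\<And>f x. f \<in> S \<Longrightarrow> f differentiable (at x)"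
    and "\<And>f i. f \<in> S \<Longrightarrow> partial_deriv i f \<in> S"
  shows "smooth f"
proof -
  have "foldr partial_deriv is f \<in> S" for "is"
    by (induction "is") (auto simp: assms)
  then show ?thesis by (auto simp: smooth_def assms)
qed

lemma smooth_differentiable: "smooth f \<Longrightarrow> f differentiable (at x)"
  unfolding smooth_def by (metis foldr.simps(1) id_apply)

lemma smooth_partial_deriv: "smooth f \<Longrightarrow> smooth (partial_deriv i f)"
  unfolding smooth_def
proof (intro allI)
  fix "is" x
  assume "\<forall>is x. foldr partial_deriv is f differentiable at x"
  \<comment> \<open>\<open>foldr\<close> applies the last list element first, so the additional
    derivative goes to the end of the list.\<close>
  then have "foldr partial_deriv (is @ [i]) f differentiable at x" by blast
  then show "foldr partial_deriv is (partial_deriv i f) differentiable at x" by simp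
qed

lemma smooth_has_derivative: "smooth f \<Longrightarrow> (f has_derivative frechet_derivative f (at x)) (at x)"
  using smooth_differentiable frechet_derivative_works by blast

lemma smooth_continuous: "smooth f \<Longrightarrow> continuous_on S f"
  using smooth_differentiable
  by (meson continuous_at_imp_continuous_on differentiable_imp_continuous_within)

lemma partial_deriv_eq: "(f has_derivative f') (at x) \<Longrightarrow> partial_deriv i f x = f' (axis i 1)"
  unfolding partial_deriv_def by (metis frechet_derivative_at)

lemma partial_deriv_add:
  "f differentiable (at x) \<Longrightarrow> g differentiable (at x) \<Longrightarrow>
    partial_deriv i (\<lambda>x. f x + g x) x = partial_deriv i f x + partial_deriv i g x"
  unfolding frechet_derivative_works
  by (subst partial_deriv_eq, rule has_derivative_add) (simp_all add: partial_deriv_def)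

lemma partial_deriv_mult:
  "f differentiable (at x) \<Longrightarrow> g differentiable (at x) \<Longrightarrow>
    partial_deriv i (\<lambda>x. f x * g x) x = f x * partial_deriv i g x + partial_deriv i f x * g x"
  unfolding frechet_derivative_works
  by (subst partial_deriv_eq, rule has_derivative_mult) (simp_all add: partial_deriv_def)

lemma partial_deriv_linear:
  assumes "bounded_linear h" "f differentiable (at x)"
  shows "partial_deriv i (\<lambda>x. h (f x)) x = h (partial_deriv i f x)"
  using assms(2) unfolding frechet_derivative_works
  by (subst partial_deriv_eq, rule bounded_linear.has_derivative[OF assms(1)])
     (simp_all add: partial_deriv_def)

lemma partial_deriv_affine:
  assumes "f differentiable (at (a + c *\<^sub>R x))"
  shows "partial_deriv i (\<lambda>x. f (a + c *\<^sub>R x)) x = of_real c * partial_deriv i f (a + c *\<^sub>R x)"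
    (is ?A) and "(\<lambda>x. f (a + c *\<^sub>R x)) differentiable (at x)" (is ?B)
proof -
  let ?f' = "frechet_derivative f (at (a + c *\<^sub>R x))"
  have d: "(f has_derivative ?f') (at (a + c *\<^sub>R x))"
    using assms by (simp add: frechet_derivative_works)
  have "((\<lambda>x. a + c *\<^sub>R x) has_derivative (\<lambda>h. c *\<^sub>R h)) (at x)"
    by (auto intro!: derivative_eq_intros)
  from has_derivative_compose[OF this d]
  have *: "((\<lambda>x. f (a + c *\<^sub>R x)) has_derivative (\<lambda>h. ?f' (c *\<^sub>R h))) (at x)" .
  have lin: "linear ?f'" using d has_derivative_linear by blast
  show ?A unfolding partial_deriv_eq[OF *] linear_scale[OF lin]
    by (simp add: partial_deriv_def scaleR_conv_of_real)
  show ?B using * differentiable_def by blast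
qed

lemma partial_deriv_const [simp]: "partial_deriv i (\<lambda>x. c) x = 0"
  by (subst partial_deriv_eq, rule has_derivative_const) simp

lemma partial_deriv_const_fun: "partial_deriv i (\<lambda>x. c) = (\<lambda>x. 0)"
  by (rule ext) simp

lemma smooth_const: "smooth (\<lambda>x. c)"
  by (rule smooth_coinduct[of _ "range (\<lambda>c x. c)"]) (auto simp: partial_deriv_const_fun)

lemma smooth_bounded_linear:
  fixes L :: "real^'n \<Rightarrow> complex"
  assumes "bounded_linear L"
  shows "smooth L"
proof (rule smooth_coinduct[of _ "insert L (range (\<lambda>c x. c))"])
  have d: "(L has_derivative L) (at x)" for x
    by (rule bounded_linear_imp_has_derivative[OF assms])
  have pd: "partial_deriv i L = (\<lambda>x. L (axis i 1))" for i
    by (rule ext) (rule partial_deriv_eq[OF d])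
  fix f :: "real^'n \<Rightarrow> complex" and i x assume f: "f \<in> insert L (range (\<lambda>c x. c))"
  then show "f differentiable at x" using d by (auto intro: differentiableI)
  show "partial_deriv i f \<in> insert L (range (\<lambda>c x. c))"
    using f pd by (auto simp: partial_deriv_const_fun)
qed simp

lemma bounded_linear_coord: "bounded_linear (\<lambda>x::real^'n. complex_of_real (x $ j))"
  by (rule bounded_linear_compose[OF bounded_linear_of_real bounded_linear_vec_nth])

lemma smooth_coord: "smooth (\<lambda>x::real^'n. complex_of_real (x $ j))"
  by (rule smooth_bounded_linear[OF bounded_linear_coord])

lemma partial_deriv_coord:
  "partial_deriv i (\<lambda>x::real^'n. complex_of_real (x $ j)) x = (if i = j then 1 else 0)"
  by (subst partial_deriv_eq[OF bounded_linear_imp_has_derivative[OF bounded_linear_coord]]) (auto simp: axis_def)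

lemma smooth_linear:
  assumes "bounded_linear h" "smooth f"
  shows "smooth (\<lambda>x. h (f x))"
proof (rule smooth_coinduct[of _ "{\<lambda>x. h (f x) |f. smooth f}"])
  fix g :: "real^'n \<Rightarrow> complex" and i x assume "g \<in> {\<lambda>x. h (f x) |f. smooth f}"
  then obtain f where f: "smooth f" "g = (\<lambda>x. h (f x))" by blast
  show "g differentiable (at x)" unfolding f
    using bounded_linear.has_derivative[OF assms(1) smooth_has_derivative[OF f(1)]] differentiable_def by blast
  have "partial_deriv i g = (\<lambda>x. h (partial_deriv i f x))" unfolding f
    by (rule ext) (rule partial_deriv_linear[OF assms(1) smooth_differentiable[OF f(1)]])
  then show "partial_deriv i g \<in> {\<lambda>x. h (f x) |f. smooth f}" 
    using smooth_partial_deriv[OF f(1)] by blast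
qed (use assms in auto)

lemma smooth_affine:
  fixes f :: "real^'n \<Rightarrow> complex"
  assumes "smooth f"
  shows "smooth (\<lambda>x. f (a + c *\<^sub>R x))"
proof (rule smooth_coinduct[of _ "{\<lambda>x. f (a + c *\<^sub>R x) |f. smooth f}"])
  fix g :: "real^'n \<Rightarrow> complex" and i x assume "g \<in> {\<lambda>x. f (a + c *\<^sub>R x) |f. smooth f}"
  then obtain f where f: "smooth f" "g = (\<lambda>x. f (a + c *\<^sub>R x))" by blast
  show "g differentiable (at x)" unfolding f
    by (rule partial_deriv_affine smooth_differentiable[OF f(1)])+
  have "partial_deriv i g = (\<lambda>x. of_real c * partial_deriv i f (a + c *\<^sub>R x))" unfolding f
    by (rule ext) (rule partial_deriv_affine smooth_differentiable[OF f(1)])+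
  moreover have "smooth (\<lambda>x. of_real c * partial_deriv i f x)"
    by (rule smooth_linear[OF bounded_linear_mult_right smooth_partial_deriv[OF f(1)]])
  ultimately show "partial_deriv i g \<in> {\<lambda>x. f (a + c *\<^sub>R x) |f. smooth f}"
    by (auto intro!: exI[of _ "\<lambda>x. of_real c * partial_deriv i f x"])
qed (use assms in auto)

text \<open>The Leibniz rule leads from a product to a sum of products, so coinduction needs a set
  closed under both operations. The algebra generated by \<open>G\<close> together with all smooth
  functions is closed under partial derivatives as soon as the derivatives of the generators lie in
  it.\<close>

inductive_set gen_algebra :: "(real^'n \<Rightarrow> complex) set \<Rightarrow> (real^'n \<Rightarrow> complex) set" for G where
  generator: "f \<in> G \<Longrightarrow> f \<in> gen_algebra G"
| smooth: "smooth f \<Longrightarrow> f \<in> gen_algebra G"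
| add: "f \<in> gen_algebra G \<Longrightarrow> g \<in> gen_algebra G \<Longrightarrow> (\<lambda>x. f x + g x) \<in> gen_algebra G"
| mult: "f \<in> gen_algebra G \<Longrightarrow> g \<in> gen_algebra G \<Longrightarrow> (\<lambda>x. f x * g x) \<in> gen_algebra G"

lemma gen_algebra_smooth:
  assumes G: "\<And>f x. f \<in> G \<Longrightarrow> f differentiable (at x)" "\<And>f i. f \<in> G \<Longrightarrow> partial_deriv i f \<in> gen_algebra G"
    and f: "f \<in> gen_algebra G"
  shows "smooth f"
proof -
  have *: "(\<forall>x. f differentiable (at x)) \<and> (\<forall>i. partial_deriv i f \<in> gen_algebra G)" if "f \<in> gen_algebra G" for f
    using that
  proof induction
    case (generator f)
    then show ?case using G by blast
  next
    case (smooth f)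
    then show ?case by (auto simp: smooth_differentiable intro!: gen_algebra.smooth smooth_partial_deriv)
  next
    case (add f g)
    have "partial_deriv i (\<lambda>x. f x + g x) = (\<lambda>x. partial_deriv i f x + partial_deriv i g x)" for i
      using add by (intro ext partial_deriv_add) auto
    then show ?case using add by (auto intro!: gen_algebra.add)
  next
    case (mult f g)
    have "partial_deriv i (\<lambda>x. f x * g x) = (\<lambda>x. f x * partial_deriv i g x + partial_deriv i f x * g x)" for i
      using mult by (intro ext partial_deriv_mult) auto
    then show ?case using mult by (auto intro!: gen_algebra.add gen_algebra.mult)
  qed
  show ?thesis by (rule smooth_coinduct[OF f]) (use * in auto)
qed

lemma smooth_add: "smooth f \<Longrightarrow> smooth g \<Longrightarrow> smooth (\<lambda>x. f x + g x)"
  and smooth_mult: "smooth f \<Longrightarrow> smooth g \<Longrightarrow> smooth (\<lambda>x. f x * g x)"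
  by (rule gen_algebra_smooth[of "{}"]; auto intro: gen_algebra.intros)+

lemma smooth_uminus: "smooth f \<Longrightarrow> smooth (\<lambda>x. - f x)"
  by (rule smooth_linear[OF bounded_linear_minus[OF bounded_linear_ident]])

lemma smooth_diff: "smooth f \<Longrightarrow> smooth g \<Longrightarrow> smooth (\<lambda>x. f x - g x)"
  using smooth_add[OF _ smooth_uminus] by fastforce

lemma partial_deriv_diff:
  "f differentiable (at x) \<Longrightarrow> g differentiable (at x) \<Longrightarrow>
    partial_deriv i (\<lambda>x. f x - g x) x = partial_deriv i f x - partial_deriv i g x"
  unfolding frechet_derivative_works
  by (subst partial_deriv_eq, rule has_derivative_diff) (simp_all add: partial_deriv_def)

lemma smooth_cnj: "smooth f \<Longrightarrow> smooth (\<lambda>x. cnj (f x))"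
  by (rule smooth_linear[OF bounded_linear_cnj])

lemma smooth_sum: "(\<And>i. i \<in> A \<Longrightarrow> smooth (f i)) \<Longrightarrow> smooth (\<lambda>x. \<Sum>i\<in>A. f i x)"
  by (induction A rule: infinite_finite_induct) (auto simp: smooth_const intro!: smooth_add)

text \<open>The algebra generated by the smooth functions, \<open>s\<close> and \<open>1/s\<close> is closed under partial
  derivatives, because \<open>\<partial>\<^sub>i s = \<partial>\<^sub>i (s\<^sup>2) / (2 s)\<close>.\<close>

lemma smooth_root:
  fixes s :: "real^'n \<Rightarrow> real"
  assumes s: "smooth (\<lambda>x. (complex_of_real (s x))\<^sup>2)" and pos: "\<And>x. s x > 0"
  shows "smooth (\<lambda>x. complex_of_real (s x))"
    and "partial_deriv i (\<lambda>x. complex_of_real (s x)) x =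
      partial_deriv i (\<lambda>x. (complex_of_real (s x))\<^sup>2) x / (2 * complex_of_real (s x))"
proof -
  let ?g = "\<lambda>x. (complex_of_real (s x))\<^sup>2"
  let ?s = "\<lambda>x. complex_of_real (s x)" and ?i = "\<lambda>x. complex_of_real (1 / s x)"
  let ?D = "\<lambda>x. frechet_derivative ?g (at x)"
  have ne: "s x \<noteq> 0" for x using pos[of x] by simp
  have D: "((\<lambda>x. (s x)\<^sup>2) has_derivative (\<lambda>h. Re (?D x h))) (at x)" for x
    using bounded_linear.has_derivative[OF bounded_linear_Re smooth_has_derivative[OF s, of x]]
    by (simp add: power2_eq_square)
  have sq: "sqrt ((s x)\<^sup>2) = s x" for x using pos[of x] by simp
  have Ds: "(s has_derivative (\<lambda>h. Re (?D x h) / (2 * s x))) (at x)" for x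
  proof -
    have "(s x)\<^sup>2 > 0" using pos[of x] by simp
    from has_derivative_compose[OF D has_field_derivative_imp_has_derivative[OF DERIV_real_sqrt[OF this]]]
    have "((\<lambda>x. sqrt ((s x)\<^sup>2)) has_derivative (\<lambda>h. Re (?D x h) / (2 * s x))) (at x)"
      by (simp only: sq) (simp add: field_simps)
    then show ?thesis by (simp only: sq)
  qed
  \<comment> \<open>The square takes real values, so by uniqueness of the derivative its complex
    derivative is real too. This removes the \<open>Re\<close> that the rule for the real square
    root introduced.\<close>
  have real: "?D x h = of_real (Re (?D x h))" for x h
  proof -
    have "((\<lambda>x. complex_of_real ((s x)\<^sup>2)) has_derivative (\<lambda>h. of_real (Re (?D x h)))) (at x)"
      by (intro bounded_linear.has_derivative[OF bounded_linear_of_real] D)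
    then have "?D x = (\<lambda>h. of_real (Re (?D x h)))"
      using frechet_derivative_at by (simp add: of_real_power) force
    then show ?thesis by metis
  qed
  have Dcs: "(?s has_derivative (\<lambda>h. of_real (Re (?D x h) / (2 * s x)))) (at x)" for x
    by (intro bounded_linear.has_derivative[OF bounded_linear_of_real] Ds)
  have Dci: "(?i has_derivative (\<lambda>h. of_real (- (Re (?D x h) / (2 * s x)) / (s x)\<^sup>2))) (at x)" for x
    using ne by (intro bounded_linear.has_derivative[OF bounded_linear_of_real])
      (auto intro!: derivative_eq_intros Ds simp: power2_eq_square)
  have 1: "partial_deriv i ?s x = partial_deriv i ?g x / (2 * ?s x)" for i x
    unfolding partial_deriv_eq[OF Dcs] unfolding partial_deriv_def using real[of x "axis i 1"] by simp
  have 2: "partial_deriv i ?i x = - (partial_deriv i ?g x / (2 * ?s x) / (?s x)\<^sup>2)" for i x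
    unfolding partial_deriv_eq[OF Dci] unfolding partial_deriv_def using real[of x "axis i 1"] by simp
  show "partial_deriv i ?s x = partial_deriv i ?g x / (2 * ?s x)" by (rule 1)
  have mem: "?i \<in> gen_algebra {?s, ?i}" "(\<lambda>x. c * partial_deriv i ?g x) \<in> gen_algebra {?s, ?i}" for c i
    by (rule gen_algebra.generator, simp, intro gen_algebra.smooth smooth_mult smooth_const smooth_partial_deriv s)
  have m1: "partial_deriv i ?s \<in> gen_algebra {?s, ?i}" for i
  proof -
    have eq: "partial_deriv i ?s = (\<lambda>x. (1/2 * partial_deriv i ?g x) * ?i x)"
      by (rule ext) (simp add: 1)
    show ?thesis unfolding eq by (rule gen_algebra.mult[OF mem(2) mem(1)])
  qed
  have m2: "partial_deriv i ?i \<in> gen_algebra {?s, ?i}" for i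
  proof -
    have eq: "partial_deriv i ?i = (\<lambda>x. (-1/2 * partial_deriv i ?g x) * (?i x * (?i x * ?i x)))"
    proof (rule ext)
      fix x
      have "- (A / (2 * of_real t) / (of_real t)\<^sup>2) = (-1/2 * A) * (of_real (1 / t) * (of_real (1 / t) * of_real (1 / t)))"
        for A :: complex and t :: real by (simp add: power2_eq_square)
      then show "partial_deriv i ?i x = (-1/2 * partial_deriv i ?g x) * (?i x * (?i x * ?i x))"
        unfolding 2 .
    qed
    show ?thesis unfolding eq
      by (rule gen_algebra.mult[OF mem(2) gen_algebra.mult[OF mem(1) gen_algebra.mult[OF mem(1) mem(1)]]])
  qed
  show "smooth ?s"
  proof (rule gen_algebra_smooth[of "{?s, ?i}"])
    fix f :: "real^'n \<Rightarrow> complex" and x assume "f \<in> {?s, ?i}"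
    then show "f differentiable at x"
      using Dcs Dci by (auto simp: differentiable_def)
  next
    fix f :: "real^'n \<Rightarrow> complex" and i assume "f \<in> {?s, ?i}"
    then show "partial_deriv i f \<in> gen_algebra {?s, ?i}" using m1 m2 by auto
  qed (auto intro: gen_algebra.generator)
qed

text \<open>Any compact subset of \<open>D\<close> outside which \<psi> vanishes contains the closed
  support, which is then compact itself. Closure properties thus only have to produce some compact
  set.\<close>

lemma test_functions_iff:
  "\<psi> \<in> test_functions D \<longleftrightarrow> smooth \<psi> \<and> (\<exists>K. compact K \<and> K \<subseteq> D \<and> (\<forall>x. x \<notin> K \<longrightarrow> \<psi> x = 0))"
proof
  assume "\<psi> \<in> test_functions D"
  then show "smooth \<psi> \<and> (\<exists>K. compact K \<and> K \<subseteq> D \<and> (\<forall>x. x \<notin> K \<longrightarrow> \<psi> x = 0))"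
    using closure_subset[of "{x. \<psi> x \<noteq> 0}"] unfolding test_functions_def by blast
next
  assume *: "smooth \<psi> \<and> (\<exists>K. compact K \<and> K \<subseteq> D \<and> (\<forall>x. x \<notin> K \<longrightarrow> \<psi> x = 0))"
  then obtain K where K: "compact K" "K \<subseteq> D" "\<forall>x. x \<notin> K \<longrightarrow> \<psi> x = 0" by blast
  then have "closure {x. \<psi> x \<noteq> 0} \<subseteq> K"
    by (intro closure_minimal) (auto intro: compact_imp_closed)
  moreover have "compact (closure {x. \<psi> x \<noteq> 0})"
    using calculation K(1) by (metis closed_closure compact_Int_closed inf.absorb_iff2)
  ultimately show "\<psi> \<in> test_functions D"
    using * K by (auto simp: test_functions_def)
qed

lemma test_functions_smooth: "\<psi> \<in> test_functions D \<Longrightarrow> smooth \<psi>"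
  by (simp add: test_functions_def)

lemma test_functions_outside: "\<psi> \<in> test_functions D \<Longrightarrow> x \<notin> D \<Longrightarrow> \<psi> x = 0"
  by (auto simp: test_functions_iff)

lemma test_functions_add:
  assumes "f \<in> test_functions D" "g \<in> test_functions D"
  shows "(\<lambda>x. f x + g x) \<in> test_functions D"
proof -
  obtain K L where "compact K" "K \<subseteq> D" "\<forall>x. x \<notin> K \<longrightarrow> f x = 0" "compact L" "L \<subseteq> D" "\<forall>x. x \<notin> L \<longrightarrow> g x = 0"
    using assms by (auto simp: test_functions_iff)
  then show ?thesis using assms
    by (auto simp: test_functions_iff intro!: smooth_add exI[of _ "K \<union> L"])
qed

lemma test_functions_mult:
  assumes "f \<in> test_functions D" "smooth g"
  shows "(\<lambda>x. f x * g x) \<in> test_functions D" "(\<lambda>x. g x * f x) \<in> test_functions D"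
  using assms by (auto simp: test_functions_iff intro!: smooth_mult)

lemma test_functions_linear:
  assumes "bounded_linear h" "f \<in> test_functions D"
  shows "(\<lambda>x. h (f x)) \<in> test_functions D"
proof -
  have "h 0 = 0" using assms(1) by (rule linear_simps(3))
  then show ?thesis
    using assms smooth_linear[OF assms(1)] unfolding test_functions_iff by auto
qed

lemmas test_functions_cnj = test_functions_linear[OF bounded_linear_cnj]

lemma test_functions_diff:
  assumes "f \<in> test_functions D" "g \<in> test_functions D"
  shows "(\<lambda>x. f x - g x) \<in> test_functions D"
  using test_functions_add[OF assms(1) test_functions_linear[OF bounded_linear_minus[OF bounded_linear_ident] assms(2)]]
  by simp

lemma partial_deriv_locally_zero:
  assumes "open U" "x \<in> U" "\<And>y. y \<in> U \<Longrightarrow> f y = 0"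
  shows "partial_deriv i f x = 0"
proof -
  have "((\<lambda>x. 0::complex) has_derivative (\<lambda>h. 0)) (at x)" by simp
  then have "(f has_derivative (\<lambda>h. 0)) (at x)"
    by (rule has_derivative_transform_within_open[OF _ assms(1,2)]) (simp add: assms)
  then show ?thesis by (simp add: partial_deriv_eq)
qed

lemma test_functions_partial_deriv:
  assumes "f \<in> test_functions D"
  shows "partial_deriv i f \<in> test_functions D"
proof -
  obtain K where K: "compact K" "K \<subseteq> D" "\<And>x. x \<notin> K \<Longrightarrow> f x = 0" "smooth f"
    using assms by (auto simp: test_functions_iff)
  have "partial_deriv i f x = 0" if "x \<notin> K" for x
    by (rule partial_deriv_locally_zero[of "- K"]) (use K that in \<open>auto intro: compact_imp_closed\<close>)
  then show ?thesis using K smooth_partial_deriv by (auto simp: test_functions_iff)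
qed

section \<open>Integration by parts\<close>

lemma test_functions_continuous: "\<psi> \<in> test_functions D \<Longrightarrow> continuous_on S \<psi>"
  by (simp add: smooth_continuous test_functions_smooth)

lemma smooth_borel_measurable: "smooth f \<Longrightarrow> f \<in> borel_measurable borel"
  by (simp add: smooth_continuous borel_measurable_continuous_onI)

lemma test_functions_borel_measurable: "\<psi> \<in> test_functions D \<Longrightarrow> \<psi> \<in> borel_measurable borel"
  by (simp add: smooth_borel_measurable test_functions_smooth)

lemma test_functions_bounded_support:
  assumes "\<psi> \<in> test_functions D"
  obtains R where "R > 0" "\<And>x. norm x > R \<Longrightarrow> \<psi> x = 0"
proof -
  obtain K where K: "compact K" "\<forall>x. x \<notin> K \<longrightarrow> \<psi> x = 0"
    using assms by (auto simp: test_functions_iff)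
  then obtain R where "R > 0" "\<forall>x\<in>K. norm x \<le> R"
    using bounded_pos compact_imp_bounded by metis
  with K show ?thesis by (intro that[of R]) (auto simp: not_le[symmetric])
qed

lemma test_functions_bounded:
  assumes "\<psi> \<in> test_functions D"
  obtains B where "B > 0" "\<And>x. norm (\<psi> x) \<le> B"
proof -
  obtain K where K: "compact K" "\<forall>x. x \<notin> K \<longrightarrow> \<psi> x = 0"
    using assms by (auto simp: test_functions_iff)
  have "bounded (\<psi> ` K)"
    by (intro compact_imp_bounded compact_continuous_image K test_functions_continuous[OF assms])
  then obtain B where "B > 0" "\<forall>x\<in>K. norm (\<psi> x) \<le> B"
    by (auto simp: bounded_pos)
  with K show ?thesis by (intro that[of B]) (metis less_imp_le norm_zero)+
qed

lemma integrable_continuous_compact_support: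
  fixes f :: "'a::euclidean_space \<Rightarrow> 'b::{banach, second_countable_topology}"
  assumes "continuous_on UNIV f" "\<And>x. norm x > R \<Longrightarrow> f x = 0"
  shows "integrable lborel f"
proof -
  have "integrable lborel (\<lambda>x. indicator (cball 0 R) x *\<^sub>R f x)"
    by (intro borel_integrable_compact compact_cball continuous_on_subset[OF assms(1)]) auto
  moreover have "(\<lambda>x. indicator (cball 0 R) x *\<^sub>R f x) = f"
    using assms(2) by (auto simp: indicator_def fun_eq_iff not_le[symmetric])
  ultimately show ?thesis by simp
qed

lemma test_functions_integrable:
  assumes "\<psi> \<in> test_functions D"
  shows "integrable lborel \<psi>"
  using test_functions_bounded_support[OF assms] integrable_continuous_compact_support
    test_functions_continuous[OF assms] by metis

lemma integral_lborel_translate: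
  fixes f :: "'a::euclidean_space \<Rightarrow> 'b::{banach, second_countable_topology}"
  assumes "f \<in> borel_measurable borel"
  shows "(LINT x|lborel. f (x + a)) = (LINT x|lborel. f x)"
proof -
  have "(LINT x|lborel. f x) = (LINT x|distr lborel borel ((+) a). f x)"
    by (simp add: lborel_distr_plus)
  also have "\<dots> = (LINT x|lborel. f (a + x))"
    by (rule integral_distr) (use assms in auto)
  finally show ?thesis by (simp add: add.commute)
qed

lemma partial_deriv_line:
  assumes "f differentiable (at (x + t *\<^sub>R axis i 1))"
  shows "((\<lambda>t. f (x + t *\<^sub>R axis i 1)) has_vector_derivative partial_deriv i f (x + t *\<^sub>R axis i 1)) (at t within S)"
proof -
  let ?y = "x + t *\<^sub>R axis i 1"
  have d: "(f has_derivative frechet_derivative f (at ?y)) (at ?y)"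
    using assms by (simp add: frechet_derivative_works)
  have lin: "linear (frechet_derivative f (at ?y))" using d has_derivative_linear by blast
  have "((\<lambda>t. x + t *\<^sub>R axis i 1) has_derivative (\<lambda>h. h *\<^sub>R axis i 1)) (at t within S)"
    by (auto intro!: derivative_eq_intros)
  from has_derivative_compose[OF this d] show ?thesis
    by (simp add: has_vector_derivative_def partial_deriv_def linear_scale[OF lin])
qed

lemma has_vector_derivative_quotient:
  fixes f :: "'a::real_normed_vector \<Rightarrow> 'b::real_normed_vector"
  assumes "((\<lambda>t. f (x + t *\<^sub>R a)) has_vector_derivative v) (at 0)"
  shows "((\<lambda>t. (f (x + t *\<^sub>R a) - f x) /\<^sub>R t) \<longlongrightarrow> v) (at 0)"
proof -
  let ?q = "\<lambda>t. (f (x + t *\<^sub>R a) - f x) /\<^sub>R t"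
  have "((\<lambda>t. (1 / norm t) *\<^sub>R (f (x + t *\<^sub>R a) - (f x + t *\<^sub>R v))) \<longlongrightarrow> 0) (at 0)"
    using assms by (auto simp: has_vector_derivative_def has_derivative_within)
  then have "((\<lambda>t. norm ((1 / norm t) *\<^sub>R (f (x + t *\<^sub>R a) - (f x + t *\<^sub>R v)))) \<longlongrightarrow> 0) (at 0)"
    by (rule tendsto_norm_zero)
  moreover have "norm ((1 / norm t) *\<^sub>R (f (x + t *\<^sub>R a) - (f x + t *\<^sub>R v))) = norm (?q t - v)" if "t \<noteq> 0" for t
  proof -
    have "?q t - v = (f (x + t *\<^sub>R a) - (f x + t *\<^sub>R v)) /\<^sub>R t"
      using that by (simp add: algebra_simps)
    then show ?thesis by (simp add: divide_inverse)
  qed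
  ultimately have "((\<lambda>t. norm (?q t - v)) \<longlongrightarrow> 0) (at 0)"
    by (subst (asm) tendsto_cong[of _ "\<lambda>t. norm (?q t - v)"]) (auto simp: eventually_at_filter)
  then show ?thesis by (simp add: tendsto_norm_zero_iff LIM_zero_iff)
qed

text \<open>By translation invariance the difference quotients in direction i have integral 0, and
  they converge pointwise to the partial derivative. The steps are at most 1, so all quotients
  vanish outside the ball of radius R + 1, and the mean value inequality bounds them by B there:
  dominated convergence applies.\<close>

lemma integral_partial_deriv_eq_0:
  fixes f :: "real^'n \<Rightarrow> complex"
  assumes f: "f \<in> test_functions D"
  shows "(LINT x|lborel. partial_deriv i f x) = 0"
proof -
  let ?e = "axis i 1 :: real^'n"
  obtain R where R: "R > 0" "\<And>x. norm x > R \<Longrightarrow> f x = 0"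
    using test_functions_bounded_support[OF f] by blast
  obtain B where B: "B > 0" "\<And>x. norm (partial_deriv i f x) \<le> B"
    using test_functions_bounded[OF test_functions_partial_deriv[OF f]] by blast
  have [measurable]: "f \<in> borel_measurable borel" "partial_deriv i f \<in> borel_measurable borel"
    by (auto intro: test_functions_borel_measurable f test_functions_partial_deriv)
  define h where "h m = inverse (real (Suc m))" for m
  have h: "0 < h m" "h m \<le> 1" for m by (auto simp: h_def field_simps)
  have hlim: "h \<longlonglongrightarrow> 0" unfolding h_def by (rule LIMSEQ_inverse_real_of_nat)
  let ?q = "\<lambda>m x. (f (x + h m *\<^sub>R ?e) - f x) /\<^sub>R h m"
  have vd: "((\<lambda>t. f (x + t *\<^sub>R ?e)) has_vector_derivative partial_deriv i f (x + t *\<^sub>R ?e)) (at t within S)" for x t S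
    by (rule partial_deriv_line[OF smooth_differentiable[OF test_functions_smooth[OF f]]])
  have "(\<lambda>m. LINT x|lborel. ?q m x) \<longlonglongrightarrow> (LINT x|lborel. partial_deriv i f x)"
  proof (rule integral_dominated_convergence[where w = "\<lambda>x. indicator (cball 0 (R + 1)) x * B"])
    show "integrable lborel (\<lambda>x::real^'n. indicator (cball 0 (R + 1)) x * B)"
      using emeasure_bounded_finite[OF bounded_cball, of "0::real^'n" "R + 1"]
      by (intro integrable_mult_left integrable_real_indicator) auto
    show "AE x in lborel. (\<lambda>m. ?q m x) \<longlonglongrightarrow> partial_deriv i f x"
    proof (rule AE_I2)
      fix x
      have "((\<lambda>t. f (x + t *\<^sub>R ?e)) has_vector_derivative partial_deriv i f x) (at 0)"
        using vd[of x 0 UNIV] by simp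
      then have "((\<lambda>t. (f (x + t *\<^sub>R ?e) - f x) /\<^sub>R t) \<longlongrightarrow> partial_deriv i f x) (at 0)"
        by (rule has_vector_derivative_quotient)
      moreover have "filterlim h (at 0) sequentially"
        using hlim h(1) by (auto simp: filterlim_at intro!: always_eventually) (metis less_irrefl)
      ultimately show "(\<lambda>m. ?q m x) \<longlonglongrightarrow> partial_deriv i f x"
        by (rule filterlim_compose)
    qed
    show "AE x in lborel. norm (?q m x) \<le> indicator (cball 0 (R + 1)) x * B" for m
    proof (rule AE_I2)
      fix x :: "real^'n"
      show "norm (?q m x) \<le> indicator (cball 0 (R + 1)) x * B"
      proof (cases "norm x \<le> R + 1")
        case True
        have "norm ((\<lambda>t. f (x + t *\<^sub>R ?e)) (h m) - (\<lambda>t. f (x + t *\<^sub>R ?e)) 0) \<le> B * norm (h m - 0)"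
          by (rule differentiable_bound[of "{0..h m}" _ "\<lambda>t u. u *\<^sub>R partial_deriv i f (x + t *\<^sub>R ?e)"])
             (use h[of m] B(2) vd in \<open>auto simp: has_vector_derivative_def onorm_scaleR_left onorm_id less_imp_le\<close>)
        then have "norm (f (x + h m *\<^sub>R ?e) - f x) \<le> B * h m" using h(1)[of m] by simp
        then have "norm (?q m x) \<le> B" using h(1)[of m] by (simp add: pos_divide_le_eq divide_inverse_commute[symmetric] norm_scaleR)
        with True show ?thesis by simp
      next
        case False
        have "norm x \<le> norm (x + h m *\<^sub>R ?e) + norm (h m *\<^sub>R ?e)"
          by (metis add_diff_cancel norm_triangle_ineq4)
        then have "norm (x + h m *\<^sub>R ?e) > R" using False h[of m] by (simp add: norm_axis_1)
        then show ?thesis using False R by simp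
      qed
    qed
  qed measurable
  moreover have "(\<lambda>m. LINT x|lborel. ?q m x) = (\<lambda>m. 0)"
  proof (rule ext)
    fix m
    have i: "integrable lborel f" by (rule test_functions_integrable[OF f])
    have i2: "integrable lborel (\<lambda>x. f (x + h m *\<^sub>R ?e))"
    proof -
      have "continuous_on UNIV (\<lambda>x. f (x + h m *\<^sub>R ?e))"
        by (intro continuous_on_compose2[OF test_functions_continuous[OF f, of UNIV]] continuous_intros) auto
      moreover have "f (x + h m *\<^sub>R ?e) = 0" if "norm x > R + 1" for x
      proof -
        have "norm x \<le> norm (x + h m *\<^sub>R ?e) + norm (h m *\<^sub>R ?e)"
          by (metis add_diff_cancel norm_triangle_ineq4)
        then have "norm (x + h m *\<^sub>R ?e) > R" using that h[of m] by (simp add: norm_axis_1)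
        then show ?thesis using R by simp
      qed
      ultimately show ?thesis by (rule integrable_continuous_compact_support)
    qed
    show "(LINT x|lborel. ?q m x) = 0" using i i2 integral_lborel_translate[of f "h m *\<^sub>R ?e"] by simp
  qed
  ultimately show ?thesis by (metis LIMSEQ_const_iff)
qed

text \<open>The product g * f has compact support although only f does. This leaves room for
  polynomial factors g such as |x|^2.\<close>

lemma integration_by_parts:
  assumes "f \<in> test_functions D" "smooth g"
  shows "(LINT x|lborel. g x * partial_deriv i f x) = - (LINT x|lborel. partial_deriv i g x * f x)"
proof -
  have "partial_deriv i (\<lambda>x. g x * f x) x = g x * partial_deriv i f x + partial_deriv i g x * f x" for x
    by (intro partial_deriv_mult smooth_differentiable test_functions_smooth[OF assms(1)] assms(2))
  then have "(LINT x|lborel. g x * partial_deriv i f x + partial_deriv i g x * f x) = 0"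
    using integral_partial_deriv_eq_0[OF test_functions_mult(2)[OF assms], of i] by simp
  moreover have "integrable lborel (\<lambda>x. g x * partial_deriv i f x)" "integrable lborel (\<lambda>x. partial_deriv i g x * f x)"
    by (rule test_functions_integrable[OF test_functions_mult(2)] assms test_functions_partial_deriv smooth_partial_deriv)+
  ultimately show ?thesis by (simp add: eq_neg_iff_add_eq_0)
qed

section \<open>The Gagliardo--Loomis--Whitney inequality\<close>

definition upd :: "real^'n \<Rightarrow> 'n \<Rightarrow> real \<Rightarrow> real^'n" where
  "upd x i t = x + (t - x $ i) *\<^sub>R axis i 1"

lemma upd_nth: "upd x i t $ j = (if j = i then t else x $ j)"
  by (simp add: upd_def axis_def)

lemma upd_upd [simp]: "upd (upd x i s) i t = upd x i t"
  by (simp add: vec_eq_iff upd_nth)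

lemma upd_commute: "i \<noteq> j \<Longrightarrow> upd (upd x i s) j t = upd (upd x j t) i s"
  by (simp add: vec_eq_iff upd_nth)

lemma measurable_upd [measurable (raw)]:
  fixes f :: "'b \<Rightarrow> real^'n"
  assumes f: "f \<in> M \<rightarrow>\<^sub>M borel" and g: "g \<in> M \<rightarrow>\<^sub>M borel"
  shows "(\<lambda>z. upd (f z) i (g z)) \<in> M \<rightarrow>\<^sub>M borel"
proof -
  have "(\<lambda>x::real^'n. x $ i) \<in> borel_measurable borel"
    by (intro borel_measurable_continuous_onI continuous_intros)
  from measurable_compose[OF f this] show ?thesis
    unfolding upd_def
    by (intro borel_measurable_add borel_measurable_scaleR borel_measurable_diff f g borel_measurable_const)
qed

text \<open>The partial integral is kept as a function on the whole space that is constant in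
  coordinate i. Partial integrals in several directions can then be iterated and interchanged within
  one type.\<close>

definition line_int :: "'n \<Rightarrow> (real^'n \<Rightarrow> ennreal) \<Rightarrow> real^'n \<Rightarrow> ennreal" where
  "line_int i f x = (\<integral>\<^sup>+t. f (upd x i t) \<partial>lborel)"

lemma borel_measurable_line_int:
  assumes [measurable]: "f \<in> borel_measurable borel"
  shows "line_int i f \<in> borel_measurable borel"
proof -
  show ?thesis unfolding line_int_def[abs_def]
    by (rule lborel.borel_measurable_nn_integral) measurable
qed

lemma line_int_mono: "(\<And>x. f x \<le> g x) \<Longrightarrow> line_int i f x \<le> line_int i g x"
  unfolding line_int_def by (intro nn_integral_mono) auto

lemma line_int_upd [simp]: "line_int i f (upd x i t) = line_int i f x"
  by (simp add: line_int_def)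

lemma line_int_commute:
  assumes [measurable]: "f \<in> borel_measurable borel" and "i \<noteq> j"
  shows "line_int i (line_int j f) = line_int j (line_int i f)"
proof (rule ext)
  fix x
  show "line_int i (line_int j f) x = line_int j (line_int i f) x"
    unfolding line_int_def
    by (subst lborel_pair.Fubini') (use assms in \<open>auto simp: upd_commute\<close>)
qed

definition lines_int :: "'n list \<Rightarrow> (real^'n \<Rightarrow> ennreal) \<Rightarrow> real^'n \<Rightarrow> ennreal" where
  "lines_int js f = foldr line_int js f"

lemma lines_int_simps [simp]:
  "lines_int [] f = f" "lines_int (j # js) f = line_int j (lines_int js f)"
  by (simp_all add: lines_int_def)

lemma borel_measurable_lines_int [measurable (raw)]:
  "f \<in> borel_measurable borel \<Longrightarrow> lines_int js f \<in> borel_measurable borel"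
  by (induction js) (auto intro: borel_measurable_line_int)

text \<open>Lebesgue measure on \<open>real^'n\<close> is the image of the product of
  one-dimensional Lebesgue measures, and the product integral splits off one coordinate at a time.
  Once all coordinates are integrated, the base point x has no influence.\<close>

lemma nn_integral_eq_lines_int:
  fixes f :: "real^'n \<Rightarrow> ennreal"
  assumes f [measurable]: "f \<in> borel_measurable borel" and js: "distinct js" "set js = UNIV"
  shows "(\<integral>\<^sup>+x. f x \<partial>lborel) = lines_int js f x"
proof -
  interpret product_sigma_finite "\<lambda>i::'n. lborel :: real measure" ..
  \<comment> \<open>\<open>ov S x y\<close> overwrites the coordinates of x in S by those of y.
    Keeping x general lets the induction on the list pass through partially integrated
    stages.\<close>
  define ov where "ov S x y = (\<chi> i. if i \<in> S then y i else x $ i)" for S and x :: "real^'n" and y :: "'n \<Rightarrow> real"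
  have ov_meas [measurable]: "ov S x \<in> (Pi\<^sub>M S (\<lambda>i. lborel)) \<rightarrow>\<^sub>M borel" for S x
  proof -
    have "(\<lambda>y. \<Sum>i\<in>UNIV. (if i \<in> S then y i else x $ i) *\<^sub>R (axis i 1 :: real^'n)) \<in> (Pi\<^sub>M S (\<lambda>i. lborel)) \<rightarrow>\<^sub>M borel"
    proof (intro borel_measurable_sum borel_measurable_scaleR)
      fix i show "(\<lambda>y. if i \<in> S then y i else x $ i) \<in> borel_measurable (Pi\<^sub>M S (\<lambda>i. lborel))"
        by (cases "i \<in> S") (auto intro: measurable_component_singleton[of i S "\<lambda>i. lborel", simplified])
    qed auto
    moreover have "(\<Sum>i\<in>UNIV. c i *\<^sub>R (axis i 1 :: real^'n)) = (\<chi> i. c i)" for c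
      by (simp add: vec_eq_iff axis_def if_distrib cong: if_cong)
    then have "ov S x = (\<lambda>y. \<Sum>i\<in>UNIV. (if i \<in> S then y i else x $ i) *\<^sub>R (axis i 1 :: real^'n))"
      by (simp add: fun_eq_iff ov_def)
    ultimately show ?thesis by simp
  qed
  have *: "(\<integral>\<^sup>+y. f (ov (set js) x y) \<partial>Pi\<^sub>M (set js) (\<lambda>i. lborel)) = lines_int js f x" if "distinct js" for js x
    using that
  proof (induction js arbitrary: x)
    case Nil
    then show ?case by (simp add: ov_def space_PiM_empty)
  next
    case (Cons j js)
    have "(\<integral>\<^sup>+y. f (ov (set (j # js)) x y) \<partial>Pi\<^sub>M (set (j # js)) (\<lambda>i. lborel))
      = (\<integral>\<^sup>+t. (\<integral>\<^sup>+y. f (ov (set (j # js)) x (y(j := t))) \<partial>Pi\<^sub>M (set js) (\<lambda>i. lborel)) \<partial>lborel)"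
      using Cons.prems by (simp only: list.set) (rule product_nn_integral_insert_rev; auto; measurable)
    also have "\<dots> = (\<integral>\<^sup>+t. (\<integral>\<^sup>+y. f (ov (set js) (upd x j t) y) \<partial>Pi\<^sub>M (set js) (\<lambda>i. lborel)) \<partial>lborel)"
    proof -
      have "ov (set (j # js)) x (y(j := t)) = ov (set js) (upd x j t) y" for y t
        using Cons.prems by (auto simp: ov_def vec_eq_iff upd_nth)
      then show ?thesis by simp
    qed
    also have "\<dots> = lines_int (j # js) f x"
      using Cons by (simp add: line_int_def)
    finally show ?case .
  qed
  let ?P = "Pi\<^sub>M UNIV (\<lambda>i::'n. lborel :: real measure)"
  \<comment> \<open>Lebesgue measure is determined by the volumes of boxes, so it suffices to
    compute the image measure of a box.\<close>
  have "(lborel :: (real^'n) measure) = distr ?P borel (ov UNIV 0)"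
  proof (rule lborel_eqI)
    fix l u :: "real^'n" assume le: "\<And>b. b \<in> Basis \<Longrightarrow> l \<bullet> b \<le> u \<bullet> b"
    have le': "l $ i \<le> u $ i" for i
      using le[of "axis i 1"] by (simp add: inner_axis axis_in_Basis_iff)
    have "emeasure (distr ?P borel (ov UNIV 0)) (box l u) = emeasure ?P (ov UNIV 0 -` box l u \<inter> space ?P)"
      by (rule emeasure_distr) auto
    also have "ov UNIV 0 -` box l u \<inter> space ?P = (\<Pi>\<^sub>E i\<in>UNIV. {l $ i<..<u $ i})"
      by (auto simp: box_def ov_def space_PiM PiE_def Basis_vec_def inner_axis)
    also have "emeasure ?P \<dots> = (\<Prod>i\<in>UNIV. emeasure lborel {l $ i<..<u $ i})"
      by (rule emeasure_PiM) auto
    also have "\<dots> = (\<Prod>i\<in>UNIV. ennreal (u $ i - l $ i))"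
      using le' by simp
    also have "\<dots> = ennreal (\<Prod>i\<in>UNIV. u $ i - l $ i)"
      using le' by (subst prod_ennreal) auto
    also have "(\<Prod>i\<in>UNIV. u $ i - l $ i) = (\<Prod>b\<in>Basis. (u - l) \<bullet> b)"
    proof -
      have B: "Basis = range (\<lambda>i. axis i 1 :: real^'n)" by (auto simp: Basis_vec_def)
      have "inj (\<lambda>i. axis i 1 :: real^'n)" by (auto simp: inj_on_def axis_eq_axis)
      then have "(\<Prod>b\<in>Basis. (u - l) \<bullet> b) = (\<Prod>i\<in>UNIV. (u - l) \<bullet> axis i 1)"
        by (subst B) (subst prod.reindex, assumption, rule prod.cong, simp_all only: comp_def)
      then show ?thesis by (simp add: inner_axis)
    qed
    finally show "emeasure (distr ?P borel (ov UNIV 0)) (box l u) = ennreal (\<Prod>b\<in>Basis. (u - l) \<bullet> b)" .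
  qed simp
  then have "(\<integral>\<^sup>+x. f x \<partial>lborel) = (\<integral>\<^sup>+x. f x \<partial>distr ?P borel (ov UNIV 0))"
    by (rule arg_cong[where f = "\<lambda>M. integral\<^sup>N M f"])
  also have "\<dots> = (\<integral>\<^sup>+y. f (ov UNIV 0 y) \<partial>?P)"
    by (rule nn_integral_distr) measurable
  also have "(\<lambda>y. f (ov UNIV 0 y)) = (\<lambda>y. f (ov UNIV x y))"
    by (simp add: ov_def)
  also have "(\<integral>\<^sup>+y. f (ov UNIV x y) \<partial>?P) = lines_int js f x"
    using *[OF js(1)] js(2) by simp
  finally show ?thesis .
qed

text \<open>The coordinates in \<open>js\<close> are integrated out one at a time. When \<open>x\<^sub>j\<close> is integrated, the factor with
  \<open>i = j\<close> does not depend on \<open>x\<^sub>j\<close>, and the remaining \<open>n - 1\<close> factors are handled by the Hoelder inequality.\<close>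

lemma Gagliardo_lines:
  fixes f :: "real^'n \<Rightarrow> ennreal"
  assumes f [measurable]: "f \<in> borel_measurable borel" and n: "CARD('n) \<ge> 2" and "distinct js"
    and p: "p = 1 / (real CARD('n) - 1)"
  shows "lines_int js (\<lambda>x. \<Prod>i\<in>UNIV. epow (line_int i f x) p) x
    \<le> (\<Prod>i\<in>UNIV. epow ((if i \<in> set js then lines_int js f else line_int i (lines_int js f)) x) p)"
  using \<open>distinct js\<close>
proof (induction js arbitrary: x)
  case Nil
  then show ?case by simp
next
  case (Cons j js)
  \<comment> \<open>In either case \<open>?B i\<close> is f integrated over the coordinates in
    \<open>js\<close> together with i.\<close>
  let ?B = "\<lambda>i. if i \<in> set js then lines_int js f else line_int i (lines_int js f)"
  have [measurable]: "lines_int js f \<in> borel_measurable borel" by measurable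
  note borel_measurable_line_int[measurable (raw)]
  have [measurable]: "?B i \<in> borel_measurable borel" for i by auto
  have "lines_int (j # js) (\<lambda>x. \<Prod>i\<in>UNIV. epow (line_int i f x) p) x
      \<le> line_int j (\<lambda>x. \<Prod>i\<in>UNIV. epow (?B i x) p) x"
    using Cons by (auto intro!: line_int_mono)
  also have "\<dots> = (\<integral>\<^sup>+t. epow (line_int j (lines_int js f) x) p * (\<Prod>i\<in>-{j}. epow (?B i (upd x j t)) p) \<partial>lborel)"
    unfolding line_int_def[of j "\<lambda>x. \<Prod>i\<in>UNIV. epow (?B i x) p"] using Cons.prems
    by (intro nn_integral_cong, subst prod.remove[of UNIV j]) (auto simp: Compl_eq_Diff_UNIV)
  also have "\<dots> = epow (line_int j (lines_int js f) x) p * (\<integral>\<^sup>+t. (\<Prod>i\<in>-{j}. epow (?B i (upd x j t)) p) \<partial>lborel)"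
    by (rule nn_integral_cmult) measurable
  also have "\<dots> \<le> epow (line_int j (lines_int js f) x) p * (\<Prod>i\<in>-{j}. epow (\<integral>\<^sup>+t. ?B i (upd x j t) \<partial>lborel) p)"
  proof (intro mult_left_mono weighted_Holder)
    \<comment> \<open>The n - 1 remaining exponents must add up to 1, which is what determines
      p.\<close>
    have "card (- {j}) = CARD('n) - 1" by (simp add: Compl_eq_Diff_UNIV card_Diff_singleton)
    then show "(\<Sum>i\<in>-{j}. p) = 1" using n by (simp add: p of_nat_diff)
    show "p > 0" using n by (simp add: p)
  qed (auto, measurable)
  also have "\<dots> = epow (line_int j (lines_int js f) x) p *
      (\<Prod>i\<in>-{j}. epow ((if i \<in> set (j # js) then lines_int (j # js) f else line_int i (lines_int (j # js) f)) x) p)"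
  proof (intro arg_cong2[where f = "(*)"] refl prod.cong)
    fix i assume i: "i \<in> - {j}"
    have "(\<integral>\<^sup>+t. ?B i (upd x j t) \<partial>lborel) = line_int j (?B i) x"
      by (simp add: line_int_def)
    also have "\<dots> = (if i \<in> set (j # js) then lines_int (j # js) f else line_int i (lines_int (j # js) f)) x"
      using i line_int_commute[of "lines_int js f" j i] by auto
    finally show "epow (\<integral>\<^sup>+t. ?B i (upd x j t) \<partial>lborel) p =
      epow ((if i \<in> set (j # js) then lines_int (j # js) f else line_int i (lines_int (j # js) f)) x) p" by simp
  qed
  also have "\<dots> = (\<Prod>i\<in>UNIV. epow ((if i \<in> set (j # js) then lines_int (j # js) f else line_int i (lines_int (j # js) f)) x) p)"
    by (subst prod.remove[of UNIV j]) (auto simp: Compl_eq_Diff_UNIV)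
  finally show ?case .
qed

text \<open>The power n/(n-1) of f is a product of n factors f^(1/(n-1)), and the i-th of them is
  estimated through the line in direction i. \<open>Gagliardo_lines\<close> for a list of all
  coordinates then turns every factor into the same power of the full integral of g.\<close>

theorem Gagliardo:
  fixes f g :: "real^'n \<Rightarrow> ennreal"
  assumes [measurable]: "f \<in> borel_measurable borel" "g \<in> borel_measurable borel" and n: "CARD('n) \<ge> 2"
    and le: "\<And>i x. f x \<le> line_int i g x"
  shows "(\<integral>\<^sup>+x. epow (f x) (CARD('n) / (real CARD('n) - 1)) \<partial>lborel)
    \<le> epow (\<integral>\<^sup>+x. g x \<partial>lborel) (CARD('n) / (real CARD('n) - 1))"
proof -
  define p where "p = 1 / (real CARD('n) - 1)"
  have p: "p > 0" using n by (simp add: p_def)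
  obtain js :: "'n list" where js: "set js = UNIV" "distinct js"
    using finite_distinct_list[of "UNIV :: 'n set"] by auto
  note borel_measurable_line_int[measurable (raw)]
  have eq: "epow y (CARD('n) / (real CARD('n) - 1)) = (\<Prod>i\<in>(UNIV::'n set). epow y p)" for y
    using epow_prod_const[of "UNIV :: 'n set" y p] by (simp add: p_def)
  have "(\<integral>\<^sup>+x. epow (f x) (CARD('n) / (real CARD('n) - 1)) \<partial>lborel)
      \<le> (\<integral>\<^sup>+x. (\<Prod>i\<in>UNIV. epow (line_int i g x) p) \<partial>lborel)"
    unfolding eq by (intro nn_integral_mono prod_mono_ennreal epow_mono le less_imp_le[OF p])
  also have "\<dots> = lines_int js (\<lambda>x. \<Prod>i\<in>UNIV. epow (line_int i g x) p) 0"
    using js by (intro nn_integral_eq_lines_int) measurable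
  also have "\<dots> \<le> (\<Prod>i\<in>(UNIV::'n set). epow (lines_int js g 0) p)"
    using Gagliardo_lines[of g js p 0] n js by (simp add: p_def)
  also have "\<dots> = epow (\<integral>\<^sup>+x. g x \<partial>lborel) (CARD('n) / (real CARD('n) - 1))"
    unfolding eq using js by (subst nn_integral_eq_lines_int[of g js 0]) auto
  finally show ?thesis .
qed

section \<open>The Sobolev inequality for test functions\<close>

abbreviation sqint :: "'a measure \<Rightarrow> ('a \<Rightarrow> 'b::real_normed_vector) \<Rightarrow> ennreal" where
  "sqint M f \<equiv> (\<integral>\<^sup>+x. ennreal ((norm (f x))\<^sup>2) \<partial>M)"

abbreviation powint :: "real \<Rightarrow> 'a measure \<Rightarrow> ('a \<Rightarrow> 'b::real_normed_vector) \<Rightarrow> ennreal" where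
  "powint p M f \<equiv> (\<integral>\<^sup>+x. ennreal (norm (f x) powr p) \<partial>M)"

text \<open>This is the fundamental theorem of calculus for |g|^\<gamma> between a zero of g and t,
  after which the integral is extended to the whole line. The derivative of |g| is the inner product
  of g' with \<open>sgn g\<close>, hence at most |g'|.\<close>

lemma powr_norm_le_line_integral:
  fixes g :: "real \<Rightarrow> complex"
  assumes deriv: "\<And>t. (g has_vector_derivative g' t) (at t)" and cont: "continuous_on UNIV g'"
    and supp: "\<And>t. t < a \<Longrightarrow> g t = 0" and \<gamma>: "\<gamma> \<ge> 1"
  shows "ennreal (norm (g t) powr \<gamma>) \<le> (\<integral>\<^sup>+s. ennreal (\<gamma> * norm (g s) powr (\<gamma> - 1) * norm (g' s)) \<partial>lborel)"
proof (cases "g t = 0")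
  case False
  let ?b = "\<lambda>s. \<gamma> * norm (g s) powr (\<gamma> - 1) * norm (g' s)"
  have contg: "continuous_on S g" for S
    using deriv by (meson continuous_at_imp_continuous_on has_vector_derivative_continuous)
  have [measurable]: "g \<in> borel_measurable borel" "g' \<in> borel_measurable borel"
    by (auto intro: borel_measurable_continuous_onI contg cont)
  have b: "?b s \<ge> 0" for s using \<gamma> by simp
  have at: "min a t - 1 \<le> t" "g (min a t - 1) = 0" using supp by auto
  \<comment> \<open>We integrate from the last zero of \<open>g\<close> before \<open>t\<close>: beyond it \<open>\<bar>g\<bar>\<^sup>\<gamma>\<close> is differentiable even for \<open>\<gamma> = 1\<close>.\<close>
  define Z where "Z = {s \<in> {min a t - 1..t}. g s = 0}"
  have "Z = {min a t - 1..t} \<inter> g -` {0}" by (auto simp: Z_def)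
  moreover have "closed ({min a t - 1..t} \<inter> g -` {0})"
    by (intro continuous_closed_preimage contg) auto
  ultimately have "compact Z"
    by (metis compact_Icc compact_Int_closed inf_left_idem)
  moreover have "Z \<noteq> {}" using at by (auto simp: Z_def)
  ultimately obtain s0 where s0: "s0 \<in> Z" "\<And>s. s \<in> Z \<Longrightarrow> s \<le> s0"
    using compact_attains_sup by metis
  have s0': "s0 \<le> t" "g s0 = 0" "min a t - 1 \<le> s0" using s0 by (auto simp: Z_def)
  have nz: "g s \<noteq> 0" if "s0 < s" "s \<le> t" for s
    using s0(2)[of s] that s0' by (force simp: Z_def)
  define h' where "h' s = \<gamma> * norm (g s) powr (\<gamma> - 1) * (g' s \<bullet> sgn (g s))" for s
  have "(h' has_integral (norm (g t) powr \<gamma> - norm (g s0) powr \<gamma>)) {s0..t}"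
  proof (rule fundamental_theorem_of_calculus_interior)
    show "continuous_on {s0..t} (\<lambda>s. norm (g s) powr \<gamma>)"
      using \<gamma> by (intro continuous_on_powr' continuous_on_norm contg continuous_on_const) auto
    fix s assume s: "s \<in> {s0<..<t}"
    have n: "(norm has_derivative (\<lambda>h. h \<bullet> sgn (g s))) (at (g s))"
      using GDERIV_norm[OF nz[of s]] s by (simp add: gderiv_def)
    have "((\<lambda>s. norm (g s)) has_derivative (\<lambda>h. (h *\<^sub>R g' s) \<bullet> sgn (g s))) (at s)"
      using has_derivative_compose[OF deriv[of s, unfolded has_vector_derivative_def] n] .
    then have "((\<lambda>s. norm (g s)) has_real_derivative (g' s \<bullet> sgn (g s))) (at s)"
      by (simp add: has_field_derivative_def mult_commute_abs)
    then have "((\<lambda>s. norm (g s) powr \<gamma>) has_real_derivative h' s) (at s)"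
      using has_real_derivative_powr[of "norm (g s)" \<gamma>] nz[of s] s
      unfolding h'_def by (intro DERIV_chain2[where f = "\<lambda>z. z powr \<gamma>" and g = "\<lambda>s. norm (g s)"]) auto
    then show "((\<lambda>s. norm (g s) powr \<gamma>) has_vector_derivative h' s) (at s)"
      by (simp add: has_real_derivative_iff_has_vector_derivative)
  qed (use s0' in auto)
  then have h': "(h' has_integral norm (g t) powr \<gamma>) {s0..t}"
    using s0' \<gamma> by simp
  show ?thesis
  proof (cases "(\<integral>\<^sup>+s. ennreal (?b s) \<partial>lborel) = \<infinity>")
    case fin: False
    have int: "integrable lborel ?b"
      by (rule integrableI_nonneg) (use b fin in \<open>auto simp: less_top\<close>)
    have le: "h' s \<le> ?b s" for s
    proof -
      have "g' s \<bullet> sgn (g s) \<le> norm (g' s) * norm (sgn (g s))" by (rule norm_cauchy_schwarz)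
      also have "\<dots> \<le> norm (g' s)" by (simp add: norm_sgn)
      finally show ?thesis using \<gamma> by (simp add: h'_def mult_left_mono)
    qed
    have "((\<lambda>s. if s \<in> {s0..t} then h' s else 0) has_integral norm (g t) powr \<gamma>) UNIV"
      using h' by (simp only: has_integral_restrict_UNIV)
    then have "norm (g t) powr \<gamma> \<le> (LINT s|lborel. ?b s)"
      by (rule has_integral_le[OF _ has_integral_integral_lborel[OF int]]) (use b le in auto)
    also have "ennreal (LINT s|lborel. ?b s) = (\<integral>\<^sup>+s. ennreal (?b s) \<partial>lborel)"
      by (rule nn_integral_eq_integral[symmetric, OF int]) (use b in auto)
    finally show ?thesis by (simp add: ennreal_leI)
  qed simp
qed simp

lemma grad_nth: "grad f x $ i = partial_deriv i f x"
  by (simp add: grad_def)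

lemma norm_partial_deriv_le_grad: "norm (partial_deriv i f x) \<le> norm (grad f x)"
  unfolding grad_nth[symmetric] by (rule Finite_Cartesian_Product.norm_nth_le)

lemma smooth_continuous_grad: "smooth f \<Longrightarrow> continuous_on S (grad f)"
  unfolding grad_def[abs_def] by (intro continuous_on_vec_lambda smooth_continuous smooth_partial_deriv)

lemma smooth_measurable_grad: "smooth f \<Longrightarrow> grad f \<in> borel_measurable borel"
  by (intro borel_measurable_continuous_onI smooth_continuous_grad)

lemma test_functions_measurable:
  assumes "f \<in> test_functions D"
  shows "f \<in> borel_measurable borel" "grad f \<in> borel_measurable borel"
  using assms by (auto intro: test_functions_borel_measurable smooth_measurable_grad test_functions_smooth)

lemma grad_outside: "f \<in> test_functions D \<Longrightarrow> x \<notin> D \<Longrightarrow> grad f x = 0"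
  by (simp add: vec_eq_iff grad_nth test_functions_outside[OF test_functions_partial_deriv])

text \<open>Supplies the hypothesis of \<open>Gagliardo\<close> for |f|^\<gamma>. The partial
  derivative is enlarged to the full gradient so that one and the same integrand serves all
  directions.\<close>

lemma test_function_le_line_int:
  fixes f :: "real^'n \<Rightarrow> complex"
  assumes f: "f \<in> test_functions D" and \<gamma>: "\<gamma> \<ge> 1"
  shows "ennreal (norm (f x) powr \<gamma>)
    \<le> line_int i (\<lambda>x. ennreal (\<gamma> * norm (f x) powr (\<gamma> - 1) * norm (grad f x))) x"
proof -
  let ?e = "axis i 1 :: real^'n" and ?y = "x - (x $ i) *\<^sub>R axis i 1 :: real^'n"
  have upd: "upd x i t = ?y + t *\<^sub>R ?e" for t by (simp add: upd_def algebra_simps)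
  obtain R where R: "R > 0" "\<And>x. norm x > R \<Longrightarrow> f x = 0"
    using test_functions_bounded_support[OF f] by blast
  have z: "f (?y + t *\<^sub>R ?e) = 0" if "t < - R" for t
  proof (rule R(2))
    have "\<bar>upd x i t $ i\<bar> \<le> norm (upd x i t)" by (rule component_le_norm_cart)
    then show "norm (?y + t *\<^sub>R ?e) > R" using that by (simp add: upd[symmetric] upd_nth)
  qed
  have "ennreal (norm (f (?y + (x $ i) *\<^sub>R ?e)) powr \<gamma>) \<le> (\<integral>\<^sup>+t. ennreal (\<gamma> * norm (f (?y + t *\<^sub>R ?e)) powr (\<gamma> - 1)
      * norm (partial_deriv i f (?y + t *\<^sub>R ?e))) \<partial>lborel)"
  proof (rule powr_norm_le_line_integral[where a = "- R"])
    show "((\<lambda>t. f (?y + t *\<^sub>R ?e)) has_vector_derivative partial_deriv i f (?y + t *\<^sub>R ?e)) (at t)" for t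
      by (rule partial_deriv_line[OF smooth_differentiable[OF test_functions_smooth[OF f]]])
    show "continuous_on UNIV (\<lambda>t. partial_deriv i f (?y + t *\<^sub>R ?e))"
      by (intro continuous_on_compose2[OF test_functions_continuous[OF test_functions_partial_deriv[OF f], of UNIV]]
        continuous_intros) auto
  qed (use z \<gamma> in auto)
  also have "\<dots> \<le> line_int i (\<lambda>x. ennreal (\<gamma> * norm (f x) powr (\<gamma> - 1) * norm (grad f x))) x"
    unfolding line_int_def upd using \<gamma>
    by (intro nn_integral_mono ennreal_leI mult_left_mono norm_partial_deriv_le_grad) auto
  finally show ?thesis by simp
qed

text \<open>Dividing by J^a leaves J^(1-a) \<le> K. The division is legitimate because J is finite,
  and J = 0 is trivial.\<close>

lemma epow_absorb:
  assumes "J \<noteq> top" "J \<le> K * epow J a" "a < 1"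
  shows "J \<le> epow K (1 / (1 - a))"
proof (cases "J = 0 \<or> K = top")
  case False
  obtain j k where jk: "J = ennreal j" "0 < j" "K = ennreal k" "0 \<le> k"
    using assms(1) False by (cases J; cases K) auto
  have "j \<le> k * j powr a"
    using assms(2) jk by (simp add: ennreal_mult[symmetric] ennreal_le_iff)
  then have "j powr (1 - a) \<le> k"
    using jk by (simp add: powr_diff divide_le_eq)
  then have "(j powr (1 - a)) powr (1 / (1 - a)) \<le> k powr (1 / (1 - a))"
    using assms(3) by (intro powr_mono2) auto
  then show ?thesis using assms(3) jk by (simp add: powr_powr ennreal_leI)
qed auto

text \<open>Since \<open>0 powr 0 = 0\<close>, the case \<open>s = 0\<close> bounds the measure of the support of \<open>h\<close>.\<close>

lemma nn_integral_powr_lower: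
  fixes h :: "'a \<Rightarrow> real"
  assumes [measurable]: "h \<in> borel_measurable M" "D \<in> sets M" and s: "0 \<le> s" "s \<le> P" "P > 0"
    and h: "\<And>x. 0 \<le> h x" "\<And>x. x \<notin> D \<Longrightarrow> h x = 0"
  shows "(\<integral>\<^sup>+x. ennreal (h x powr s) \<partial>M) \<le> max 1 (emeasure M D) * epow (\<integral>\<^sup>+x. ennreal (h x powr P) \<partial>M) (s / P)"
proof -
  let ?J = "\<integral>\<^sup>+x. ennreal (h x powr P) \<partial>M" and ?m = "emeasure M D"
  consider "s = 0" "?J = 0" | "s = 0" "?J = top" | "s = 0" "?J \<noteq> 0" "?J \<noteq> top" | "s = P" | "0 < s" "s < P"
    using s by linarith
  then show ?thesis
  proof cases
    case 1
    then have "AE x in M. ennreal (h x powr P) = 0"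
      by (subst (asm) nn_integral_0_iff_AE) auto
    then have "AE x in M. ennreal (h x powr s) = 0"
      by eventually_elim (auto simp: ennreal_eq_0_iff not_less)
    then have "(\<integral>\<^sup>+x. ennreal (h x powr s) \<partial>M) = (\<integral>\<^sup>+x. 0 \<partial>M)" by (rule nn_integral_cong_AE)
    then show ?thesis by simp
  next
    case 2
    have "max 1 ?m * top = top" by (auto simp: ennreal_mult_top max_def)
    then show ?thesis using 2 by simp
  next
    case 3
    have "(\<integral>\<^sup>+x. ennreal (h x powr s) \<partial>M) \<le> (\<integral>\<^sup>+x. indicator D x \<partial>M)"
      using 3(1) h(2) by (intro nn_integral_mono) (auto simp: indicator_def)
    also have "\<dots> = ?m" by simp
    finally have "(\<integral>\<^sup>+x. ennreal (h x powr s) \<partial>M) \<le> ?m" .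
    moreover have "epow ?J (s / P) = 1"
      using 3 by (cases ?J) auto
    ultimately show ?thesis by (simp add: le_max_iff_disj)
  next
    case 4
    then have "1 * ?J \<le> max 1 ?m * ?J" by (intro mult_right_mono) auto
    with 4 s show ?thesis by simp
  next
    case 5
    let ?a = "s / P"
    have a: "0 < ?a" "?a < 1" using 5 by auto
    have "(\<integral>\<^sup>+x. ennreal (h x powr s) \<partial>M) = (\<integral>\<^sup>+x. epow (ennreal (h x powr P)) ?a * epow (indicator D x) (1 - ?a) \<partial>M)"
    proof (intro nn_integral_cong)
      fix x
      have "h x powr s = (h x powr P) powr ?a" using 5 by (simp add: powr_powr)
      moreover have "epow 1 (1 - ?a) = 1" using epow_ennreal[of 1] by simp
      ultimately show "ennreal (h x powr s) = epow (ennreal (h x powr P)) ?a * epow (indicator D x) (1 - ?a)"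
        using h(2)[of x] by (cases "x \<in> D") auto
    qed
    also have "\<dots> \<le> epow ?J ?a * epow (\<integral>\<^sup>+x. indicator D x \<partial>M) (1 - ?a)"
      by (rule Holder_epow[OF a]) measurable
    also have "(\<integral>\<^sup>+x. indicator D x \<partial>M) = ?m" by simp
    finally have "(\<integral>\<^sup>+x. ennreal (h x powr s) \<partial>M) \<le> epow ?J ?a * epow ?m (1 - ?a)" .
    \<comment> \<open>Hoelder's inequality yields the factor m^(1 - s/P); the larger
      \<open>max 1 ?m\<close> is the same for all exponents, the two end cases included.\<close>
    also have "\<dots> \<le> epow ?J ?a * max 1 ?m"
    proof (intro mult_left_mono)
      show "epow ?m (1 - ?a) \<le> max 1 ?m"
      proof (cases "?m \<le> 1")
        case True
        then have "epow ?m (1 - ?a) \<le> epow 1 (1 - ?a)" using a by (intro epow_mono) auto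
        then show ?thesis using epow_ennreal[of 1] by (simp add: le_max_iff_disj)
      next
        case False
        show ?thesis
        proof (cases ?m)
          case (real r)
          then have "r powr (1 - ?a) \<le> r powr 1" using False a by (intro powr_mono) auto
          then show ?thesis using real False by (simp add: le_max_iff_disj ennreal_leI)
        qed simp
      qed
    qed simp
    finally show ?thesis by (simp add: mult.commute)
  qed
qed

text \<open>For n \<ge> 2 the Gagliardo inequality is applied to |f|^\<gamma>, and Cauchy-Schwarz
  separates |f|^(\<gamma>-1) from the gradient. The first factor involves the exponent
  2(\<gamma>-1), which is at most 2q for n \<ge> 3 exactly when q \<le> n/(n-2). On the bounded set
  \<open>D\<close> it is therefore controlled by a power below 1 of the left side and can be
  absorbed. In one dimension the line integral bounds the supremum of |f| directly.\<close>

theorem Sobolev_test_functions: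
  fixes D :: "(real^'n) set"
  assumes D: "open D" "bounded D" and q: "q \<ge> 1" "CARD('n) \<ge> 3 \<Longrightarrow> q \<le> CARD('n) / (real CARD('n) - 2)"
  obtains C where "C < top" "\<And>f. f \<in> test_functions D \<Longrightarrow>
    powint (2 * q) lborel f \<le> C * epow (sqint lborel (grad f)) q"
proof -
  have [measurable]: "D \<in> sets borel" using D by auto
  let ?m = "max 1 (emeasure lborel D)"
  have m: "?m < top" using emeasure_bounded_finite[OF D(2)] by (simp add: max_def)
  let ?J = "\<lambda>f::real^'n \<Rightarrow> complex. powint (2 * q) lborel f"
  let ?G = "\<lambda>f::real^'n \<Rightarrow> complex. sqint lborel (grad f)"
  have gen: "(\<integral>\<^sup>+x. ennreal (\<gamma> * norm (f x) powr (\<gamma> - 1) * norm (grad f x)) \<partial>lborel)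
      \<le> \<gamma> * epow ?m (1/2) * epow (?J f) ((\<gamma> - 1) / (2 * q)) * epow (?G f) (1/2)"
    if f: "f \<in> test_functions D" and \<gamma>: "1 \<le> \<gamma>" "\<gamma> - 1 \<le> q" for f \<gamma>
  proof -
    note [measurable] = test_functions_measurable[OF f]
    have "(\<integral>\<^sup>+x. ennreal (\<gamma> * norm (f x) powr (\<gamma> - 1) * norm (grad f x)) \<partial>lborel)
        = \<gamma> * (\<integral>\<^sup>+x. ennreal (norm (f x) powr (\<gamma> - 1)) * ennreal (norm (grad f x)) \<partial>lborel)"
      using \<gamma> by (subst nn_integral_cmult[symmetric]) (auto simp: ennreal_mult mult.assoc)
    also have "\<dots> \<le> \<gamma> * (epow (\<integral>\<^sup>+x. (ennreal (norm (f x) powr (\<gamma> - 1)))\<^sup>2 \<partial>lborel) (1/2)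
        * epow (\<integral>\<^sup>+x. (ennreal (norm (grad f x)))\<^sup>2 \<partial>lborel) (1/2))"
      by (intro mult_left_mono Cauchy_Schwarz_ennreal) auto
    also have "(\<integral>\<^sup>+x. (ennreal (norm (f x) powr (\<gamma> - 1)))\<^sup>2 \<partial>lborel) = (\<integral>\<^sup>+x. ennreal (norm (f x) powr (2 * (\<gamma> - 1))) \<partial>lborel)"
      by (intro nn_integral_cong) (simp only: powr_square ennreal_power powr_ge_zero)
    also have "(\<integral>\<^sup>+x. (ennreal (norm (grad f x)))\<^sup>2 \<partial>lborel) = ?G f"
      by (simp add: ennreal_power)
    also have "epow (\<integral>\<^sup>+x. ennreal (norm (f x) powr (2 * (\<gamma> - 1))) \<partial>lborel) (1/2)
        \<le> epow (?m * epow (?J f) (2 * (\<gamma> - 1) / (2 * q))) (1/2)"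
      using \<gamma> q by (intro epow_mono nn_integral_powr_lower) (auto simp: test_functions_outside[OF f])
    also have "\<dots> = epow ?m (1/2) * epow (?J f) ((\<gamma> - 1) / (2 * q))"
    proof -
      have "2 * (\<gamma> - 1) / (2 * q) * (1/2) = (\<gamma> - 1) / (2 * q)"
        using q by (simp add: field_simps)
      then show ?thesis by (simp only: epow_mult epow_epow)
    qed
    finally show ?thesis by (simp add: mult.assoc mult_left_mono mult_right_mono)
  qed
  \<comment> \<open>Absorption is only possible if the left side is known to be finite
    beforehand.\<close>
  have Jfin: "?J f \<noteq> top" if f: "f \<in> test_functions D" for f
  proof -
    obtain B where B: "B > 0" "\<And>x. norm (f x) \<le> B" using test_functions_bounded[OF f] by blast
    have "?J f \<le> (\<integral>\<^sup>+x. ennreal (B powr (2 * q)) * indicator D x \<partial>lborel)"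
      using B q test_functions_outside[OF f]
      by (intro nn_integral_mono) (auto simp: indicator_def intro!: ennreal_leI powr_mono2)
    also have "\<dots> < top"
      using emeasure_bounded_finite[OF D(2)] by (simp add: nn_integral_cmult ennreal_mult_less_top)
    finally show ?thesis by simp
  qed
  have n1: "CARD('n) \<ge> 1" by (simp add: Suc_leI)
  show thesis
  \<comment> \<open>For n = 1 the exponent n/(n-1) makes no sense, but the line integral is already
    the full integral. The choice \<gamma> = 1 bounds |f| uniformly, and the bound is raised to the
    power 2q and integrated over \<open>D\<close>.\<close>
  proof (cases "CARD('n) = 1")
    case True
    then obtain i :: 'n where i: "UNIV = {i}" by (metis card_1_singletonE)
    show ?thesis
    proof (rule that)
      show "epow ?m q * emeasure lborel D < top"
        using m emeasure_bounded_finite[OF D(2)] by (simp add: ennreal_mult_less_top epow_less_top_iff)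
      fix f assume f: "f \<in> test_functions D"
      note [measurable] = test_functions_measurable[OF f]
      define A where "A = epow ?m (1/2) * epow (?G f) (1/2)"
      show "?J f \<le> epow ?m q * emeasure lborel D * epow (?G f) q"
      \<comment> \<open>The case is split off because the factor \<open>epow (?J f) 0\<close> below
        is 1 only for nonzero finite \<open>?J f\<close>.\<close>
      proof (cases "?J f = 0")
        case False
        have sup: "ennreal (norm (f x)) \<le> A" for x
        proof -
          have "ennreal (norm (f x)) \<le> line_int i (\<lambda>x. ennreal (1 * norm (f x) powr (1 - 1) * norm (grad f x))) x"
            using test_function_le_line_int[OF f, of 1 x i] by simp
          also have "\<dots> = lines_int [i] (\<lambda>x. ennreal (1 * norm (f x) powr (1 - 1) * norm (grad f x))) x" by simp
          also have "\<dots> = (\<integral>\<^sup>+x. ennreal (1 * norm (f x) powr (1 - 1) * norm (grad f x)) \<partial>lborel)"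
            using i by (intro nn_integral_eq_lines_int[symmetric]) auto
          also have "\<dots> \<le> 1 * epow ?m (1/2) * epow (?J f) ((1 - 1) / (2 * q)) * epow (?G f) (1/2)"
            using gen[OF f, of 1] q by simp
          also have "epow (?J f) ((1 - 1) / (2 * q)) = 1"
            using False Jfin[OF f] by (cases "?J f") auto
          finally show ?thesis by (simp add: A_def)
        qed
        have "?J f \<le> (\<integral>\<^sup>+x. epow A (2 * q) * indicator D x \<partial>lborel)"
        proof (intro nn_integral_mono)
          fix x
          have "ennreal (norm (f x) powr (2 * q)) = epow (ennreal (norm (f x))) (2 * q)" by simp
          also have "\<dots> \<le> epow A (2 * q)" using sup q by (intro epow_mono) auto
          finally show "ennreal (norm (f x) powr (2 * q)) \<le> epow A (2 * q) * indicator D x"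
            using test_functions_outside[OF f, of x] by (cases "x \<in> D") auto
        qed
        also have "\<dots> = epow A (2 * q) * emeasure lborel D"
          by (simp add: nn_integral_cmult)
        also have "epow A (2 * q) = epow ?m q * epow (?G f) q"
          by (simp add: A_def epow_mult epow_epow)
        finally show ?thesis by (simp add: mult_ac)
      qed simp
    qed
  next
    case False
    then have n: "CARD('n) \<ge> 2" using n1 by linarith
    define N where "N = CARD('n) / (real CARD('n) - 1)"
    \<comment> \<open>Chosen so that (|f|^\<gamma>)^N = |f|^(2q). Then the exponent to be absorbed
      is (\<gamma> - 1) N / (2q) = 1 - N/(2q), which is below 1.\<close>
    define \<gamma> where "\<gamma> = 2 * q / N"
    have N: "N > 0" "N \<le> 2" using n by (auto simp: N_def field_simps)
    have \<gamma>: "1 \<le> \<gamma>" using N q by (simp add: \<gamma>_def field_simps)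
    have \<gamma>': "\<gamma> - 1 \<le> q"
    proof (cases "CARD('n) = 2")
      case True
      then show ?thesis using q by (simp add: \<gamma>_def N_def)
    next
      case False
      then have n3: "CARD('n) \<ge> 3" using n by simp
      then have "q * (real CARD('n) - 2) \<le> CARD('n)"
        using q(2) by (simp add: pos_le_divide_eq)
      then show ?thesis using n3 by (simp add: \<gamma>_def N_def field_simps)
    qed
    show ?thesis
    proof (rule that)
      show "epow (ennreal \<gamma> * epow ?m (1/2)) (2 * q) < top"
        using m by (simp add: ennreal_mult_less_top epow_less_top_iff)
      fix f assume f: "f \<in> test_functions D"
      note [measurable] = test_functions_measurable[OF f]
      have "?J f = (\<integral>\<^sup>+x. epow (ennreal (norm (f x) powr \<gamma>)) N \<partial>lborel)"
        using N by (simp add: powr_powr \<gamma>_def)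
      also have "\<dots> \<le> epow (\<integral>\<^sup>+x. ennreal (\<gamma> * norm (f x) powr (\<gamma> - 1) * norm (grad f x)) \<partial>lborel) N"
        unfolding N_def using test_function_le_line_int[OF f \<gamma>] by (intro Gagliardo n) auto
      also have "\<dots> \<le> epow (\<gamma> * epow ?m (1/2) * epow (?J f) ((\<gamma> - 1) / (2 * q)) * epow (?G f) (1/2)) N"
        using gen[OF f \<gamma> \<gamma>'] N by (intro epow_mono) auto
      also have "\<dots> = epow (\<gamma> * epow ?m (1/2) * epow (?G f) (1/2)) N * epow (?J f) ((\<gamma> - 1) / (2 * q) * N)"
        by (simp only: epow_mult epow_epow mult_ac)
      finally have "?J f \<le> epow (epow (\<gamma> * epow ?m (1/2) * epow (?G f) (1/2)) N) (1 / (1 - (\<gamma> - 1) / (2 * q) * N))"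
        using N q Jfin[OF f] by (intro epow_absorb) (auto simp: \<gamma>_def field_simps)
      also have "1 / (1 - (\<gamma> - 1) / (2 * q) * N) = 2 * q / N"
        using N q by (simp add: \<gamma>_def field_simps)
      also have "epow (epow (\<gamma> * epow ?m (1/2) * epow (?G f) (1/2)) N) (2 * q / N)
          = epow (ennreal \<gamma> * epow ?m (1/2)) (2 * q) * epow (?G f) q"
        using N by (simp add: epow_mult epow_epow)
      finally show "?J f \<le> epow (ennreal \<gamma> * epow ?m (1/2)) (2 * q) * epow (?G f) q" .
    qed
  qed
qed

section \<open>Integrals over the domain and Hoelder duality\<close>

lemma borel_measurable_lebesgue_on:
  assumes "f \<in> borel_measurable borel"
  shows "f \<in> borel_measurable (lebesgue_on D)"
  using assms by (intro measurable_restrict_space1 measurable_completion) simp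

lemma nn_integral_lebesgue_on:
  assumes "D \<in> sets borel" "f \<in> borel_measurable borel" "\<And>x. x \<notin> D \<Longrightarrow> f x = 0"
  shows "(\<integral>\<^sup>+x. f x \<partial>lebesgue_on D) = (\<integral>\<^sup>+x. f x \<partial>lborel)"
proof -
  have "f x * indicator D x = f x" for x using assms(3)[of x] by (auto simp: indicator_def)
  then show ?thesis
    using assms(1) by (subst nn_integral_restrict_space) (auto simp: nn_integral_completion)
qed

lemma integral_lebesgue_on:
  fixes f :: "'a::euclidean_space \<Rightarrow> 'b::{banach, second_countable_topology}"
  assumes "D \<in> sets borel" "f \<in> borel_measurable borel" "\<And>x. x \<notin> D \<Longrightarrow> f x = 0"
  shows "(LINT x|lebesgue_on D. f x) = (LINT x|lborel. f x)"
proof -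
  have "indicator D x *\<^sub>R f x = f x" for x using assms(3)[of x] by (auto simp: indicator_def)
  then show ?thesis
    using assms(1,2) by (subst integral_restrict_space) (auto simp: integral_completion)
qed

lemma Lp_norm_eq: "p \<noteq> \<infinity> \<Longrightarrow> Lp_norm p D f = epow (powint (enn2real p) (lebesgue_on D) f) (1 / enn2real p)"
  by (simp add: Lp_norm_def epow_def Let_def)

lemma Lp_norm_2: "Lp_norm 2 D f = epow (sqint (lebesgue_on D) f) (1/2)"
  by (simp add: Lp_norm_eq powr_numeral)

lemma sqint_eq: "sqint (lebesgue_on D) f = Lp_norm 2 D f * Lp_norm 2 D f"
  by (simp add: Lp_norm_2 epow_add[symmetric])

lemma epow_tendsto_0:
  assumes "(x \<longlongrightarrow> 0) F" "a > 0"
  shows "((\<lambda>k. epow (x k) a) \<longlongrightarrow> 0) F"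
proof (rule order_tendstoI)
  fix b :: ennreal assume b: "0 < b"
  then have "0 < epow b (1 / a)" by (simp add: zero_less_iff_neq_zero)
  with assms(1) have "\<forall>\<^sub>F k in F. x k < epow b (1 / a)" by (rule order_tendstoD)
  then show "\<forall>\<^sub>F k in F. epow (x k) a < b"
  proof eventually_elim
    case (elim k)
    show ?case
    proof (rule ccontr)
      assume "\<not> epow (x k) a < b"
      then have "epow b (1 / a) \<le> epow (epow (x k) a) (1 / a)"
        using assms(2) by (intro epow_mono) auto
      then show False using elim assms(2) by (simp add: epow_epow)
    qed
  qed
qed simp

lemma tendsto_cmult_ennreal_0:
  fixes c :: ennreal
  assumes "(x \<longlongrightarrow> 0) F" "c < top"
  shows "((\<lambda>k. c * x k) \<longlongrightarrow> 0) F"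
  using tendsto_mult_ennreal[OF tendsto_const assms(1), of c] assms(2) by simp

text \<open>The exponent q is always a finite real number: r = 1, whose conjugate is infinite, does
  not occur in either part of the theorem.\<close>

abbreviation conj_exponents :: "ennreal \<Rightarrow> real \<Rightarrow> bool" where
  "conj_exponents r q \<equiv> (r = \<infinity> \<and> q = 1) \<or> (\<exists>\<rho>>1. r = ennreal \<rho> \<and> q > 1 \<and> 1 / q + 1 / \<rho> = 1)"

lemma Holder_Lp_norm:
  fixes V :: "real^'n \<Rightarrow> real"
  assumes rq: "conj_exponents r q"
    and [measurable]: "V \<in> borel_measurable (lebesgue_on D)" "g \<in> borel_measurable (lebesgue_on D)"
  shows "(\<integral>\<^sup>+x. ennreal \<bar>V x\<bar> * g x \<partial>lebesgue_on D)
    \<le> Lp_norm r D V * epow (\<integral>\<^sup>+x. epow (g x) q \<partial>lebesgue_on D) (1 / q)"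
  using rq
proof (elim disjE exE conjE)
  assume r: "r = \<infinity>" "q = 1"
  have "AE x in lebesgue_on D. ennreal (norm (V x)) \<le> Lp_norm r D V"
    unfolding r Lp_norm_def by (simp add: esssup_AE)
  then have "AE x in lebesgue_on D. ennreal \<bar>V x\<bar> * g x \<le> Lp_norm r D V * g x"
    by eventually_elim (simp add: mult_right_mono)
  then have "(\<integral>\<^sup>+x. ennreal \<bar>V x\<bar> * g x \<partial>lebesgue_on D) \<le> (\<integral>\<^sup>+x. Lp_norm r D V * g x \<partial>lebesgue_on D)"
    by (rule nn_integral_mono_AE)
  then show ?thesis using r by (simp add: nn_integral_cmult)
next
  fix \<rho> :: real assume r: "\<rho> > 1" "r = ennreal \<rho>" "q > 1" "1 / q + 1 / \<rho> = 1"
  have q: "1 - 1 / \<rho> = 1 / q" using r by linarith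
  have "(\<integral>\<^sup>+x. epow (ennreal (\<bar>V x\<bar> powr \<rho>)) (1 / \<rho>) * epow (epow (g x) q) (1 - 1 / \<rho>) \<partial>lebesgue_on D)
    \<le> epow (\<integral>\<^sup>+x. ennreal (\<bar>V x\<bar> powr \<rho>) \<partial>lebesgue_on D) (1 / \<rho>) * epow (\<integral>\<^sup>+x. epow (g x) q \<partial>lebesgue_on D) (1 - 1 / \<rho>)"
    using r by (intro Holder_epow) auto
  moreover have "Lp_norm r D V = epow (\<integral>\<^sup>+x. ennreal (\<bar>V x\<bar> powr \<rho>) \<partial>lebesgue_on D) (1 / \<rho>)"
    using r by (simp add: Lp_norm_eq)
  ultimately show ?thesis using r by (simp add: q epow_epow powr_powr)
qed

text \<open>The equation between extended numbers is moved to the reals. It rules out q = 0, because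
  1 / 0 = \<infinity>, and q = \<infinity>, because that would give r = 1.\<close>

lemma conjugate_exponents:
  assumes "1 < r" "1 / q + 1 / r = (1::ennreal)"
  obtains q' where "q = ennreal q'" "q' \<ge> 1"
    "conj_exponents r q'"
proof (cases r)
  case top
  then have "1 / q = 1" using assms(2) by simp
  have "q = 1"
  proof (cases q)
    case (real x)
    have "x \<noteq> 0" using \<open>1 / q = 1\<close> real by auto
    then have "ennreal (1 / x) = ennreal 1" using \<open>1 / q = 1\<close> real
      by (metis divide_ennreal ennreal_1 less_le zero_le_one)
    then show ?thesis using real by (subst (asm) ennreal_inj) auto
  qed (use \<open>1 / q = 1\<close> in simp)
  then show ?thesis using top by (intro that[of 1]) auto
next
  case (real \<rho>)
  then have \<rho>: "\<rho> > 1" using assms(1) by (metis ennreal_1 ennreal_less_iff zero_le_one)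
  then have ir: "1 / r = ennreal (1 / \<rho>)" using real by (metis divide_ennreal ennreal_1 less_trans zero_le_one zero_less_one)
  have q0: "q \<noteq> 0" using assms(2) by auto
  have "q \<noteq> top"
  proof
    assume "q = top"
    then have "ennreal (1 / \<rho>) = ennreal 1" using assms(2) ir by simp
    then show False using \<rho> by (subst (asm) ennreal_inj) auto
  qed
  then obtain q' where q': "q = ennreal q'" "q' > 0"
    using q0 by (cases q) (auto simp: less_le)
  then have "1 / q = ennreal (1 / q')" by (metis divide_ennreal ennreal_1 zero_le_one)
  then have "ennreal (1 / q' + 1 / \<rho>) = ennreal 1"
    using assms(2) ir q' \<rho> by (simp add: ennreal_plus)
  then have *: "1 / q' + 1 / \<rho> = 1" using q' \<rho> by (subst (asm) ennreal_inj) auto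
  then have "1 / q' < 1" using \<rho> by (smt (verit) divide_pos_pos)
  then have "q' > 1" using q' by (simp add: divide_less_eq)
  then show ?thesis using q' \<rho> real * by (intro that[of q']) auto
qed

lemma Fatou_powint:
  fixes w :: "nat \<Rightarrow> 'a \<Rightarrow> 'b::{real_normed_vector,second_countable_topology}"
  assumes [measurable]: "\<And>l. w l \<in> borel_measurable M" and lim: "AE x in M. (\<lambda>l. w l x) \<longlonglongrightarrow> v x" and p: "p > 0"
    and B: "\<forall>\<^sub>F l in sequentially. powint p M (w l) \<le> B"
  shows "powint p M v \<le> B"
proof -
  have "AE x in M. ennreal (norm (v x) powr p) = liminf (\<lambda>l. ennreal (norm (w l x) powr p))"
    using lim
  proof eventually_elim
    case (elim x)
    have "(\<lambda>l. ennreal (norm (w l x) powr p)) \<longlonglongrightarrow> ennreal (norm (v x) powr p)"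
      using p by (intro tendsto_ennrealI tendsto_powr' tendsto_norm elim tendsto_const) auto
    then show ?case by (metis lim_imp_Liminf trivial_limit_sequentially)
  qed
  then have "powint p M v = (\<integral>\<^sup>+x. liminf (\<lambda>l. ennreal (norm (w l x) powr p)) \<partial>M)"
    by (rule nn_integral_cong_AE)
  also have "\<dots> \<le> liminf (\<lambda>l. powint p M (w l))"
    by (rule nn_integral_liminf) measurable
  also have "\<dots> \<le> B"
    using B by (metis Liminf_le trivial_limit_sequentially)
  finally show ?thesis .
qed

lemma sqint_add_le:
  assumes [measurable]: "f \<in> borel_measurable M" "g \<in> borel_measurable M"
  shows "sqint M (\<lambda>x. f x + g x) \<le> 2 * sqint M f + 2 * sqint M g"
proof -
  have "(norm (f x + g x))\<^sup>2 \<le> 2 * (norm (f x))\<^sup>2 + 2 * (norm (g x))\<^sup>2" for x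
  proof -
    have "(norm (f x + g x))\<^sup>2 \<le> (norm (f x) + norm (g x))\<^sup>2"
      by (intro power_mono norm_triangle_ineq) auto
    also have "\<dots> \<le> 2 * (norm (f x))\<^sup>2 + 2 * (norm (g x))\<^sup>2"
      using sum_squares_bound[of "norm (f x)" "norm (g x)"] by (simp add: power2_sum)
    finally show ?thesis .
  qed
  then have "sqint M (\<lambda>x. f x + g x) \<le> (\<integral>\<^sup>+x. ennreal (2 * (norm (f x))\<^sup>2 + 2 * (norm (g x))\<^sup>2) \<partial>M)"
    by (intro nn_integral_mono ennreal_leI)
  also have "\<dots> = (\<integral>\<^sup>+x. 2 * ennreal ((norm (f x))\<^sup>2) + 2 * ennreal ((norm (g x))\<^sup>2) \<partial>M)"
    by (simp add: ennreal_plus ennreal_mult)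
  also have "\<dots> = 2 * sqint M f + 2 * sqint M g"
    by (simp add: nn_integral_add nn_integral_cmult)
  finally show ?thesis .
qed

section \<open>Approximation of elements of the Sobolev space\<close>

lemma bounded_domainD:
  assumes "bounded_domain D"
  shows "open D" "bounded D" "D \<in> sets borel"
  using assms by (auto simp: bounded_domain_def)

lemma test_functions_lebesgue_on:
  assumes "f \<in> test_functions D"
  shows "f \<in> borel_measurable (lebesgue_on D)" "grad f \<in> borel_measurable (lebesgue_on D)"
  using assms by (auto intro!: borel_measurable_lebesgue_on test_functions_borel_measurable
    smooth_measurable_grad test_functions_smooth)

lemma W012_measurable:
  assumes "u \<in> W012 D"
  shows "u \<in> borel_measurable (lebesgue_on D)" "weak_gradient D u \<in> borel_measurable (lebesgue_on D)"
    "sqint (lebesgue_on D) u < top" "sqint (lebesgue_on D) (weak_gradient D u) < top"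
  using assms by (auto simp: W012_def Lp_space_def sqint_eq ennreal_mult_less_top)

text \<open>Convergence in the L^2 norm provides a subsequence that converges almost everywhere, and
  the convergence of the gradients is inherited by it. The finitely many initial terms whose error
  may be infinite are dropped.\<close>

lemma W012_approximation:
  fixes D :: "(real^'n) set"
  assumes u: "u \<in> W012 D"
  obtains \<psi> where "\<And>k::nat. \<psi> k \<in> test_functions D"
    "\<And>k. sqint (lebesgue_on D) (\<lambda>x. grad (\<psi> k) x - weak_gradient D u x) < top"
    "(\<lambda>k. sqint (lebesgue_on D) (\<lambda>x. grad (\<psi> k) x - weak_gradient D u x)) \<longlonglongrightarrow> 0"
    "AE x in lebesgue_on D. (\<lambda>k. \<psi> k x) \<longlonglongrightarrow> u x"
proof -
  let ?M = "lebesgue_on D"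
  obtain \<phi> where \<phi>: "\<And>k::nat. \<phi> k \<in> test_functions D"
    "(\<lambda>k. Lp_norm 2 D (\<lambda>x. grad (\<phi> k) x - weak_gradient D u x)) \<longlonglongrightarrow> 0"
    "(\<lambda>k. Lp_norm 2 D (\<lambda>x. \<phi> k x - u x)) \<longlonglongrightarrow> 0"
    using u by (auto simp: W012_def)
  let ?e = "\<lambda>k. sqint ?M (\<lambda>x. grad (\<phi> k) x - weak_gradient D u x)"
  let ?d = "\<lambda>k. sqint ?M (\<lambda>x. \<phi> k x - u x)"
  note [measurable] = W012_measurable(1,2)[OF u] test_functions_lebesgue_on[OF \<phi>(1)]
  have e0: "?e \<longlonglongrightarrow> 0" and d0: "?d \<longlonglongrightarrow> 0"
    unfolding sqint_eq using tendsto_mult_ennreal[OF \<phi>(2) \<phi>(2)] tendsto_mult_ennreal[OF \<phi>(3) \<phi>(3)] by auto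
  have "\<forall>\<^sub>F k in sequentially. ?e k < top \<and> ?d k < top"
    using order_tendstoD(2)[OF e0, of top] order_tendstoD(2)[OF d0, of top] by (auto elim: eventually_elim2)
  then obtain N where N: "\<And>k. k \<ge> N \<Longrightarrow> ?e k < top" "\<And>k. k \<ge> N \<Longrightarrow> ?d k < top"
    by (auto simp: eventually_sequentially)
  let ?a = "\<lambda>k x. (norm (\<phi> (k + N) x - u x))\<^sup>2"
  have int: "integrable ?M (?a k)" for k
    by (rule integrableI_nonneg) (use N(2)[of "k + N"] in auto)
  have "(\<lambda>k. LINT x|?M. norm (?a k x)) = (\<lambda>k. enn2real (?d (k + N)))"
    by (rule ext) (simp add: integral_eq_nn_integral)
  moreover have "(\<lambda>k. enn2real (?d (k + N))) \<longlonglongrightarrow> enn2real 0"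
    using LIMSEQ_ignore_initial_segment[OF d0, of N] by (intro tendsto_enn2real) auto
  ultimately have "(\<lambda>k. LINT x|?M. norm (?a k x)) \<longlonglongrightarrow> 0" by simp
  from tendsto_L1_AE_subseq[OF int this] obtain s :: "nat \<Rightarrow> nat"
    where s: "strict_mono s" "AE x in ?M. (\<lambda>k. ?a (s k) x) \<longlonglongrightarrow> 0" by blast
  show thesis
  proof (rule that[of "\<lambda>k. \<phi> (s k + N)"])
    show "(\<lambda>k. ?e (s k + N)) \<longlonglongrightarrow> 0"
      using LIMSEQ_subseq_LIMSEQ[OF LIMSEQ_ignore_initial_segment[OF e0, of N] s(1)] by (simp add: comp_def)
    show "AE x in ?M. (\<lambda>k. \<phi> (s k + N) x) \<longlonglongrightarrow> u x"
      using s(2)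
    proof eventually_elim
      case (elim x)
      then have "(\<lambda>k. sqrt ((norm (\<phi> (s k + N) x - u x))\<^sup>2)) \<longlonglongrightarrow> sqrt 0"
        by (rule tendsto_real_sqrt)
      then show ?case by (simp add: tendsto_norm_zero_iff LIM_zero_iff)
    qed
  qed (use \<phi>(1) N(1) in auto)
qed

lemma grad_diff:
  "smooth f \<Longrightarrow> smooth g \<Longrightarrow> grad (\<lambda>x. f x - g x) x = grad f x - grad g x"
  by (simp add: vec_eq_iff grad_nth partial_deriv_diff smooth_differentiable)

lemma Sobolev_lebesgue_on:
  fixes D :: "(real^'n) set"
  assumes D: "bounded_domain D" and q: "q \<ge> 1" "CARD('n) \<ge> 3 \<Longrightarrow> q \<le> CARD('n) / (real CARD('n) - 2)"
  obtains C where "C < top" "\<forall>f\<in>test_functions D.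
    powint (2 * q) (lebesgue_on D) f \<le> C * epow (sqint (lebesgue_on D) (grad f)) q"
proof -
  obtain C where C: "C < top" "\<And>f. f \<in> test_functions D \<Longrightarrow>
    powint (2 * q) lborel f \<le> C * epow (sqint lborel (grad f)) q"
    using Sobolev_test_functions[OF bounded_domainD(1,2)[OF D] q] by blast
  show ?thesis
  proof (rule that[OF C(1)], rule ballI)
    fix f assume f: "f \<in> test_functions D"
    note [measurable] = test_functions_measurable[OF f]
    have "powint (2 * q) (lebesgue_on D) f = powint (2 * q) lborel f" "sqint (lebesgue_on D) (grad f) = sqint lborel (grad f)"
      using bounded_domainD(3)[OF D] test_functions_outside[OF f] grad_outside[OF f]
      by (auto intro!: nn_integral_lebesgue_on)
    with C(2)[OF f] show "powint (2 * q) (lebesgue_on D) f \<le> C * epow (sqint (lebesgue_on D) (grad f)) q" by simp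
  qed
qed

text \<open>The Sobolev inequality for the differences of two approximants, combined with Fatou's
  lemma in the second index, gives convergence in L^(2q) to the known pointwise limit without any
  appeal to completeness. The factors 2 and 4 come from \<open>sqint_add_le\<close>.\<close>

lemma approximation_powint:
  fixes D :: "(real^'n) set"
  assumes C: "C < top" "\<forall>f\<in>test_functions D.
      powint (2 * q) (lebesgue_on D) f \<le> C * epow (sqint (lebesgue_on D) (grad f)) q"
    and q: "q \<ge> 1"
    and [measurable]: "u \<in> borel_measurable (lebesgue_on D)" "g \<in> borel_measurable (lebesgue_on D)"
    and \<psi>: "\<And>k::nat. \<psi> k \<in> test_functions D"
    "\<And>k. sqint (lebesgue_on D) (\<lambda>x. grad (\<psi> k) x - g x) < top"
    "(\<lambda>k. sqint (lebesgue_on D) (\<lambda>x. grad (\<psi> k) x - g x)) \<longlonglongrightarrow> 0"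
    "AE x in lebesgue_on D. (\<lambda>k. \<psi> k x) \<longlonglongrightarrow> u x"
  shows "powint (2 * q) (lebesgue_on D) (\<lambda>x. \<psi> k x - u x) < top"
    and "(\<lambda>k. powint (2 * q) (lebesgue_on D) (\<lambda>x. \<psi> k x - u x)) \<longlonglongrightarrow> 0"
    and "\<delta> > 0 \<Longrightarrow> powint (2 * q) (lebesgue_on D) u \<le> C * epow (2 * \<delta> + 2 * sqint (lebesgue_on D) g) q"
proof -
  let ?M = "lebesgue_on D"
  let ?e = "\<lambda>k. sqint ?M (\<lambda>x. grad (\<psi> k) x - g x)"
  note [measurable] = test_functions_lebesgue_on[OF \<psi>(1)]
  \<comment> \<open>The added 1/(k+1) makes the bound strictly positive, so that the errors
    \<open>?e l\<close> fall below it for large l even if \<open>?e k\<close> is 0. The \<delta> in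
    the last claim has the same purpose.\<close>
  let ?d = "\<lambda>k. ?e k + ennreal (1 / Suc k)"
  have d: "?d k > 0" for k by (intro add_nonneg_pos) auto
  have four: "2 * y + 2 * y = 4 * y" for y :: ennreal by (simp flip: distrib_right)
  have *: "powint (2 * q) ?M (\<lambda>x. \<psi> k x - u x) \<le> C * epow (4 * ?d k) q" for k
  proof (rule Fatou_powint[of "\<lambda>l x. \<psi> k x - \<psi> l x"])
    show "AE x in ?M. (\<lambda>l. \<psi> k x - \<psi> l x) \<longlonglongrightarrow> \<psi> k x - u x"
      using \<psi>(4) by eventually_elim (intro tendsto_intros)
    have "\<forall>\<^sub>F l in sequentially. ?e l < ?d k"
      using order_tendstoD(2)[OF \<psi>(3) d] .
    then show "\<forall>\<^sub>F l in sequentially. powint (2 * q) ?M (\<lambda>x. \<psi> k x - \<psi> l x) \<le> C * epow (4 * ?d k) q"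
    proof eventually_elim
      case (elim l)
      have "sqint ?M (grad (\<lambda>x. \<psi> k x - \<psi> l x)) = sqint ?M (\<lambda>x. (grad (\<psi> k) x - g x) + (g x - grad (\<psi> l) x))"
        by (simp add: grad_diff test_functions_smooth[OF \<psi>(1)])
      also have "\<dots> \<le> 2 * ?e k + 2 * sqint ?M (\<lambda>x. g x - grad (\<psi> l) x)"
        by (rule sqint_add_le) measurable
      also have "\<dots> = 2 * ?e k + 2 * ?e l" by (simp add: norm_minus_commute)
      also have "\<dots> \<le> 2 * ?d k + 2 * ?d k"
        using elim by (intro add_mono mult_left_mono) (auto simp: less_imp_le)
      also have "\<dots> = 4 * ?d k" by (rule four)
      finally have "epow (sqint ?M (grad (\<lambda>x. \<psi> k x - \<psi> l x))) q \<le> epow (4 * ?d k) q"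
        using q by (intro epow_mono) auto
      then show ?case
        using bspec[OF C(2) test_functions_diff[OF \<psi>(1)[of k] \<psi>(1)[of l]]] by (meson mult_left_mono order_trans zero_le)
    qed
  qed (use q in auto)
  show "powint (2 * q) ?M (\<lambda>x. \<psi> k x - u x) < top"
    by (rule le_less_trans[OF *]) (use C(1) \<psi>(2)[of k] in \<open>simp add: ennreal_mult_less_top epow_less_top_iff\<close>)
  have "?d \<longlonglongrightarrow> 0 + ennreal 0"
    using LIMSEQ_inverse_real_of_nat by (intro tendsto_add \<psi>(3) tendsto_ennrealI) (simp add: divide_inverse)
  then have "?d \<longlonglongrightarrow> 0" by simp
  then have lim: "(\<lambda>k. C * epow (4 * ?d k) q) \<longlonglongrightarrow> 0"
    by (intro tendsto_cmult_ennreal_0 epow_tendsto_0 C(1)) (use q in auto)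
  show "(\<lambda>k. powint (2 * q) ?M (\<lambda>x. \<psi> k x - u x)) \<longlonglongrightarrow> 0"
    by (rule tendsto_sandwich[OF _ _ tendsto_const lim]) (use * in auto)
  show "powint (2 * q) ?M u \<le> C * epow (2 * \<delta> + 2 * sqint ?M g) q" if "\<delta> > 0"
  proof (rule Fatou_powint[OF _ \<psi>(4)])
    have "\<forall>\<^sub>F l in sequentially. ?e l < \<delta>"
      using order_tendstoD(2)[OF \<psi>(3) that] .
    then show "\<forall>\<^sub>F l in sequentially. powint (2 * q) ?M (\<psi> l) \<le> C * epow (2 * \<delta> + 2 * sqint ?M g) q"
    proof eventually_elim
      case (elim l)
      have "sqint ?M (grad (\<psi> l)) \<le> 2 * ?e l + 2 * sqint ?M g"
        using sqint_add_le[of "\<lambda>x. grad (\<psi> l) x - g x" ?M g] by simp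
      also have "\<dots> \<le> 2 * \<delta> + 2 * sqint ?M g"
        using elim by (intro add_mono mult_left_mono) (auto simp: less_imp_le)
      finally have "epow (sqint ?M (grad (\<psi> l))) q \<le> epow (2 * \<delta> + 2 * sqint ?M g) q"
        using q by (intro epow_mono) auto
      then show ?case
        using bspec[OF C(2) \<psi>(1)[of l]] by (meson mult_left_mono order_trans zero_le)
    qed
  qed (use q in auto)
qed

section \<open>The energy inequality\<close>

lemma borel_measurable_vec_nth:
  fixes f :: "'a \<Rightarrow> 'b::real_normed_vector^'n"
  assumes "f \<in> borel_measurable M"
  shows "(\<lambda>x. f x $ i) \<in> borel_measurable M"
proof -
  have "(\<lambda>y::'b^'n. y $ i) \<in> borel_measurable borel"
    by (intro borel_measurable_continuous_onI continuous_intros)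
  from measurable_compose[OF assms this] show ?thesis .
qed

lemma borel_measurable_cnj:
  assumes "f \<in> borel_measurable M"
  shows "(\<lambda>x. cnj (f x)) \<in> borel_measurable M"
proof -
  have "cnj \<in> borel_measurable borel"
    by (intro borel_measurable_continuous_onI continuous_intros)
  from measurable_compose[OF assms this] show ?thesis .
qed

lemma norm_sum_mult_le:
  fixes a b :: "complex^'n"
  shows "norm (\<Sum>i\<in>UNIV. a $ i * b $ i) \<le> norm a * norm b"
proof -
  have "norm (\<Sum>i\<in>UNIV. a $ i * b $ i) \<le> (\<Sum>i\<in>UNIV. \<bar>norm (a $ i)\<bar> * \<bar>norm (b $ i)\<bar>)"
    by (rule order_trans[OF norm_sum]) (simp add: norm_mult)
  also have "\<dots> \<le> norm a * norm b"
    unfolding norm_vec_def by (rule L2_set_mult_ineq)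
  finally show ?thesis .
qed

lemma norm_vec_square: "(norm a)\<^sup>2 = (\<Sum>i\<in>UNIV. (norm (a $ i))\<^sup>2)"
  by (simp add: norm_vec_def L2_set_def sum_nonneg)

lemma grad_cnj:
  assumes "smooth f"
  shows "grad (\<lambda>x. cnj (f x)) x = (\<chi> i. cnj (grad f x $ i))"
  by (simp add: vec_eq_iff grad_nth partial_deriv_linear[OF bounded_linear_cnj smooth_differentiable[OF assms]])

lemma norm_cnj_vec: "norm (\<chi> i. cnj (a $ i)) = norm (a :: complex^'n)"
  by (simp add: norm_vec_def)

lemma Holder_three:
  fixes V :: "real^'n \<Rightarrow> real" and u w :: "real^'n \<Rightarrow> complex"
  assumes rq: "conj_exponents r q"
    and [measurable]: "V \<in> borel_measurable (lebesgue_on D)" "u \<in> borel_measurable (lebesgue_on D)"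
      "w \<in> borel_measurable (lebesgue_on D)"
  shows "(\<integral>\<^sup>+x. ennreal (\<bar>V x\<bar> * (norm (u x) * norm (w x))) \<partial>lebesgue_on D)
    \<le> Lp_norm r D V * (epow (powint (2 * q) (lebesgue_on D) u) (1 / (2 * q))
      * epow (powint (2 * q) (lebesgue_on D) w) (1 / (2 * q)))"
proof -
  let ?M = "lebesgue_on D"
  have q: "q > 0" using rq by auto
  have "(\<integral>\<^sup>+x. ennreal (\<bar>V x\<bar> * (norm (u x) * norm (w x))) \<partial>?M)
      = (\<integral>\<^sup>+x. ennreal \<bar>V x\<bar> * ennreal (norm (u x) * norm (w x)) \<partial>?M)"
    by (simp add: ennreal_mult)
  also have "\<dots> \<le> Lp_norm r D V * epow (\<integral>\<^sup>+x. epow (ennreal (norm (u x) * norm (w x))) q \<partial>?M) (1 / q)"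
    by (rule Holder_Lp_norm[OF rq]) measurable
  also have "(\<integral>\<^sup>+x. epow (ennreal (norm (u x) * norm (w x))) q \<partial>?M)
      = (\<integral>\<^sup>+x. ennreal (norm (u x) powr q) * ennreal (norm (w x) powr q) \<partial>?M)"
    by (simp add: ennreal_mult epow_mult)
  also have "Lp_norm r D V * epow \<dots> (1 / q) \<le> Lp_norm r D V * epow
      (epow (\<integral>\<^sup>+x. (ennreal (norm (u x) powr q))\<^sup>2 \<partial>?M) (1/2) * epow (\<integral>\<^sup>+x. (ennreal (norm (w x) powr q))\<^sup>2 \<partial>?M) (1/2)) (1 / q)"
    using q by (intro mult_left_mono epow_mono Cauchy_Schwarz_ennreal) auto
  also have "(\<integral>\<^sup>+x. (ennreal (norm (u x) powr q))\<^sup>2 \<partial>?M) = powint (2 * q) ?M u"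
    by (simp only: powr_square ennreal_power powr_ge_zero)
  also have "(\<integral>\<^sup>+x. (ennreal (norm (w x) powr q))\<^sup>2 \<partial>?M) = powint (2 * q) ?M w"
    by (simp only: powr_square ennreal_power powr_ge_zero)
  finally show ?thesis by (simp add: epow_mult epow_epow)
qed

lemma Lp_norm_const_finite:
  assumes D: "bounded_domain D"
  shows "Lp_norm p D (\<lambda>x. E :: real) < top"
proof -
  have "emeasure (lebesgue_on D) D < top"
    using emeasure_bounded_finite[OF bounded_domainD(2)[OF D]] bounded_domainD(3)[OF D]
    by (simp add: emeasure_restrict_space)
  moreover have "esssup (lebesgue_on D) (\<lambda>x. ennreal (norm E)) \<le> ennreal (norm E)"
    by (rule esssup_I) auto
  then have "esssup (lebesgue_on D) (\<lambda>x. ennreal (norm E)) < top"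
    by (rule le_less_trans) simp
  ultimately show ?thesis
    by (cases "p = \<infinity>") (simp_all add: Lp_norm_eq epow_less_top_iff ennreal_mult_less_top, simp add: Lp_norm_def)
qed

text \<open>The equation is bilinear, so it is tested with the conjugates of the approximants. In
  the limit the gradient term is controlled by Cauchy-Schwarz and the potential term by Hoelder's
  inequality together with convergence in L^(2q).\<close>

theorem energy_inequality:
  fixes D :: "(real^'n) set" and V :: "real^'n \<Rightarrow> real" and u :: "real^'n \<Rightarrow> complex"
  assumes D: "bounded_domain D" and V: "V \<in> Lp_space r D" and E: "E \<le> 0"
    and u: "u \<in> W012 D" and nontriv: "nontrivial_on D u" and sol: "distributional_solution D V E u"
    and rq: "conj_exponents r q"
    and qn: "CARD('n) \<ge> 3 \<Longrightarrow> q \<le> CARD('n) / (real CARD('n) - 2)"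
  shows "powint (2 * q) (lebesgue_on D) u < top" "0 < powint (2 * q) (lebesgue_on D) u"
    "0 < sqint (lebesgue_on D) (weak_gradient D u)"
    "sqint (lebesgue_on D) (weak_gradient D u)
      \<le> Lp_norm r D (\<lambda>x. max (V x) 0) * epow (powint (2 * q) (lebesgue_on D) u) (1 / q)"
proof -
  let ?M = "lebesgue_on D" and ?g = "weak_gradient D u"
  have q: "q \<ge> 1" using rq by auto
  obtain C where C: "C < top" "\<forall>f\<in>test_functions D. powint (2 * q) ?M f \<le> C * epow (sqint ?M (grad f)) q"
    using Sobolev_lebesgue_on[OF D q qn] by blast
  obtain \<psi> where \<psi>: "\<And>k::nat. \<psi> k \<in> test_functions D"
    "\<And>k. sqint ?M (\<lambda>x. grad (\<psi> k) x - ?g x) < top"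
    "(\<lambda>k. sqint ?M (\<lambda>x. grad (\<psi> k) x - ?g x)) \<longlonglongrightarrow> 0"
    "AE x in ?M. (\<lambda>k. \<psi> k x) \<longlonglongrightarrow> u x"
    using W012_approximation[OF u] by blast
  have [measurable]: "V \<in> borel_measurable ?M" and Vfin: "Lp_norm r D V < top"
    using V by (auto simp: Lp_space_def)
  note um [measurable] = W012_measurable(1,2)[OF u]
  note [measurable] = test_functions_lebesgue_on[OF \<psi>(1)]
  note ap = approximation_powint[OF C q um \<psi>]
  let ?U = "powint (2 * q) ?M u" and ?G = "sqint ?M ?g"
  let ?W = "\<lambda>k. powint (2 * q) ?M (\<lambda>x. \<psi> k x - u x)"
  have Gfin: "?G < top" by (rule W012_measurable(4)[OF u])
  have "?U \<le> C * epow (2 * 1 + 2 * ?G) q" by (rule ap(3)) (rule zero_less_one)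
  also have "\<dots> < top" using C(1) Gfin by (simp add: ennreal_mult_less_top epow_less_top_iff)
  finally show Ufin: "?U < top" .
  have "?U \<noteq> 0"
  proof
    assume "?U = 0"
    then have "AE x in ?M. u x = 0"
      by (subst (asm) nn_integral_0_iff_AE) (auto simp: ennreal_eq_0_iff not_less)
    then show False using nontriv by (simp add: nontrivial_on_def)
  qed
  then show U0: "0 < ?U" by (simp add: zero_less_iff_neq_zero)
  \<comment> \<open>With a vanishing gradient the bound in \<open>ap(3)\<close> tends to 0 as its
    slack does, which would force u to be trivial.\<close>
  have "?G \<noteq> 0"
  proof
    assume G: "?G = 0"
    have "(\<lambda>k. C * epow (2 * ennreal (inverse (Suc k))) q) \<longlonglongrightarrow> 0"
      using C(1) q LIMSEQ_inverse_real_of_nat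
      by (intro tendsto_cmult_ennreal_0 epow_tendsto_0) (auto intro: tendsto_eq_rhs[OF tendsto_ennrealI])
    moreover have "?U \<le> C * epow (2 * ennreal (inverse (Suc k))) q" for k
      using ap(3)[of "ennreal (inverse (Suc k))"] G by simp
    ultimately have "?U \<le> 0" by (intro LIMSEQ_le_const) auto
    then show False using U0 by simp
  qed
  then show "0 < ?G" by (simp add: zero_less_iff_neq_zero)
  \<comment> \<open>\<open>F k\<close> and \<open>H k\<close> are the two sides of the equation
    tested with the conjugate of \<psi>_k. Their limits are |grad u|^2 and (V + E)|u|^2.\<close>
  define F where "F k x = (\<Sum>i\<in>UNIV. ?g x $ i * grad (\<lambda>x. cnj (\<psi> k x)) x $ i)" for k x
  define F0 where "F0 x = (\<Sum>i\<in>UNIV. ?g x $ i * cnj (?g x $ i))" for x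
  define H where "H k x = complex_of_real (V x + E) * u x * cnj (\<psi> k x)" for k x
  define H0 where "H0 x = complex_of_real (V x + E) * u x * cnj (u x)" for x
  note [measurable (raw)] = borel_measurable_vec_nth borel_measurable_cnj
  have cc: "z * cnj z = (complex_of_real (norm z))\<^sup>2" for z
    by (metis complex_norm_square of_real_power)
  have F0: "F0 x = of_real ((norm (?g x))\<^sup>2)" for x
    by (simp add: F0_def norm_vec_square cc)
  have H0: "H0 x = of_real ((V x + E) * (norm (u x))\<^sup>2)" for x
    by (simp add: H0_def mult.assoc cc)
  have "F k = (\<lambda>x. \<Sum>i\<in>UNIV. ?g x $ i * cnj (grad (\<psi> k) x $ i))" for k
    by (rule ext) (simp add: F_def grad_cnj[OF test_functions_smooth[OF \<psi>(1)]])
  then have Fm [measurable]: "F k \<in> borel_measurable ?M" for k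
    by (simp only:) measurable
  have [measurable]: "F0 \<in> borel_measurable ?M" "H k \<in> borel_measurable ?M" "H0 \<in> borel_measurable ?M" for k
    unfolding F0[abs_def] H_def[abs_def] H0_def[abs_def] by measurable
  have intF0: "integrable ?M F0"
    by (rule integrableI_bounded) (use Gfin in \<open>auto simp: F0 norm_power\<close>)
  have Fdiff: "(\<integral>\<^sup>+x. ennreal (norm (F k x - F0 x)) \<partial>?M)
      \<le> epow ?G (1/2) * epow (sqint ?M (\<lambda>x. grad (\<psi> k) x - ?g x)) (1/2)" for k
  proof -
    have "norm (F k x - F0 x) \<le> norm (?g x) * norm (grad (\<psi> k) x - ?g x)" for x
    proof -
      have "F k x - F0 x = (\<Sum>i\<in>UNIV. ?g x $ i * (\<chi> i. cnj ((grad (\<psi> k) x - ?g x) $ i)) $ i)"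
        by (simp add: F_def F0_def grad_cnj[OF test_functions_smooth[OF \<psi>(1)]] algebra_simps sum_subtractf)
      then show ?thesis using norm_sum_mult_le[of "?g x" "\<chi> i. cnj ((grad (\<psi> k) x - ?g x) $ i)"]
        by (simp only: norm_cnj_vec)
    qed
    then have "(\<integral>\<^sup>+x. ennreal (norm (F k x - F0 x)) \<partial>?M)
      \<le> (\<integral>\<^sup>+x. ennreal (norm (?g x)) * ennreal (norm (grad (\<psi> k) x - ?g x)) \<partial>?M)"
      by (intro nn_integral_mono) (simp add: ennreal_mult[symmetric] ennreal_leI)
    also have "\<dots> \<le> epow (\<integral>\<^sup>+x. (ennreal (norm (?g x)))\<^sup>2 \<partial>?M) (1/2)
        * epow (\<integral>\<^sup>+x. (ennreal (norm (grad (\<psi> k) x - ?g x)))\<^sup>2 \<partial>?M) (1/2)"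
      by (rule Cauchy_Schwarz_ennreal) measurable
    finally show ?thesis by (simp add: ennreal_power)
  qed
  have intF: "integrable ?M (F k)" for k
  proof -
    have "integrable ?M (\<lambda>x. F k x - F0 x)"
      by (rule integrableI_bounded)
        (use Gfin \<psi>(2)[of k] in \<open>auto intro!: le_less_trans[OF Fdiff] simp: ennreal_mult_less_top epow_less_top_iff\<close>)
    then have "integrable ?M (\<lambda>x. (F k x - F0 x) + F0 x)" using intF0 by (rule Bochner_Integration.integrable_add)
    then show ?thesis by simp
  qed
  have Fbound: "(\<lambda>k. epow ?G (1/2) * epow (sqint ?M (\<lambda>x. grad (\<psi> k) x - ?g x)) (1/2)) \<longlonglongrightarrow> 0"
    using Gfin by (intro tendsto_cmult_ennreal_0 epow_tendsto_0 \<psi>(3)) (auto simp: epow_less_top_iff)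
  have "(\<lambda>k. \<integral>\<^sup>+x. ennreal (norm (F k x - F0 x)) \<partial>?M) \<longlonglongrightarrow> 0"
    by (rule tendsto_sandwich[OF _ _ tendsto_const Fbound]) (use Fdiff in auto)
  then have limF: "(\<lambda>k. LINT x|?M. F k x) \<longlonglongrightarrow> (LINT x|?M. F0 x)"
    by (rule tendsto_L1_int[OF intF intF0])
  \<comment> \<open>On the bounded domain the constant E is itself a potential with finite norm, so
    V and E are estimated by the same inequality.\<close>
  let ?L = "(Lp_norm r D V + Lp_norm r D (\<lambda>x. E))"
  have L: "?L < top" using Vfin Lp_norm_const_finite[OF D] by simp
  have VE: "(\<integral>\<^sup>+x. ennreal (norm (complex_of_real (V x + E) * u x * cnj (w x))) \<partial>?M)
    \<le> ?L * (epow ?U (1 / (2 * q)) * epow (powint (2 * q) ?M w) (1 / (2 * q)))"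
    if [measurable]: "w \<in> borel_measurable ?M" for w
  proof -
    have "norm (complex_of_real (V x + E) * u x * cnj (w x))
      \<le> \<bar>V x\<bar> * (norm (u x) * norm (w x)) + \<bar>E\<bar> * (norm (u x) * norm (w x))" for x
    proof -
      have "norm (complex_of_real (V x + E) * u x * cnj (w x)) = \<bar>V x + E\<bar> * (norm (u x) * norm (w x))"
        by (simp add: norm_mult mult.assoc flip: of_real_add)
      also have "\<dots> \<le> (\<bar>V x\<bar> + \<bar>E\<bar>) * (norm (u x) * norm (w x))"
        by (intro mult_right_mono abs_triangle_ineq) simp
      finally show ?thesis by (simp add: distrib_right)
    qed
    then have "(\<integral>\<^sup>+x. ennreal (norm (complex_of_real (V x + E) * u x * cnj (w x))) \<partial>?M)
      \<le> (\<integral>\<^sup>+x. ennreal (\<bar>V x\<bar> * (norm (u x) * norm (w x))) + ennreal (\<bar>E\<bar> * (norm (u x) * norm (w x))) \<partial>?M)"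
      by (intro nn_integral_mono) (simp add: ennreal_plus[symmetric] ennreal_leI del: ennreal_plus)
    also have "\<dots> = (\<integral>\<^sup>+x. ennreal (\<bar>V x\<bar> * (norm (u x) * norm (w x))) \<partial>?M) + (\<integral>\<^sup>+x. ennreal (\<bar>E\<bar> * (norm (u x) * norm (w x))) \<partial>?M)"
      by (rule nn_integral_add) measurable
    also have "\<dots> \<le> Lp_norm r D V * (epow ?U (1 / (2 * q)) * epow (powint (2 * q) ?M w) (1 / (2 * q)))
       + Lp_norm r D (\<lambda>x. E) * (epow ?U (1 / (2 * q)) * epow (powint (2 * q) ?M w) (1 / (2 * q)))"
      by (intro add_mono Holder_three[OF rq]) measurable
    finally show ?thesis by (simp add: distrib_right)
  qed
  have intH0: "integrable ?M H0"
  proof (rule integrableI_bounded)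
    have "(\<integral>\<^sup>+x. ennreal (norm (H0 x)) \<partial>?M) \<le> ?L * (epow ?U (1 / (2 * q)) * epow ?U (1 / (2 * q)))"
      unfolding H0_def by (rule VE) measurable
    also have "\<dots> < top" using L Ufin by (simp add: ennreal_mult_less_top epow_less_top_iff)
    finally show "(\<integral>\<^sup>+x. ennreal (norm (H0 x)) \<partial>?M) < \<infinity>" by simp
  qed measurable
  have Hdiff: "(\<integral>\<^sup>+x. ennreal (norm (H k x - H0 x)) \<partial>?M)
      \<le> ?L * (epow ?U (1 / (2 * q)) * epow (?W k) (1 / (2 * q)))" for k
  proof -
    have "H k x - H0 x = complex_of_real (V x + E) * u x * cnj (\<psi> k x - u x)" for x
      by (simp add: H_def H0_def algebra_simps)
    then show ?thesis using VE[of "\<lambda>x. \<psi> k x - u x"] by simp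
  qed
  have intH: "integrable ?M (H k)" for k
  proof -
    have "integrable ?M (\<lambda>x. H k x - H0 x)"
      by (rule integrableI_bounded)
        (use L Ufin ap(1)[of k] in \<open>auto intro!: le_less_trans[OF Hdiff] simp: ennreal_mult_less_top epow_less_top_iff\<close>)
    then have "integrable ?M (\<lambda>x. (H k x - H0 x) + H0 x)" using intH0 by (rule Bochner_Integration.integrable_add)
    then show ?thesis by simp
  qed
  have Hbound: "(\<lambda>k. ?L * (epow ?U (1 / (2 * q)) * epow (?W k) (1 / (2 * q)))) \<longlonglongrightarrow> 0"
    using Ufin L q by (intro tendsto_cmult_ennreal_0 epow_tendsto_0 ap(2)) (auto simp: epow_less_top_iff)
  have "(\<lambda>k. \<integral>\<^sup>+x. ennreal (norm (H k x - H0 x)) \<partial>?M) \<longlonglongrightarrow> 0"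
    by (rule tendsto_sandwich[OF _ _ tendsto_const Hbound]) (use Hdiff in auto)
  then have limH: "(\<lambda>k. LINT x|?M. H k x) \<longlonglongrightarrow> (LINT x|?M. H0 x)"
    by (rule tendsto_L1_int[OF intH intH0])
  have "(LINT x|?M. F k x) = (LINT x|?M. H k x)" for k
    using sol test_functions_cnj[OF \<psi>(1)[of k]] unfolding distributional_solution_def F_def H_def by blast
  then have "(LINT x|?M. F0 x) = (LINT x|?M. H0 x)"
    using limF limH LIMSEQ_unique by simp
  then have eq: "(LINT x|?M. (norm (?g x))\<^sup>2) = (LINT x|?M. (V x + E) * (norm (u x))\<^sup>2)"
    unfolding F0 H0 integral_complex_of_real of_real_eq_iff .
  have intg: "integrable ?M (\<lambda>x. (norm (?g x))\<^sup>2)" and intu: "integrable ?M (\<lambda>x. (V x + E) * (norm (u x))\<^sup>2)"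
    using intF0 intH0 unfolding F0[abs_def] H0[abs_def] by (auto dest: integrable_Re)
  have "?G = ennreal (LINT x|?M. (norm (?g x))\<^sup>2)"
    by (rule nn_integral_eq_integral[OF intg]) simp
  also have "\<dots> = ennreal (LINT x|?M. (V x + E) * (norm (u x))\<^sup>2)" by (simp only: eq)
  \<comment> \<open>The integrand may change sign. Its positive part can be handed over to
    \<open>nn_integral\<close>, where Hoelder's inequality is available; E \<le> 0 then allows V + E
    to be replaced by V_+.\<close>
  also have "\<dots> \<le> ennreal (LINT x|?M. max 0 ((V x + E) * (norm (u x))\<^sup>2))"
    by (intro ennreal_leI integral_mono integrable_max intu) auto
  also have "\<dots> = (\<integral>\<^sup>+x. ennreal (max 0 ((V x + E) * (norm (u x))\<^sup>2)) \<partial>?M)"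
    by (intro nn_integral_eq_integral[symmetric] integrable_max intu) auto
  also have "\<dots> \<le> (\<integral>\<^sup>+x. ennreal (\<bar>max (V x) 0\<bar> * (norm (u x) * norm (u x))) \<partial>?M)"
  proof (intro nn_integral_mono ennreal_leI)
    fix x
    have "(V x + E) * (norm (u x))\<^sup>2 \<le> max (V x) 0 * (norm (u x))\<^sup>2"
      using E by (intro mult_right_mono) auto
    then show "max 0 ((V x + E) * (norm (u x))\<^sup>2) \<le> \<bar>max (V x) 0\<bar> * (norm (u x) * norm (u x))"
      by (simp add: power2_eq_square)
  qed
  also have "\<dots> \<le> Lp_norm r D (\<lambda>x. max (V x) 0) * (epow ?U (1 / (2 * q)) * epow ?U (1 / (2 * q)))"
    by (rule Holder_three[OF rq]) measurable
  also have "epow ?U (1 / (2 * q)) * epow ?U (1 / (2 * q)) = epow ?U (1 / q)"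
    by (simp add: epow_add[symmetric])
  finally show "?G \<le> Lp_norm r D (\<lambda>x. max (V x) 0) * epow ?U (1 / q)" .
qed

section \<open>The fundamental lemma of the calculus of variations\<close>

lemma smooth_real_polynomial_function:
  fixes f :: "real^'n \<Rightarrow> real"
  assumes "real_polynomial_function f"
  shows "smooth (\<lambda>x. complex_of_real (f x))"
  using assms
proof induction
  case (linear f)
  then show ?case by (intro smooth_bounded_linear bounded_linear_compose[OF bounded_linear_of_real])
qed (auto intro: smooth_const smooth_add smooth_mult)

lemma smooth_polynomial_function:
  fixes f :: "real^'n \<Rightarrow> complex"
  assumes "polynomial_function f"
  shows "smooth f"
proof -
  have "real_polynomial_function (\<lambda>x. Re (f x))" "real_polynomial_function (\<lambda>x. Im (f x))"
    using assms bounded_linear_Re bounded_linear_Im unfolding polynomial_function_def comp_def by auto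
  then have "smooth (\<lambda>x. complex_of_real (Re (f x)) + \<i> * complex_of_real (Im (f x)))"
    by (intro smooth_add smooth_mult smooth_const smooth_real_polynomial_function)
  then show ?thesis by (simp add: complex_eq[symmetric])
qed

lemma mult_cnj_sgn: "z * cnj (sgn z) = complex_of_real (norm z)"
proof (cases "z = 0")
  case False
  have "z * cnj (sgn z) = z * cnj z / complex_of_real (norm z)" by (simp add: sgn_eq)
  also have "\<dots> = complex_of_real (norm z)"
    using False by (simp add: complex_norm_square[symmetric] power2_eq_square del: of_real_power)
  finally show ?thesis .
qed simp

text \<open>By the Stone--Weierstrass theorem \<open>k\<close> is orthogonal to all continuous functions, hence to \<open>sgn k\<close>,
  which is an almost everywhere limit of continuous functions bounded by 1.\<close>

lemma AE_zero_if_orthogonal_smooth: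
  fixes k :: "real^'n \<Rightarrow> complex"
  assumes k: "integrable lebesgue k" and K: "compact K" "\<And>x. x \<notin> K \<Longrightarrow> k x = 0"
    and orth: "\<And>e. smooth e \<Longrightarrow> (LINT x|lebesgue. k x * e x) = 0"
  shows "AE x in lebesgue. k x = 0"
proof -
  have [measurable]: "k \<in> borel_measurable lebesgue" using k by auto
  have "(\<lambda>x. cnj (sgn (k x))) \<in> borel_measurable lebesgue"
    by (intro borel_measurable_cnj) measurable
  then have "(\<lambda>x. cnj (sgn (k x))) measurable_on UNIV"
    by (rule lebesgue_measurable_imp_measurable_on) simp
  then obtain N g where N: "negligible N" and g: "\<And>n::nat. continuous_on UNIV (g n)"
    and lim: "\<And>x. x \<notin> N \<Longrightarrow> (\<lambda>n. g n x) \<longlonglongrightarrow> cnj (sgn (k x))"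
    unfolding measurable_on_def by auto
  \<comment> \<open>Radial truncation to the unit ball makes dominated convergence applicable with
    the bound |k|. The limit is unaffected because |sgn k| \<le> 1.\<close>
  define c where "c n x = g n x /\<^sub>R max 1 (norm (g n x))" for n x
  have contc: "continuous_on UNIV (c n)" for n
    unfolding c_def by (intro continuous_intros g) auto
  have c1: "norm (c n x) \<le> 1" for n x
    by (auto simp: c_def divide_simps)
  have limc: "(\<lambda>n. c n x) \<longlonglongrightarrow> cnj (sgn (k x))" if "x \<notin> N" for x
  proof -
    have "(\<lambda>n. c n x) \<longlonglongrightarrow> cnj (sgn (k x)) /\<^sub>R max 1 (norm (cnj (sgn (k x))))"
      unfolding c_def by (intro tendsto_intros lim that) auto
    also have "max 1 (norm (cnj (sgn (k x)))) = 1" by (simp add: norm_sgn)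
    finally show ?thesis by simp
  qed
  have cm [measurable]: "c n \<in> borel_measurable lebesgue" for n
    using borel_measurable_continuous_onI[OF contc] by (intro measurable_completion) simp
  have int_norm: "integrable lebesgue (\<lambda>x. norm (k x))" using k by (rule integrable_norm)
  have "(\<lambda>n. LINT x|lebesgue. k x * c n x) \<longlonglongrightarrow> (LINT x|lebesgue. complex_of_real (norm (k x)))"
  proof (rule integral_dominated_convergence[where w = "\<lambda>x. norm (k x)"])
    have "AE x in lebesgue. x \<notin> N"
      using N by (auto simp: negligible_iff_null_sets intro: AE_not_in)
    then show "AE x in lebesgue. (\<lambda>n. k x * c n x) \<longlonglongrightarrow> complex_of_real (norm (k x))"
    proof eventually_elim
      case (elim x)
      have "(\<lambda>n. k x * c n x) \<longlonglongrightarrow> k x * cnj (sgn (k x))"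
        by (intro tendsto_intros limc elim)
      also have "k x * cnj (sgn (k x)) = complex_of_real (norm (k x))"
        by (rule mult_cnj_sgn)
      finally show ?case .
    qed
    show "AE x in lebesgue. norm (k x * c n x) \<le> norm (k x)" for n
      using c1 by (simp add: norm_mult mult_left_le)
  qed (use int_norm in measurable)
  moreover have "(\<lambda>n. LINT x|lebesgue. k x * c n x) \<longlonglongrightarrow> 0"
  proof (rule Lim_null_comparison)
    show "(\<lambda>n. inverse (real (Suc n)) * (LINT x|lebesgue. norm (k x))) \<longlonglongrightarrow> 0"
      using tendsto_mult_right[OF LIMSEQ_inverse_real_of_nat, of "LINT x|lebesgue. norm (k x)"] by simp
    show "\<forall>\<^sub>F n in sequentially. norm (LINT x|lebesgue. k x * c n x) \<le> inverse (real (Suc n)) * (LINT x|lebesgue. norm (k x))"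
    proof (intro always_eventually allI)
      fix n
      \<comment> \<open>Uniform approximation on K suffices because k vanishes outside K. The
        polynomial itself contributes 0, so only the approximation error times |k| is left.\<close>
      obtain e where e: "polynomial_function e" "\<And>x. x \<in> K \<Longrightarrow> norm (c n x - e x) < inverse (real (Suc n))"
        using Stone_Weierstrass_polynomial_function[OF K(1) continuous_on_subset[OF contc], of "inverse (real (Suc n))" n]
        by auto
      have [measurable]: "e \<in> borel_measurable lebesgue"
        using smooth_borel_measurable[OF smooth_polynomial_function[OF e(1)]] by (intro measurable_completion) simp
      have bound: "norm (k x * (c n x - e x)) \<le> inverse (real (Suc n)) * norm (k x)" for x
        using K(2)[of x] e(2)[of x] by (cases "x \<in> K") (auto simp: norm_mult mult.commute intro!: mult_left_mono)
      have i1: "integrable lebesgue (\<lambda>x. k x * c n x)"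
        by (rule Bochner_Integration.integrable_bound[OF int_norm]) (use c1 in \<open>auto simp: norm_mult mult_left_le\<close>)
      have i2: "integrable lebesgue (\<lambda>x. k x * (c n x - e x))"
        by (rule Bochner_Integration.integrable_bound[OF integrable_mult_right[OF int_norm, of "inverse (real (Suc n))"]])
           (use bound in \<open>auto simp: abs_mult\<close>)
      have i3: "integrable lebesgue (\<lambda>x. k x * e x)"
        using Bochner_Integration.integrable_diff[OF i1 i2] by (simp add: algebra_simps)
      have "(LINT x|lebesgue. k x * c n x) = (LINT x|lebesgue. k x * (c n x - e x) + k x * e x)"
        by (simp add: algebra_simps)
      also have "\<dots> = (LINT x|lebesgue. k x * (c n x - e x))"
        using orth[OF smooth_polynomial_function[OF e(1)]] by (subst Bochner_Integration.integral_add[OF i2 i3]) simp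
      also have "norm \<dots> \<le> (LINT x|lebesgue. norm (k x * (c n x - e x)))"
        by (rule integral_norm_bound)
      also have "\<dots> \<le> (LINT x|lebesgue. inverse (real (Suc n)) * norm (k x))"
        by (rule integral_mono[OF integrable_norm[OF i2] integrable_mult_right[OF int_norm]]) (rule bound)
      finally show "norm (LINT x|lebesgue. k x * c n x) \<le> inverse (real (Suc n)) * (LINT x|lebesgue. norm (k x))"
        by simp
    qed
  qed
  ultimately have "(LINT x|lebesgue. complex_of_real (norm (k x))) = 0"
    using LIMSEQ_unique by blast
  then have "(LINT x|lebesgue. norm (k x)) = 0" by (simp only: integral_complex_of_real of_real_eq_0_iff)
  then show ?thesis
    using integral_nonneg_eq_0_iff_AE[OF int_norm] by simp
qed

section \<open>Localization by dilated test functions\<close>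

lemma test_functions_affine:
  fixes f :: "real^'n \<Rightarrow> complex"
  assumes f: "f \<in> test_functions S" and c: "c \<noteq> 0" and sub: "\<And>x. a + c *\<^sub>R x \<in> S \<Longrightarrow> x \<in> D"
  shows "(\<lambda>x. f (a + c *\<^sub>R x)) \<in> test_functions D"
proof -
  obtain K where K: "compact K" "K \<subseteq> S" "\<And>x. x \<notin> K \<Longrightarrow> f x = 0" "smooth f"
    using f by (auto simp: test_functions_iff)
  let ?h = "\<lambda>y. (1 / c) *\<^sub>R (y - a)"
  have "compact (?h ` K)"
    by (intro compact_continuous_image K continuous_intros)
  moreover have "?h ` K \<subseteq> D" using K(2) c sub by force
  moreover have "f (a + c *\<^sub>R x) = 0" if "x \<notin> ?h ` K" for x
  proof (rule K(3))
    show "a + c *\<^sub>R x \<notin> K"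
    proof
      assume "a + c *\<^sub>R x \<in> K"
      then have "?h (a + c *\<^sub>R x) \<in> ?h ` K" by blast
      then show False using that c by simp
    qed
  qed
  ultimately show ?thesis
    using smooth_affine[OF K(4)] unfolding test_functions_iff by blast
qed

lemma test_functions_supp:
  assumes "\<psi> \<in> test_functions D"
  obtains K where "compact K" "K \<subseteq> D" "\<And>x. x \<notin> K \<Longrightarrow> \<psi> x = 0"
  using assms by (auto simp: test_functions_iff)

lemma integrable_mult_test_function:
  fixes h :: "real^'n \<Rightarrow> complex"
  assumes h: "\<And>K. compact K \<Longrightarrow> K \<subseteq> D \<Longrightarrow> h absolutely_integrable_on K"
    and \<psi>: "\<psi> \<in> test_functions D" and D: "D \<in> sets borel"
  shows "integrable (lebesgue_on D) (\<lambda>x. h x * \<psi> x)"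
    and "integrable lebesgue (\<lambda>x. indicator D x *\<^sub>R (h x * \<psi> x))"
proof -
  obtain K where K: "compact K" "K \<subseteq> D" "\<And>x. x \<notin> K \<Longrightarrow> \<psi> x = 0"
    using test_functions_supp[OF \<psi>] by blast
  obtain B where B: "B > 0" "\<And>x. norm (\<psi> x) \<le> B" using test_functions_bounded[OF \<psi>] by blast
  have hK: "integrable lebesgue (\<lambda>x. indicator K x *\<^sub>R h x)"
    using h[OF K(1,2)] by (simp add: set_integrable_def)
  have [measurable]: "\<psi> \<in> borel_measurable lebesgue"
    using test_functions_borel_measurable[OF \<psi>] by (intro measurable_completion) simp
  have eq: "indicator D x *\<^sub>R (h x * \<psi> x) = (indicator K x *\<^sub>R h x) * \<psi> x" for x
    using K(2) K(3)[of x] by (auto simp: indicator_def)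
  have hB: "integrable lebesgue (\<lambda>x. B * norm (indicator K x *\<^sub>R h x))"
    using integrable_norm[OF hK] by (rule integrable_mult_right)
  show "integrable lebesgue (\<lambda>x. indicator D x *\<^sub>R (h x * \<psi> x))"
    unfolding eq
  proof (rule Bochner_Integration.integrable_bound[OF hB])
    show "(\<lambda>x. (indicator K x *\<^sub>R h x) * \<psi> x) \<in> borel_measurable lebesgue"
      using hK by (intro borel_measurable_times) auto
    show "AE x in lebesgue. norm ((indicator K x *\<^sub>R h x) * \<psi> x) \<le> norm (B * norm (indicator K x *\<^sub>R h x))"
    proof (rule AE_I2)
      fix x
      have "norm (indicator K x *\<^sub>R h x) * norm (\<psi> x) \<le> norm (indicator K x *\<^sub>R h x) * B"
        by (intro mult_left_mono B) simp
      then show "norm ((indicator K x *\<^sub>R h x) * \<psi> x) \<le> norm (B * norm (indicator K x *\<^sub>R h x))"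
        using B(1) unfolding norm_mult by (simp add: mult.commute)
    qed
  qed
  then show "integrable (lebesgue_on D) (\<lambda>x. h x * \<psi> x)"
    using D by (subst integrable_restrict_space) auto
qed

text \<open>Dilates and translates of one nonzero test function \<open>\<psi>0\<close> replace the usual bump functions.\<close>

theorem AE_zero_if_orthogonal_test_functions:
  fixes h :: "real^'n \<Rightarrow> complex" and \<psi>0 :: "real^'n \<Rightarrow> complex"
  assumes D: "open D" and \<psi>0: "\<psi>0 \<in> test_functions S" "\<psi>0 p \<noteq> 0"
    and h: "\<And>K. compact K \<Longrightarrow> K \<subseteq> D \<Longrightarrow> h absolutely_integrable_on K"
    and orth: "\<And>\<psi>. \<psi> \<in> test_functions D \<Longrightarrow> (LINT x|lebesgue_on D. h x * \<psi> x) = 0"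
  shows "AE x in lebesgue_on D. h x = 0"
proof -
  have Db: "D \<in> sets borel" using D by simp
  \<comment> \<open>A smooth multiple of a test function is again a test function. Hence h * \<psi>,
    extended by zero, is integrable with compact support and orthogonal to all smooth
    functions.\<close>
  have *: "negligible {x \<in> D. h x * \<psi> x \<noteq> 0}" if \<psi>: "\<psi> \<in> test_functions D" for \<psi>
  proof -
    let ?k = "\<lambda>x. indicator D x *\<^sub>R (h x * \<psi> x)"
    obtain K where K: "compact K" "K \<subseteq> D" "\<And>x. x \<notin> K \<Longrightarrow> \<psi> x = 0"
      using test_functions_supp[OF \<psi>] by blast
    have k: "integrable lebesgue ?k"
      by (rule integrable_mult_test_function(2)[OF _ \<psi> Db]) (rule h)
    have "AE x in lebesgue. ?k x = 0"
    proof (rule AE_zero_if_orthogonal_smooth[OF k K(1)])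
      fix e :: "real^'n \<Rightarrow> complex" assume "smooth e"
      then have "(LINT x|lebesgue_on D. h x * (\<psi> x * e x)) = 0"
        by (intro orth test_functions_mult \<psi>)
      then show "(LINT x|lebesgue. ?k x * e x) = 0"
        using Db by (subst (asm) integral_restrict_space) (auto simp: mult_ac)
    qed (use K in auto)
    then obtain N where N: "N \<in> null_sets lebesgue" "\<And>x. x \<in> space lebesgue - N \<Longrightarrow> ?k x = 0"
      by (rule AE_E3) auto
    then have "{x \<in> D. h x * \<psi> x \<noteq> 0} \<subseteq> N" by (force simp: indicator_def)
    with N(1) show ?thesis using negligible_subset by (metis negligible_iff_null_sets)
  qed
  let ?Z = "{x \<in> D. h x \<noteq> 0}"
  have "negligible ?Z"
  proof (rule iffD2[OF locally_negligible_alt], rule ballI)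
    fix x assume x: "x \<in> ?Z"
    then obtain \<epsilon> where \<epsilon>: "\<epsilon> > 0" "ball x \<epsilon> \<subseteq> D" using D by (auto simp: open_contains_ball)
    obtain R where R: "R > 0" "\<And>y. norm y > R \<Longrightarrow> \<psi>0 y = 0"
      using test_functions_bounded_support[OF \<psi>0(1)] by blast
    \<comment> \<open>The factor c is so large that the rescaled support lies in the ball of radius
      \<epsilon> around x. The shift makes the value at x equal to \<psi>0 p, hence nonzero in a
      neighbourhood of x.\<close>
    define c where "c = (R + 1 + norm p) / \<epsilon>"
    have c: "c > 0" using R(1) \<epsilon>(1) by (simp add: c_def add_pos_nonneg)
    define \<psi> where "\<psi> y = \<psi>0 ((p - c *\<^sub>R x) + c *\<^sub>R y)" for y
    have "\<psi>0 \<in> test_functions (ball 0 (R + 1))"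
    proof -
      have "\<psi>0 y = 0" if "y \<notin> cball 0 R" for y using that R(2)[of y] by auto
      then show ?thesis using test_functions_smooth[OF \<psi>0(1)]
        by (auto simp: test_functions_iff intro!: exI[of _ "cball 0 R"])
    qed
    then have \<psi>: "\<psi> \<in> test_functions D" unfolding \<psi>_def
    proof (rule test_functions_affine)
      fix y assume "p - c *\<^sub>R x + c *\<^sub>R y \<in> ball 0 (R + 1)"
      then have n: "norm (p + c *\<^sub>R (y - x)) < R + 1" by (simp add: algebra_simps)
      have "c * norm (y - x) = norm (c *\<^sub>R (y - x))" using c by simp
      also have "\<dots> \<le> norm (p + c *\<^sub>R (y - x)) + norm p"
        using norm_triangle_ineq4[of "p + c *\<^sub>R (y - x)" p] by (simp only: add_diff_cancel_left')
      also have "\<dots> < c * \<epsilon>" using n \<epsilon>(1) by (simp add: c_def)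
      finally have "norm (y - x) < \<epsilon>" using c by simp
      then show "y \<in> D" using \<epsilon>(2) by (auto simp: dist_norm norm_minus_commute)
    qed (use c in auto)
    let ?U = "?Z \<inter> {y. \<psi> y \<noteq> 0}"
    have "openin (top_of_set ?Z) ?U"
    proof (rule openin_open_Int)
      have "open (\<psi> -` (- {0}))"
        using test_functions_continuous[OF \<psi>, of UNIV] by (intro open_vimage) auto
      then show "open {y. \<psi> y \<noteq> 0}" by (simp add: vimage_def)
    qed
    moreover have "x \<in> ?U" using x \<psi>0(2) by (simp add: \<psi>_def)
    moreover have "negligible ?U" by (rule negligible_subset[OF *[OF \<psi>]]) auto
    ultimately show "\<exists>U. openin (top_of_set ?Z) U \<and> x \<in> U \<and> negligible U" by blast
  qed
  then have "?Z \<in> null_sets lebesgue" by (simp only: negligible_iff_null_sets)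
  then have "AE x in lebesgue. x \<notin> ?Z" by (rule AE_not_in)
  then have "AE x in lebesgue. x \<in> D \<longrightarrow> h x = 0" by eventually_elim auto
  then show ?thesis using Db by (subst AE_restrict_space_iff) auto
qed

section \<open>Weak gradients of test functions\<close>

text \<open>Each component of the difference is orthogonal to all test functions. Without uniqueness
  nothing would connect the representative picked by \<open>weak_gradient\<close> with the classical
  gradient. The function \<psi>0 is the nonzero test function from which the bump functions are
  made.\<close>

lemma weak_gradient_AE_unique:
  fixes D :: "(real^'n) set" and \<psi>0 :: "real^'n \<Rightarrow> complex"
  assumes D: "open D" and \<psi>0: "\<psi>0 \<in> test_functions S" "\<psi>0 p \<noteq> 0"
    and g: "has_weak_gradient D u g1" "has_weak_gradient D u g2"
  shows "AE x in lebesgue_on D. g1 x = g2 x"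
proof -
  have Db: "D \<in> sets borel" using D by simp
  have comp: "(\<lambda>x. g x $ i) absolutely_integrable_on K"
    if "has_weak_gradient D u g" "compact K" "K \<subseteq> D" for g i K
  proof -
    have "g absolutely_integrable_on K" using that by (auto simp: has_weak_gradient_def)
    from absolutely_integrable_linear[OF this bounded_linear_vec_nth] show ?thesis by (simp add: comp_def)
  qed
  have "AE x in lebesgue_on D. g1 x $ i - g2 x $ i = 0" for i
  proof (rule AE_zero_if_orthogonal_test_functions[OF D \<psi>0])
    show "(\<lambda>x. g1 x $ i - g2 x $ i) absolutely_integrable_on K" if "compact K" "K \<subseteq> D" for K
      using comp[OF g(1) that] comp[OF g(2) that] by (rule set_integral_diff(1))
    fix \<psi> assume \<psi>: "\<psi> \<in> test_functions D"
    have i1: "integrable (lebesgue_on D) (\<lambda>x. g1 x $ i * \<psi> x)"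
      by (rule integrable_mult_test_function(1)[OF _ \<psi> Db]) (rule comp[OF g(1)])
    have i2: "integrable (lebesgue_on D) (\<lambda>x. g2 x $ i * \<psi> x)"
      by (rule integrable_mult_test_function(1)[OF _ \<psi> Db]) (rule comp[OF g(2)])
    have "(LINT x|lebesgue_on D. u x * partial_deriv i \<psi> x) = - (LINT x|lebesgue_on D. g1 x $ i * \<psi> x)"
         "(LINT x|lebesgue_on D. u x * partial_deriv i \<psi> x) = - (LINT x|lebesgue_on D. g2 x $ i * \<psi> x)"
      using g \<psi> unfolding has_weak_gradient_def by blast+
    then have "(LINT x|lebesgue_on D. g1 x $ i * \<psi> x) = (LINT x|lebesgue_on D. g2 x $ i * \<psi> x)" by simp
    then show "(LINT x|lebesgue_on D. (g1 x $ i - g2 x $ i) * \<psi> x) = 0"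
      using i1 i2 by (simp add: left_diff_distrib)
  qed
  then have "AE x in lebesgue_on D. \<forall>i\<in>UNIV. g1 x $ i - g2 x $ i = 0"
    by (intro AE_finite_allI) auto
  then show ?thesis by eventually_elim (simp add: vec_eq_iff)
qed

section \<open>Test functions as elements of the Sobolev space\<close>

lemma absolutely_integrable_continuous_compact:
  fixes f :: "'a::euclidean_space \<Rightarrow> 'b::euclidean_space"
  assumes "compact K" "continuous_on UNIV f"
  shows "f absolutely_integrable_on K"
proof -
  have "integrable lborel (\<lambda>x. indicator K x *\<^sub>R f x)"
    by (rule borel_integrable_compact[OF assms(1) continuous_on_subset[OF assms(2)]]) simp
  then show ?thesis unfolding set_integrable_def
    by (subst integrable_completion) auto
qed

lemma has_weak_gradient_grad:
  assumes D: "D \<in> sets borel" and f: "f \<in> test_functions D"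
  shows "has_weak_gradient D f (grad f)"
  unfolding has_weak_gradient_def
proof (intro conjI allI impI ballI)
  note s = test_functions_smooth[OF f]
  fix K assume K: "compact K \<and> K \<subseteq> D"
  then show "f absolutely_integrable_on K" "grad f absolutely_integrable_on K"
    using s by (auto intro!: absolutely_integrable_continuous_compact smooth_continuous smooth_continuous_grad)
next
  note s = test_functions_smooth[OF f]
  fix \<psi> i assume \<psi>: "\<psi> \<in> test_functions D"
  note d\<psi> = test_functions_partial_deriv[OF \<psi>]
  have [measurable]: "f \<in> borel_measurable borel" "\<psi> \<in> borel_measurable borel"
    "partial_deriv i f \<in> borel_measurable borel" "partial_deriv i \<psi> \<in> borel_measurable borel"
    using f \<psi> d\<psi> test_functions_partial_deriv[OF f] by (auto intro: test_functions_borel_measurable)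
  have "(LINT x|lebesgue_on D. f x * partial_deriv i \<psi> x) = (LINT x|lborel. f x * partial_deriv i \<psi> x)"
    using D test_functions_outside[OF f] by (intro integral_lebesgue_on) auto
  also have "\<dots> = - (LINT x|lborel. partial_deriv i f x * \<psi> x)"
    by (rule integration_by_parts[OF \<psi> s])
  also have "(LINT x|lborel. partial_deriv i f x * \<psi> x) = (LINT x|lebesgue_on D. partial_deriv i f x * \<psi> x)"
    using D test_functions_outside[OF \<psi>] by (intro integral_lebesgue_on[symmetric]) auto
  finally show "(LINT x|lebesgue_on D. f x * partial_deriv i \<psi> x) = - (LINT x|lebesgue_on D. grad f x $ i * \<psi> x)"
    by (simp add: grad_nth)
qed

text \<open>This rests on the completeness of Lebesgue measure. It is applied to the representative
  chosen by \<open>weak_gradient\<close>, which is identified with \<open>grad f\<close> only almost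
  everywhere.\<close>

lemma borel_measurable_lebesgue_on_AE:
  fixes f g :: "'a::euclidean_space \<Rightarrow> 'b::euclidean_space"
  assumes D: "D \<in> sets borel" and f: "f \<in> borel_measurable (lebesgue_on D)" and ae: "AE x in lebesgue_on D. f x = g x"
  shows "g \<in> borel_measurable (lebesgue_on D)"
proof -
  have "(\<lambda>x. indicator D x *\<^sub>R f x) \<in> borel_measurable lebesgue"
    using f D by (subst (asm) borel_measurable_restrict_space_iff) auto
  moreover have "AE x in lebesgue. x \<in> D \<longrightarrow> f x = g x"
    using ae D by (subst (asm) AE_restrict_space_iff) auto
  then have "AE x in lebesgue. indicator D x *\<^sub>R f x = indicator D x *\<^sub>R g x"
    by eventually_elim (auto simp: indicator_def)
  ultimately have "(\<lambda>x. indicator D x *\<^sub>R g x) \<in> borel_measurable lebesgue"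
    by (rule borel_measurable_AE)
  then show ?thesis using D by (subst borel_measurable_restrict_space_iff) auto
qed

lemma test_functions_sqint:
  assumes f: "f \<in> test_functions D"
  shows "integrable lborel (\<lambda>x. (norm (f x))\<^sup>2)" "integrable lborel (\<lambda>x. (norm (grad f x))\<^sup>2)"
    "sqint lborel f < top" "sqint lborel (grad f) < top"
proof -
  have *: "integrable lborel (\<lambda>x. (norm (g x))\<^sup>2)" if g: "g \<in> test_functions D" for g
  proof -
    obtain R where "\<And>x. norm x > R \<Longrightarrow> g x = 0"
      using test_functions_bounded_support[OF g] by blast
    then show ?thesis
      by (intro integrable_continuous_compact_support[of _ R] continuous_intros test_functions_continuous[OF g]) auto
  qed
  show i: "integrable lborel (\<lambda>x. (norm (f x))\<^sup>2)" "integrable lborel (\<lambda>x. (norm (grad f x))\<^sup>2)"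
    unfolding norm_vec_square grad_nth
    by (intro Bochner_Integration.integrable_sum * f test_functions_partial_deriv)+
  show "sqint lborel f < top" "sqint lborel (grad f) < top"
    using i by (simp_all add: nn_integral_eq_integral)
qed

lemma sqint_lebesgue_on:
  assumes "D \<in> sets borel" "f \<in> test_functions D"
  shows "sqint (lebesgue_on D) f = sqint lborel f" "sqint (lebesgue_on D) (grad f) = sqint lborel (grad f)"
    "powint p (lebesgue_on D) f = powint p lborel f"
proof -
  note [measurable] = test_functions_measurable[OF assms(2)]
  show "sqint (lebesgue_on D) f = sqint lborel f" "sqint (lebesgue_on D) (grad f) = sqint lborel (grad f)"
    "powint p (lebesgue_on D) f = powint p lborel f"
    using assms(1) test_functions_outside[OF assms(2)] grad_outside[OF assms(2)]
    by (auto intro!: nn_integral_lebesgue_on)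
qed

text \<open>The constant sequence f is an admissible approximation once the chosen weak gradient is
  identified with \<open>grad f\<close>, so the content lies in that identification.\<close>

lemma test_functions_W012:
  fixes D :: "(real^'n) set" and \<psi>0 :: "real^'n \<Rightarrow> complex"
  assumes D: "open D" and \<psi>0: "\<psi>0 \<in> test_functions S" "\<psi>0 p \<noteq> 0" and f: "f \<in> test_functions D"
  shows "AE x in lebesgue_on D. grad f x = weak_gradient D f x" "f \<in> W012 D"
proof -
  have Db: "D \<in> sets borel" using D by simp
  note wg = has_weak_gradient_grad[OF Db f]
  note fm = test_functions_lebesgue_on[OF f]
  have "has_weak_gradient D f (weak_gradient D f)"
    unfolding weak_gradient_def by (rule someI[of "has_weak_gradient D f", OF wg])
  from weak_gradient_AE_unique[OF D \<psi>0 wg this]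
  show ae: "AE x in lebesgue_on D. grad f x = weak_gradient D f x" .
  have wm: "weak_gradient D f \<in> borel_measurable (lebesgue_on D)"
    by (rule borel_measurable_lebesgue_on_AE[OF Db fm(2) ae])
  have "sqint (lebesgue_on D) (weak_gradient D f) = sqint (lebesgue_on D) (grad f)"
    using ae by (intro nn_integral_cong_AE) (auto elim: eventually_mono)
  moreover have "sqint (lebesgue_on D) (\<lambda>x. grad f x - weak_gradient D f x) = (\<integral>\<^sup>+x. 0 \<partial>lebesgue_on D)"
    using ae by (intro nn_integral_cong_AE) (auto elim: eventually_mono)
  ultimately show "f \<in> W012 D"
    using wg wm fm f test_functions_sqint[OF f]
    by (auto simp: W012_def Lp_space_def Lp_norm_2 sqint_lebesgue_on[OF Db f] epow_less_top_iff
        intro!: exI[of _ "\<lambda>k. f"])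
qed

text \<open>A zero denominator is harmless: a / 0 is infinite unless a = 0, so a finite bound K
  forces a = 0.\<close>

lemma ennreal_le_times_if_divide_le:
  fixes a b K :: ennreal
  assumes "a / b \<le> K" "K < top" "b < top"
  shows "a \<le> K * b"
proof (cases "b = 0")
  case True
  then have "a = 0" using assms by (cases "a = 0") (auto simp: top_unique)
  then show ?thesis by simp
next
  case False
  then have "a / b * b = a" using assms(3) by (simp add: ennreal_divide_times ennreal_divide_self)
  then show ?thesis using mult_right_mono[OF assms(1), of b] by simp
qed

lemma sobolev_quotient_le:
  fixes D :: "(real^'n) set"
  assumes u: "u \<in> W012 D" "nontrivial_on D u" and q: "q \<ge> 1" and K: "sobolev_const (ennreal q) D < top"
  shows "epow (powint (2 * q) (lebesgue_on D) u) (1 / q) \<le> (sobolev_const (ennreal q) D)\<^sup>2 * sqint (lebesgue_on D) (weak_gradient D u)"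
proof -
  let ?K = "sobolev_const (ennreal q) D"
  have q2: "2 * ennreal q = ennreal (2 * q)" using q by (simp add: ennreal_mult)
  have "Lp_norm (2 * ennreal q) D u / Lp_norm 2 D (weak_gradient D u) \<le> ?K"
    unfolding sobolev_const_def using u by (intro SUP_upper) auto
  then have "Lp_norm (2 * ennreal q) D u \<le> ?K * Lp_norm 2 D (weak_gradient D u)"
    using K W012_measurable(4)[OF u(1)]
    by (intro ennreal_le_times_if_divide_le) (auto simp: Lp_norm_2 epow_less_top_iff)
  then have "epow (epow (powint (2 * q) (lebesgue_on D) u) (1 / (2 * q))) 2
      \<le> epow (?K * epow (sqint (lebesgue_on D) (weak_gradient D u)) (1/2)) 2"
    using q by (intro epow_mono) (simp_all add: q2 Lp_norm_eq Lp_norm_2)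
  then show ?thesis by (simp only: epow_mult epow_epow) (simp add: epow_2)
qed

text \<open>Translates the bound given by the supremum into classical gradients and integrals over
  the whole space, the form on which dilations act. Trivial functions do not enter the supremum and
  are treated separately.\<close>

lemma sobolev_const_test_function:
  fixes D :: "(real^'n) set" and \<psi>0 :: "real^'n \<Rightarrow> complex"
  assumes D: "open D" and \<psi>0: "\<psi>0 \<in> test_functions S" "\<psi>0 p \<noteq> 0" and f: "f \<in> test_functions D"
    and q: "q \<ge> 1" and K: "sobolev_const (ennreal q) D < top"
  shows "epow (powint (2 * q) lborel f) (1 / q) \<le> (sobolev_const (ennreal q) D)\<^sup>2 * sqint lborel (grad f)"
proof (cases "nontrivial_on D f")
  case True
  have Db: "D \<in> sets borel" using D by simp
  have sq: "sqint (lebesgue_on D) (weak_gradient D f) = sqint (lebesgue_on D) (grad f)"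
    using test_functions_W012(1)[OF D \<psi>0 f] by (intro nn_integral_cong_AE) (auto elim: eventually_mono)
  show ?thesis
    using sobolev_quotient_le[OF test_functions_W012(2)[OF D \<psi>0 f] True q K]
    unfolding sq sqint_lebesgue_on[OF Db f] .
next
  case False
  have Db: "D \<in> sets borel" using D by simp
  have "powint (2 * q) (lebesgue_on D) f = (\<integral>\<^sup>+x. 0 \<partial>lebesgue_on D)"
    using False unfolding nontrivial_on_def by (intro nn_integral_cong_AE) (auto elim: eventually_mono)
  then show ?thesis by (simp add: sqint_lebesgue_on[OF Db f])
qed

section \<open>Subharmonic perturbations\<close>

abbreviation cmplx :: "('a \<Rightarrow> real) \<Rightarrow> 'a \<Rightarrow> complex" where
  "cmplx h \<equiv> (\<lambda>x. complex_of_real (h x))"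

abbreviation energy :: "(real^'n \<Rightarrow> complex) \<Rightarrow> real" where
  "energy f \<equiv> (LINT x|lborel. (norm (grad f x))\<^sup>2)"

lemma nn_integral_lborel_affine:
  fixes f :: "'a::euclidean_space \<Rightarrow> ennreal"
  assumes [measurable]: "f \<in> borel_measurable borel" and c: "c \<noteq> 0"
  shows "(\<integral>\<^sup>+x. f x \<partial>lborel) = ennreal (\<bar>c\<bar> ^ DIM('a)) * (\<integral>\<^sup>+x. f (t + c *\<^sub>R x) \<partial>lborel)"
  by (subst lborel_affine[OF c, of t])
     (simp add: nn_integral_density nn_integral_distr nn_integral_cmult)

lemma partial_deriv_of_real:
  assumes "smooth (cmplx h)"
  shows "partial_deriv i (cmplx h) x
    = of_real (Re (partial_deriv i (cmplx h) x))"
proof -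
  have "bounded_linear (\<lambda>z. complex_of_real (Re z))"
    by (rule bounded_linear_compose[OF bounded_linear_of_real bounded_linear_Re])
  from partial_deriv_linear[OF this smooth_differentiable[OF assms], of i x] show ?thesis by simp
qed

lemma norm_vec_le_componentwise:
  fixes a :: "'a::real_normed_vector^'n" and b :: "'b::real_normed_vector^'n"
  assumes "\<And>i. norm (a $ i) \<le> norm (b $ i)"
  shows "norm a \<le> norm b"
  unfolding norm_vec_def by (rule L2_set_mono) (use assms in auto)

text \<open>The witness is w = s - \<epsilon> with s = sqrt(|\<psi>|^2 + \<epsilon>^2). Subtracting
  \<epsilon> keeps the support inside that of \<psi>. Since 2 s times a partial derivative of s is
  the derivative of |\<psi>|^2, each partial derivative of w is bounded by |\<psi>|/s \<le> 1 times
  that of \<psi>.\<close>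

lemma smoothed_modulus:
  fixes \<psi> :: "real^'n \<Rightarrow> complex"
  assumes \<psi>: "\<psi> \<in> test_functions D" and \<epsilon>: "\<epsilon> > 0"
  shows "\<exists>w :: real^'n \<Rightarrow> real. cmplx w \<in> test_functions D \<and> (\<forall>x. 0 \<le> w x) \<and>
    (\<forall>x. \<bar>w x - norm (\<psi> x)\<bar> \<le> \<epsilon>) \<and> (\<forall>x. norm (grad (cmplx w) x) \<le> norm (grad \<psi> x))"
proof -
  define s where "s x = sqrt ((norm (\<psi> x))\<^sup>2 + \<epsilon>\<^sup>2)" for x
  note sm = test_functions_smooth[OF \<psi>]
  have pos: "s x > 0" for x using \<epsilon> by (simp add: s_def add_nonneg_pos)
  have s2: "(s x)\<^sup>2 = (norm (\<psi> x))\<^sup>2 + \<epsilon>\<^sup>2" for x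
    by (simp add: s_def)
  have cs2: "(complex_of_real (s x))\<^sup>2 = \<psi> x * cnj (\<psi> x) + of_real (\<epsilon>\<^sup>2)" for x
    by (simp only: of_real_power[symmetric] s2 of_real_add complex_norm_square)
  have smsq: "smooth (\<lambda>x. (complex_of_real (s x))\<^sup>2)"
    unfolding cs2 by (intro smooth_add smooth_mult smooth_cnj smooth_const sm)
  have sms: "smooth (cmplx s)"
    by (rule smooth_root(1)[OF smsq pos])
  have pd2: "partial_deriv i (\<lambda>x. (complex_of_real (s x))\<^sup>2) x
      = \<psi> x * cnj (partial_deriv i \<psi> x) + partial_deriv i \<psi> x * cnj (\<psi> x)" for i x
    unfolding cs2
    by (simp add: partial_deriv_add partial_deriv_mult smooth_differentiable sm smooth_mult smooth_cnj smooth_const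
      partial_deriv_linear[OF bounded_linear_cnj])
  define w where "w x = s x - \<epsilon>" for x
  have le_s: "norm (\<psi> x) \<le> s x" for x unfolding s_def by (rule real_le_rsqrt) simp
  have eps_s: "\<epsilon> \<le> s x" for x unfolding s_def using \<epsilon> by (intro real_le_rsqrt) simp
  have s_le: "s x \<le> norm (\<psi> x) + \<epsilon>" for x unfolding s_def using \<epsilon> by (intro sqrt_sum_squares_le_sum) auto
  have smw: "smooth (cmplx w)"
    unfolding w_def of_real_diff by (intro smooth_diff sms smooth_const)
  have pdw: "partial_deriv i (cmplx w) x = partial_deriv i (cmplx s) x" for i x
    unfolding w_def of_real_diff by (simp add: partial_deriv_diff smooth_differentiable sms smooth_const)
  show ?thesis
  proof (intro exI[of _ w] conjI allI)
    have "w x = 0" if "\<psi> x = 0" for x using that \<epsilon> by (simp add: w_def s_def)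
    then show "cmplx w \<in> test_functions D"
      using \<psi> smw by (auto simp: test_functions_iff)
    show "0 \<le> w x" "\<bar>w x - norm (\<psi> x)\<bar> \<le> \<epsilon>" for x
      using eps_s[of x] s_le[of x] le_s[of x] by (auto simp: w_def)
    show "norm (grad (cmplx w) x) \<le> norm (grad \<psi> x)" for x
    proof (rule norm_vec_le_componentwise)
      fix i
      have "norm (partial_deriv i (cmplx s) x)
          = norm (\<psi> x * cnj (partial_deriv i \<psi> x) + partial_deriv i \<psi> x * cnj (\<psi> x)) / (2 * s x)"
        unfolding smooth_root(2)[OF smsq pos] pd2 using pos[of x] by (simp add: norm_divide norm_mult)
      also have "\<dots> \<le> (2 * norm (\<psi> x) * norm (partial_deriv i \<psi> x)) / (2 * s x)"
      proof (rule divide_right_mono)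
        show "norm (\<psi> x * cnj (partial_deriv i \<psi> x) + partial_deriv i \<psi> x * cnj (\<psi> x)) \<le> 2 * norm (\<psi> x) * norm (partial_deriv i \<psi> x)"
          by (rule order_trans[OF norm_triangle_ineq]) (simp add: norm_mult)
      qed (use pos[of x] in simp)
      also have "\<dots> = norm (\<psi> x) / s x * norm (partial_deriv i \<psi> x)" by simp
      also have "\<dots> \<le> 1 * norm (partial_deriv i \<psi> x)"
        using le_s[of x] pos[of x] by (intro mult_right_mono) auto
      finally show "norm (grad (cmplx w) x $ i) \<le> norm (grad \<psi> x $ i)"
        by (simp add: grad_nth pdw)
    qed
  qed
qed

section \<open>The Laplacian and strict subharmonicity\<close>

definition laplacian :: "(real^'n \<Rightarrow> complex) \<Rightarrow> real^'n \<Rightarrow> complex" where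
  "laplacian f x = (\<Sum>i\<in>UNIV. partial_deriv i (partial_deriv i f) x)"

lemma smooth_laplacian: "smooth f \<Longrightarrow> smooth (laplacian f)"
  unfolding laplacian_def[abs_def] by (intro smooth_sum smooth_partial_deriv)

lemma test_functions_sum:
  "(\<And>i. i \<in> A \<Longrightarrow> f i \<in> test_functions D) \<Longrightarrow> (\<lambda>x. \<Sum>i\<in>A. f i x) \<in> test_functions D"
proof (induction A rule: infinite_finite_induct)
  case (insert i A)
  then show ?case by (simp add: test_functions_add)
qed (auto simp: test_functions_iff smooth_const)

lemma test_functions_laplacian: "f \<in> test_functions D \<Longrightarrow> laplacian f \<in> test_functions D"
  unfolding laplacian_def[abs_def] by (intro test_functions_sum test_functions_partial_deriv)

lemma norm_square_coord:
  "complex_of_real ((norm x)\<^sup>2) = (\<Sum>j\<in>UNIV. complex_of_real (x $ j) * complex_of_real (x $ j))"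
  by (simp add: power2_norm_eq_inner inner_vec_def)

lemma smooth_norm_square: "smooth (\<lambda>x::real^'n. complex_of_real ((norm x)\<^sup>2))"
  unfolding norm_square_coord by (intro smooth_sum smooth_mult smooth_coord)

text \<open>Two integrations by parts move both derivatives to |x|^2, each of whose n pure second
  derivatives equals 2. The nonnegative weight |x|^2 detects that the Laplacian of a nonnegative
  bump must be positive somewhere.\<close>

lemma integral_laplacian_norm_square:
  fixes f :: "real^'n \<Rightarrow> complex"
  assumes f: "f \<in> test_functions D"
  shows "(LINT x|lborel. laplacian f x * of_real ((norm x)\<^sup>2)) = 2 * of_nat CARD('n) * (LINT x|lborel. f x)"
proof -
  define s where "s x = (\<Sum>j\<in>UNIV. complex_of_real (x $ j) * complex_of_real (x $ j))" for x :: "real^'n"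
  have s: "s x = of_real ((norm x)\<^sup>2)" for x
    by (simp only: s_def norm_square_coord)
  have sms: "smooth s"
    using smooth_norm_square[where 'n = 'n] unfolding s[symmetric] .
  note smc = smooth_coord[where 'n='n]
  have pds: "partial_deriv i s x = 2 * complex_of_real (x $ i)" for i x
  proof -
    have d: "((\<lambda>x::real^'n. complex_of_real (x $ j)) has_derivative (\<lambda>h. complex_of_real (h $ j))) (at x)" for j
      by (rule bounded_linear_imp_has_derivative[OF bounded_linear_coord])
    have "(s has_derivative (\<lambda>h. \<Sum>j\<in>UNIV. complex_of_real (x $ j) * complex_of_real (h $ j)
        + complex_of_real (h $ j) * complex_of_real (x $ j))) (at x)"
      unfolding s_def[abs_def] by (intro has_derivative_sum has_derivative_mult d)
    from partial_deriv_eq[OF this, of i]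
    have "partial_deriv i s x = (\<Sum>j\<in>UNIV. 2 * complex_of_real (x $ j) * complex_of_real (axis i 1 $ j))"
      by (simp add: algebra_simps)
    also have "\<dots> = 2 * complex_of_real (x $ i)"
      by (subst sum.remove[of UNIV i]) (auto simp: axis_def intro!: sum.neutral)
    finally show ?thesis .
  qed
  have pds2: "partial_deriv i (partial_deriv i s) x = 2" for i x
  proof -
    have "partial_deriv i s = (\<lambda>x. 2 * complex_of_real (x $ i))" by (rule ext) (rule pds)
    then show ?thesis
      by (simp add: partial_deriv_linear[OF bounded_linear_mult_right smooth_differentiable[OF smc]] partial_deriv_coord)
  qed
  have "(LINT x|lborel. s x * partial_deriv i (partial_deriv i f) x) = 2 * (LINT x|lborel. f x)" for i
  proof -
    have "(LINT x|lborel. s x * partial_deriv i (partial_deriv i f) x) = - (LINT x|lborel. partial_deriv i s x * partial_deriv i f x)"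
      by (rule integration_by_parts[OF test_functions_partial_deriv[OF f] sms])
    also have "(LINT x|lborel. partial_deriv i s x * partial_deriv i f x) = - (LINT x|lborel. partial_deriv i (partial_deriv i s) x * f x)"
      by (rule integration_by_parts[OF f smooth_partial_deriv[OF sms]])
    finally show ?thesis by (simp add: pds2)
  qed
  moreover have "integrable lborel (\<lambda>x. s x * partial_deriv i (partial_deriv i f) x)" for i
    by (rule test_functions_integrable[OF test_functions_mult(2)[OF
          test_functions_partial_deriv[OF test_functions_partial_deriv[OF f]] sms]])
  ultimately have "(LINT x|lborel. (\<Sum>i\<in>UNIV. s x * partial_deriv i (partial_deriv i f) x)) = (\<Sum>i\<in>(UNIV::'n set). 2 * (LINT x|lborel. f x))"
    by (simp add: Bochner_Integration.integral_sum)
  then show ?thesis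
    unfolding laplacian_def s[symmetric] sum_distrib_right by (simp add: mult.commute mult.left_commute)
qed

text \<open>Take \<eta> = |\<psi>0|^2. If its Laplacian were nowhere positive, the integral of the
  Laplacian times |x|^2 would be at most 0, yet it is 2n times the integral of \<eta>. Continuity
  spreads half of a positive value over a ball.\<close>

lemma strictly_subharmonic_ball:
  fixes D :: "(real^'n) set" and \<psi>0 :: "real^'n \<Rightarrow> complex"
  assumes D: "open D" and \<psi>0: "\<psi>0 \<in> test_functions D" "\<not> (AE x in lborel. \<psi>0 x = 0)"
  obtains \<eta> :: "real^'n \<Rightarrow> real" and p \<rho> \<delta> where "cmplx \<eta> \<in> test_functions D" "\<And>x. 0 \<le> \<eta> x"
    "\<rho> > 0" "\<delta> > 0" "ball p \<rho> \<subseteq> D" "\<forall>x\<in>ball p \<rho>. \<delta> \<le> Re (laplacian (cmplx \<eta>) x)"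
proof -
  define \<eta> where "\<eta> x = (norm (\<psi>0 x))\<^sup>2" for x
  let ?c = "\<lambda>x. complex_of_real (\<eta> x)"
  have "?c = (\<lambda>x. \<psi>0 x * cnj (\<psi>0 x))" by (simp add: \<eta>_def complex_norm_square del: of_real_power)
  then have c: "?c \<in> test_functions D"
    using test_functions_mult(1)[OF \<psi>0(1) smooth_cnj[OF test_functions_smooth[OF \<psi>0(1)]]] by simp
  have "\<exists>p. Re (laplacian ?c p) > 0"
  proof (rule ccontr)
    assume neg: "\<not> ?thesis"
    have i1: "integrable lborel (\<lambda>x. laplacian ?c x * of_real ((norm x)\<^sup>2))"
      by (rule test_functions_integrable[OF test_functions_mult(1)[OF test_functions_laplacian[OF c] smooth_norm_square]])
    have "(LINT x|lborel. Re (laplacian ?c x * of_real ((norm x)\<^sup>2))) = Re (LINT x|lborel. laplacian ?c x * of_real ((norm x)\<^sup>2))"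
      by (rule integral_Re[OF i1])
    also have "\<dots> = 2 * CARD('n) * (LINT x|lborel. \<eta> x)"
      unfolding integral_laplacian_norm_square[OF c] integral_complex_of_real by simp
    finally have "2 * CARD('n) * (LINT x|lborel. \<eta> x) = (LINT x|lborel. Re (laplacian ?c x * of_real ((norm x)\<^sup>2)))" ..
    also have "\<dots> \<le> (LINT x|(lborel :: (real^'n) measure). 0)"
      by (rule Bochner_Integration.integral_mono[OF integrable_Re[OF i1]])
        (use neg in \<open>auto simp: mult_nonpos_nonneg not_less\<close>)
    finally have "real CARD('n) * (LINT x|lborel. \<eta> x) \<le> 0" by (simp add: mult.commute)
    then have "(LINT x|lborel. \<eta> x) \<le> 0" by (simp add: mult_le_0_iff)
    moreover have int: "integrable lborel \<eta>"
      unfolding \<eta>_def[abs_def] by (rule test_functions_sqint(1)[OF \<psi>0(1)])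
    have "(LINT x|lborel. \<eta> x) \<ge> 0" by (rule Bochner_Integration.integral_nonneg) (simp add: \<eta>_def)
    ultimately have "(LINT x|lborel. \<eta> x) = 0" by simp
    then have "AE x in lborel. \<eta> x = 0"
      by (subst (asm) integral_nonneg_eq_0_iff_AE[OF int]) (simp_all add: \<eta>_def)
    then show False using \<psi>0(2) by (simp add: \<eta>_def)
  qed
  then obtain p where p: "Re (laplacian ?c p) > 0" by blast
  then have "p \<in> D" using test_functions_outside[OF test_functions_laplacian[OF c], of p] by (cases "p \<in> D") auto
  define \<delta> where "\<delta> = Re (laplacian ?c p) / 2"
  have "open ((\<lambda>x. Re (laplacian ?c x)) -` {\<delta><..})"
    by (intro open_vimage continuous_intros test_functions_continuous[OF test_functions_laplacian[OF c]])
  then have "open (D \<inter> (\<lambda>x. Re (laplacian ?c x)) -` {\<delta><..})" using D by (intro open_Int)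
  moreover have "p \<in> D \<inter> (\<lambda>x. Re (laplacian ?c x)) -` {\<delta><..}" using p \<open>p \<in> D\<close> by (simp add: \<delta>_def)
  ultimately obtain \<rho> where "\<rho> > 0" "ball p \<rho> \<subseteq> D \<inter> (\<lambda>x. Re (laplacian ?c x)) -` {\<delta><..}"
    by (meson open_contains_ball)
  then show ?thesis
    using p by (intro that[OF c, of \<rho> \<delta> p]) (auto simp: \<eta>_def \<delta>_def less_imp_le subset_iff)
qed

text \<open>Expanding the square leaves a cross term that integration by parts turns into -2t times
  the integral of v times the Laplacian of \<eta>. Because v is nonnegative and lives in B, a lower
  bound for the Laplacian on B is enough, even if \<eta> extends beyond B.\<close>

lemma perturbed_energy:
  fixes v \<eta> :: "real^'n \<Rightarrow> real"
  defines "cv \<equiv> \<lambda>x. complex_of_real (v x)" and "c\<eta> \<equiv> \<lambda>x. complex_of_real (\<eta> x)"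
  assumes v: "cv \<in> test_functions D" "\<And>x. 0 \<le> v x" "\<And>x. x \<notin> B \<Longrightarrow> v x = 0" and \<eta>: "c\<eta> \<in> test_functions D"
    and \<delta>: "\<And>x. x \<in> B \<Longrightarrow> \<delta> \<le> Re (laplacian c\<eta> x)" and t: "t \<ge> 0"
  shows "(energy (\<lambda>x. cv x + of_real t * c\<eta> x))
    \<le> (energy cv) - 2 * t * \<delta> * (LINT x|lborel. v x) + t\<^sup>2 * (energy c\<eta>)"
proof -
  note smv = test_functions_smooth[OF v(1)] and sm\<eta> = test_functions_smooth[OF \<eta>]
  define I where "I x = (\<Sum>i\<in>UNIV. partial_deriv i c\<eta> x * partial_deriv i cv x)" for x
  have pd: "partial_deriv i (\<lambda>x. cv x + of_real t * c\<eta> x) x = partial_deriv i cv x + of_real t * partial_deriv i c\<eta> x" for i x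
    by (simp add: partial_deriv_add smooth_differentiable smv sm\<eta> smooth_mult smooth_const
      partial_deriv_linear[OF bounded_linear_mult_right])
  have cross: "(norm (a + of_real t * b))\<^sup>2 = (norm a)\<^sup>2 + 2 * t * Re (b * a) + t\<^sup>2 * (norm b)\<^sup>2"
    if "b = of_real (Re b)" for a b :: complex
  proof -
    have "Im b = 0" by (subst that) simp
    then show ?thesis unfolding cmod_power2 by (simp add: power2_eq_square algebra_simps)
  qed
  have expand: "(norm (grad (\<lambda>x. cv x + of_real t * c\<eta> x) x))\<^sup>2 = (norm (grad cv x))\<^sup>2 + 2 * t * Re (I x) + t\<^sup>2 * (norm (grad c\<eta> x))\<^sup>2" for x
  proof -
    have "(norm (grad (\<lambda>x. cv x + of_real t * c\<eta> x) x))\<^sup>2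
      = (\<Sum>i\<in>UNIV. (norm (partial_deriv i cv x))\<^sup>2 + 2 * t * Re (partial_deriv i c\<eta> x * partial_deriv i cv x) + t\<^sup>2 * (norm (partial_deriv i c\<eta> x))\<^sup>2)"
      unfolding norm_vec_square grad_nth pd
      by (intro sum.cong refl cross) (rule partial_deriv_of_real[OF sm\<eta>[unfolded c\<eta>_def], folded c\<eta>_def])
    then show ?thesis
      by (simp add: norm_vec_square grad_nth I_def sum.distrib sum_distrib_left Re_sum)
  qed
  have prod_test: "(\<lambda>x. partial_deriv i c\<eta> x * partial_deriv i cv x) \<in> test_functions D" for i
    by (intro test_functions_mult test_functions_partial_deriv v smooth_partial_deriv sm\<eta>)
  have I: "I \<in> test_functions D"
    unfolding I_def[abs_def] by (intro test_functions_sum prod_test)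
  have "(LINT x|lborel. I x) = (\<Sum>i\<in>UNIV. LINT x|lborel. partial_deriv i c\<eta> x * partial_deriv i cv x)"
    unfolding I_def by (intro Bochner_Integration.integral_sum test_functions_integrable[OF prod_test])
  also have "\<dots> = (\<Sum>i\<in>UNIV. - (LINT x|lborel. partial_deriv i (partial_deriv i c\<eta>) x * cv x))"
    by (intro sum.cong refl integration_by_parts[OF v(1)] smooth_partial_deriv sm\<eta>)
  also have "\<dots> = - (LINT x|lborel. (\<Sum>i\<in>UNIV. partial_deriv i (partial_deriv i c\<eta>) x * cv x))"
    by (subst Bochner_Integration.integral_sum)
       (auto simp: sum_negf intro!: test_functions_integrable[OF test_functions_mult(2)[OF v(1)]] smooth_partial_deriv sm\<eta>)
  also have "\<dots> = - (LINT x|lborel. laplacian c\<eta> x * cv x)"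
    by (simp add: laplacian_def sum_distrib_right)
  finally have Ieq: "(LINT x|lborel. I x) = - (LINT x|lborel. laplacian c\<eta> x * cv x)" .
  have iL: "integrable lborel (\<lambda>x. laplacian c\<eta> x * cv x)"
    by (rule test_functions_integrable[OF test_functions_mult(2)[OF v(1) smooth_laplacian[OF sm\<eta>]]])
  have iv: "integrable lborel v"
    using integrable_Re[OF test_functions_integrable[OF v(1)]] by (simp add: cv_def)
  have "\<delta> * (LINT x|lborel. v x) = (LINT x|lborel. \<delta> * v x)" by simp
  also have "\<dots> \<le> (LINT x|lborel. Re (laplacian c\<eta> x * cv x))"
  proof (rule integral_mono[OF integrable_mult_right[OF iv] integrable_Re[OF iL]])
    fix x show "\<delta> * v x \<le> Re (laplacian c\<eta> x * cv x)"
      using \<delta>[of x] v(2)[of x] v(3)[of x] by (cases "x \<in> B") (auto simp: cv_def intro: mult_right_mono)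
  qed
  also have "\<dots> = Re (LINT x|lborel. laplacian c\<eta> x * cv x)" by (rule integral_Re[OF iL])
  also have "\<dots> = - (LINT x|lborel. Re (I x))"
    by (simp add: integral_Re[OF test_functions_integrable[OF I]] Ieq)
  finally have key: "(LINT x|lborel. Re (I x)) \<le> - (\<delta> * (LINT x|lborel. v x))" by simp
  have "(energy (\<lambda>x. cv x + of_real t * c\<eta> x))
    = (energy cv) + 2 * t * (LINT x|lborel. Re (I x)) + t\<^sup>2 * (energy c\<eta>)"
    unfolding expand
    using test_functions_sqint(2)[OF v(1)] test_functions_sqint(2)[OF \<eta>] integrable_Re[OF test_functions_integrable[OF I]]
    by simp
  also have "2 * t * (LINT x|lborel. Re (I x)) \<le> 2 * t * (- (\<delta> * (LINT x|lborel. v x)))"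
    using key t by (intro mult_left_mono) auto
  finally show ?thesis by (simp add: mult.assoc)
qed

section \<open>Nonexistence of Sobolev extremals\<close>

lemma integral_lborel_affine:
  fixes f :: "'a::euclidean_space \<Rightarrow> real"
  assumes [measurable]: "f \<in> borel_measurable borel" and c: "c \<noteq> 0"
  shows "(LINT x|lborel. f x) = \<bar>c\<bar> ^ DIM('a) * (LINT x|lborel. f (t + c *\<^sub>R x))"
  by (subst lborel_affine[OF c, of t]) (simp add: integral_density integral_distr)

lemma norm_grad_affine:
  assumes "smooth f"
  shows "(norm (grad (\<lambda>x. f (a + c *\<^sub>R x)) x))\<^sup>2 = c\<^sup>2 * (norm (grad f (a + c *\<^sub>R x)))\<^sup>2"
proof -
  have "grad (\<lambda>x. f (a + c *\<^sub>R x)) x = c *\<^sub>R grad f (a + c *\<^sub>R x)"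
    by (simp add: vec_eq_iff grad_nth partial_deriv_affine(1)[OF smooth_differentiable[OF assms]] scaleR_conv_of_real[where 'a = complex])
  then show ?thesis by (simp add: power_mult_distrib)
qed

text \<open>The critical Sobolev quotient is invariant under dilations. A function on \<open>D\<close> can therefore
  be shrunk into a small ball in \<open>D\<close> on which some \<open>\<eta>\<close> is strictly subharmonic, and adding a small
  multiple of \<open>\<eta>\<close> lowers its energy to first order without lowering its \<open>L\<^sup>2\<^sup>q\<close> norm.\<close>

lemma improved_Sobolev:
  fixes D :: "(real^'n) set" and \<eta> :: "real^'n \<Rightarrow> real"
  assumes n: "CARD('n) \<ge> 3" and q: "q = CARD('n) / (real CARD('n) - 2)" and bD: "bounded D" and \<kappa>: "\<kappa> \<ge> 0"
    and Sob: "\<forall>f\<in>test_functions D. epow (powint (2 * q) lborel f) (1 / q) \<le> ennreal \<kappa> * sqint lborel (grad f)"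
    and \<eta>: "cmplx \<eta> \<in> test_functions D" "\<And>x. 0 \<le> \<eta> x"
      "\<rho> > 0" "\<delta> > 0" "ball p \<rho> \<subseteq> D" "\<forall>x\<in>ball p \<rho>. \<delta> \<le> Re (laplacian (cmplx \<eta>) x)"
  shows "\<exists>\<alpha>>0. \<exists>\<beta>\<ge>0. \<forall>t\<ge>0. \<forall>w. cmplx w \<in> test_functions D \<longrightarrow> (\<forall>x. 0 \<le> w x) \<longrightarrow>
      epow (powint (2 * q) lborel (cmplx w)) (1 / q)
      \<le> ennreal (\<kappa> * (energy (cmplx w) - t * \<alpha> * (LINT x|lborel. w x) + t\<^sup>2 * \<beta>))"
proof -
  let ?c\<eta> = "\<lambda>x. complex_of_real (\<eta> x)"
  obtain R where R: "R > 0" "D \<subseteq> ball 0 R" using bD by (metis bounded_subset_ballD)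
  \<comment> \<open>Dilation by this factor shrinks the ball of radius R, which contains
    \<open>D\<close>, to radius \<rho>.\<close>
  define \<mu> where "\<mu> = R / \<rho>"
  have \<mu>: "\<mu> > 0" using R \<eta>(3) by (simp add: \<mu>_def)
  \<comment> \<open>Passing from w to its shrunken copy v divides both the energy and the squared
    L^(2q) norm by m. For the norm this is \<open>mq\<close>, which depends on 1/q = (n-2)/n being
    the critical exponent.\<close>
  define m where "m = \<mu> ^ (CARD('n) - 2)"
  have m: "m > 0" using \<mu> by (simp add: m_def)
  have mn: "\<mu> ^ CARD('n) = m * \<mu>\<^sup>2"
  proof -
    have "CARD('n) = (CARD('n) - 2) + 2" using n by simp
    then show ?thesis by (metis m_def power_add)
  qed
  have q1: "q > 0" using n by (simp add: q)
  have mq: "(\<mu> ^ CARD('n)) powr (1 / q) = m"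
  proof -
    have "(\<mu> ^ CARD('n)) powr (1 / q) = \<mu> powr (real CARD('n) * (1 / q))"
      using \<mu> by (simp add: powr_realpow[symmetric] powr_powr)
    also have "real CARD('n) * (1 / q) = real (CARD('n) - 2)"
      using n by (simp add: q of_nat_diff)
    finally show ?thesis using \<mu> by (simp add: m_def powr_realpow)
  qed
  define c where "c = energy ?c\<eta>"
  have c: "c \<ge> 0" unfolding c_def by (rule Bochner_Integration.integral_nonneg) simp
  show ?thesis
  \<comment> \<open>The bound for v is multiplied by m to return to w. The integral of w is m
    \<mu>^2 times that of v, which explains the division by \<mu>^2; the energy of \<eta> does not
    rescale and picks up the factor m.\<close>
  proof (rule exI[of _ "2 * \<delta> / \<mu>\<^sup>2"], rule conjI[OF _ exI[of _ "c * m"]]; (intro conjI allI impI)?)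
    show "2 * \<delta> / \<mu>\<^sup>2 > 0" "c * m \<ge> 0" using \<mu> \<eta>(4) c m by auto
    fix t :: real and w :: "real^'n \<Rightarrow> real"
    assume t: "t \<ge> 0" and w: "cmplx w \<in> test_functions D" "\<forall>x. 0 \<le> w x"
    let ?cw = "\<lambda>x. complex_of_real (w x)"
    let ?a = "- \<mu> *\<^sub>R p"
    define v where "v x = w (?a + \<mu> *\<^sub>R x)" for x
    let ?cv = "\<lambda>x. complex_of_real (v x)"
    note smw = test_functions_smooth[OF w(1)]
    have "(\<lambda>x. ?cw (?a + \<mu> *\<^sub>R x)) \<in> test_functions (ball p \<rho>)"
    proof (rule test_functions_affine[OF w(1)])
      fix x assume "?a + \<mu> *\<^sub>R x \<in> D"
      then have "?a + \<mu> *\<^sub>R x \<in> ball 0 R" using R(2) by blast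
      then have "norm (\<mu> *\<^sub>R (x - p)) < R" by (simp add: algebra_simps)
      then have "\<mu> * norm (x - p) < R" using \<mu> by simp
      also have "R = \<mu> * \<rho>" using \<eta>(3) by (simp add: \<mu>_def)
      finally have "\<mu> * norm (x - p) < \<mu> * \<rho>" .
      then show "x \<in> ball p \<rho>" using \<mu> by (simp add: dist_norm norm_minus_commute)
    qed (use \<mu> in simp)
    then have cvB: "?cv \<in> test_functions (ball p \<rho>)" by (simp add: v_def)
    then have cv: "?cv \<in> test_functions D" using \<eta>(5) unfolding test_functions_def by blast
    have v0: "v x = 0" if "x \<notin> ball p \<rho>" for x
      using test_functions_outside[OF cvB that] by simp
    have [measurable]: "w \<in> borel_measurable borel"
    proof -
      have "(\<lambda>x. Re (?cw x)) \<in> borel_measurable borel"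
        using test_functions_borel_measurable[OF w(1)] by measurable
      then show ?thesis by simp
    qed
    have [measurable]: "grad ?cw \<in> borel_measurable borel"
      by (rule smooth_measurable_grad[OF smw])
    have P: "powint (2 * q) lborel ?cw = ennreal (\<mu> ^ CARD('n)) * powint (2 * q) lborel ?cv"
      using \<mu> nn_integral_lborel_affine[of "\<lambda>x. ennreal (norm (?cw x) powr (2 * q))" \<mu> ?a]
      by (simp add: v_def)
    have W: "(LINT x|lborel. w x) = \<mu> ^ CARD('n) * (LINT x|lborel. v x)"
      using \<mu> integral_lborel_affine[of w \<mu> ?a] by (simp add: v_def)
    have A: "\<mu>\<^sup>2 * (energy ?cw) = \<mu> ^ CARD('n) * (energy ?cv)"
    proof -
      have "(norm (grad ?cv x))\<^sup>2 = \<mu>\<^sup>2 * (norm (grad ?cw (?a + \<mu> *\<^sub>R x)))\<^sup>2" for x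
        unfolding v_def by (rule norm_grad_affine[OF smw])
      then show ?thesis
        using \<mu> integral_lborel_affine[of "\<lambda>x. (norm (grad ?cw x))\<^sup>2" \<mu> ?a] by simp
    qed
    let ?f = "\<lambda>x. ?cv x + of_real t * ?c\<eta> x"
    have f: "?f \<in> test_functions D"
      by (intro test_functions_add cv test_functions_mult(2)[OF \<eta>(1)] smooth_const)
    have "epow (powint (2 * q) lborel ?cv) (1 / q) \<le> epow (powint (2 * q) lborel ?f) (1 / q)"
    proof (intro epow_mono nn_integral_mono ennreal_leI powr_mono2)
      fix x
      have "?f x = complex_of_real (v x + t * \<eta> x)" by simp
      then have "norm (?f x) = \<bar>v x + t * \<eta> x\<bar>" by (simp only: norm_of_real)
      then show "norm (?cv x) \<le> norm (?f x)"
        using t \<eta>(2)[of x] w(2) by (simp add: v_def)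
    qed (use q1 in auto)
    also have "\<dots> \<le> ennreal \<kappa> * sqint lborel (grad ?f)" by (rule bspec[OF Sob f])
    also have "sqint lborel (grad ?f) = ennreal (energy ?f)"
      by (rule nn_integral_eq_integral[OF test_functions_sqint(2)[OF f]]) simp
    also have "ennreal \<kappa> * \<dots> = ennreal (\<kappa> * (energy ?f))"
      using \<kappa> by (simp add: ennreal_mult' )
    also have "\<dots> \<le> ennreal (\<kappa> * ((energy ?cv) - 2 * t * \<delta> * (LINT x|lborel. v x) + t\<^sup>2 * c))"
      unfolding c_def
    proof (intro ennreal_leI mult_left_mono \<kappa> perturbed_energy[where B = "ball p \<rho>"])
      show "0 \<le> v x" for x using w(2) by (simp add: v_def)
    qed (fact cv v0 \<eta>(1) bspec[OF \<eta>(6)] t)+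
    finally have "ennreal m * epow (powint (2 * q) lborel ?cv) (1 / q)
        \<le> ennreal m * ennreal (\<kappa> * ((energy ?cv) - 2 * t * \<delta> * (LINT x|lborel. v x) + t\<^sup>2 * c))"
      by (rule mult_left_mono) simp
    also have "\<dots> = ennreal (m * (\<kappa> * ((energy ?cv) - 2 * t * \<delta> * (LINT x|lborel. v x) + t\<^sup>2 * c)))"
      using m by (simp add: ennreal_mult')
    also have "m * (\<kappa> * ((energy ?cv) - 2 * t * \<delta> * (LINT x|lborel. v x) + t\<^sup>2 * c))
      = \<kappa> * ((energy ?cw) - t * (2 * \<delta> / \<mu>\<^sup>2) * (LINT x|lborel. w x) + t\<^sup>2 * (c * m))"
    proof -
      have "(energy ?cw) = m * (energy ?cv)"
        using A \<mu> unfolding mn by simp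
      moreover have "(LINT x|lborel. w x) = \<mu>\<^sup>2 * (m * (LINT x|lborel. v x))"
        using W unfolding mn by simp
      ultimately show ?thesis using \<mu> by (simp add: algebra_simps)
    qed
    also have "ennreal m * epow (powint (2 * q) lborel ?cv) (1 / q) = epow (powint (2 * q) lborel ?cw) (1 / q)"
      unfolding P epow_mult using \<mu> by (simp add: mq)
    finally show "epow (powint (2 * q) lborel ?cw) (1 / q)
      \<le> ennreal (\<kappa> * ((energy ?cw) - t * (2 * \<delta> / \<mu>\<^sup>2) * (LINT x|lborel. w x) + t\<^sup>2 * (c * m)))" .
  qed
qed

text \<open>The difference of the squares is at most |f - g|^2 + 2 |g| |f - g|, and Cauchy-Schwarz
  handles the second term.\<close>

lemma tendsto_integral_norm_square:
  fixes f :: "nat \<Rightarrow> 'a \<Rightarrow> 'b::euclidean_space"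
  assumes [measurable]: "\<And>k. f k \<in> borel_measurable M" "g \<in> borel_measurable M"
    and g: "sqint M g < top" and f: "\<And>k. sqint M (f k) < top"
    and lim: "(\<lambda>k. sqint M (\<lambda>x. f k x - g x)) \<longlonglongrightarrow> 0"
  shows "(\<lambda>k. LINT x|M. (norm (f k x))\<^sup>2) \<longlonglongrightarrow> (LINT x|M. (norm (g x))\<^sup>2)"
proof (rule tendsto_L1_int)
  show "integrable M (\<lambda>x. (norm (g x))\<^sup>2)" "integrable M (\<lambda>x. (norm (f k x))\<^sup>2)" for k
    by (rule integrableI_nonneg; use g f[of k] in simp)+
  let ?e = "\<lambda>k. sqint M (\<lambda>x. f k x - g x)"
  have bound: "(\<integral>\<^sup>+x. ennreal (norm ((norm (f k x))\<^sup>2 - (norm (g x))\<^sup>2)) \<partial>M)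
      \<le> ?e k + 2 * (epow (sqint M g) (1/2) * epow (?e k) (1/2))" for k
  proof -
    have "norm ((norm (f k x))\<^sup>2 - (norm (g x))\<^sup>2) \<le> (norm (f k x - g x))\<^sup>2 + 2 * (norm (g x) * norm (f k x - g x))" for x
    proof -
      let ?a = "norm (f k x)" and ?b = "norm (g x)" and ?d = "norm (f k x - g x)"
      have ab: "\<bar>?a - ?b\<bar> \<le> ?d" by (rule norm_triangle_ineq3)
      have "norm (?a\<^sup>2 - ?b\<^sup>2) = \<bar>?a - ?b\<bar> * (?a + ?b)"
        by (simp add: power2_eq_square square_diff_square_factored abs_mult)
      also have "\<dots> \<le> ?d * (?d + 2 * ?b)"
        using ab by (intro mult_mono) auto
      finally show ?thesis by (simp add: power2_eq_square algebra_simps)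
    qed
    then have "(\<integral>\<^sup>+x. ennreal (norm ((norm (f k x))\<^sup>2 - (norm (g x))\<^sup>2)) \<partial>M)
        \<le> (\<integral>\<^sup>+x. ennreal ((norm (f k x - g x))\<^sup>2) + 2 * (ennreal (norm (g x)) * ennreal (norm (f k x - g x))) \<partial>M)"
      by (intro nn_integral_mono) (simp add: ennreal_mult[symmetric] ennreal_plus[symmetric] ennreal_leI
        flip: ennreal_numeral del: ennreal_plus)
    also have "\<dots> = ?e k + 2 * (\<integral>\<^sup>+x. ennreal (norm (g x)) * ennreal (norm (f k x - g x)) \<partial>M)"
      by (simp add: nn_integral_add nn_integral_cmult)
    also have "(\<integral>\<^sup>+x. ennreal (norm (g x)) * ennreal (norm (f k x - g x)) \<partial>M)
      \<le> epow (\<integral>\<^sup>+x. (ennreal (norm (g x)))\<^sup>2 \<partial>M) (1/2) * epow (\<integral>\<^sup>+x. (ennreal (norm (f k x - g x)))\<^sup>2 \<partial>M) (1/2)"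
      by (rule Cauchy_Schwarz_ennreal) measurable
    finally show ?thesis by (simp add: ennreal_power add_left_mono mult_left_mono)
  qed
  have "(\<lambda>k. ?e k + 2 * (epow (sqint M g) (1/2) * epow (?e k) (1/2))) \<longlonglongrightarrow> 0 + 0"
    using g by (intro tendsto_add lim tendsto_cmult_ennreal_0 epow_tendsto_0) (auto simp: epow_less_top_iff)
  then have lim0: "(\<lambda>k. ?e k + 2 * (epow (sqint M g) (1/2) * epow (?e k) (1/2))) \<longlonglongrightarrow> 0" by simp
  show "(\<lambda>k. \<integral>\<^sup>+x. ennreal (norm ((norm (f k x))\<^sup>2 - (norm (g x))\<^sup>2)) \<partial>M) \<longlonglongrightarrow> 0"
    by (rule tendsto_sandwich[OF _ _ tendsto_const lim0]) (use bound in auto)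
qed

text \<open>The constants \<alpha> and \<beta> are fixed before the test function w. One value of t
  therefore lowers the bound for all late approximants by the same positive amount, and Fatou's
  lemma carries the improved bound over to |u|.\<close>

theorem no_Sobolev_extremal:
  fixes D :: "(real^'n) set"
  assumes D: "bounded_domain D" and n: "CARD('n) \<ge> 3" and q: "q = CARD('n) / (real CARD('n) - 2)"
    and u: "u \<in> W012 D" and U0: "0 < powint (2 * q) (lebesgue_on D) u"
    and K: "sobolev_const (ennreal q) D < top"
  shows "epow (powint (2 * q) (lebesgue_on D) u) (1 / q)
    < (sobolev_const (ennreal q) D)\<^sup>2 * sqint (lebesgue_on D) (weak_gradient D u)"
proof (rule ccontr)
  let ?M = "lebesgue_on D" and ?g = "weak_gradient D u"
  let ?U = "powint (2 * q) ?M u"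
  assume "\<not> ?thesis"
  then have ext: "(sobolev_const (ennreal q) D)\<^sup>2 * sqint ?M ?g \<le> epow ?U (1 / q)" by simp
  note bD = bounded_domainD[OF D]
  have q1: "q \<ge> 1" using n by (simp add: q field_simps)
  obtain \<psi> where \<psi>: "\<And>k::nat. \<psi> k \<in> test_functions D"
    "\<And>k. sqint ?M (\<lambda>x. grad (\<psi> k) x - ?g x) < top"
    "(\<lambda>k. sqint ?M (\<lambda>x. grad (\<psi> k) x - ?g x)) \<longlonglongrightarrow> 0"
    "AE x in ?M. (\<lambda>k. \<psi> k x) \<longlonglongrightarrow> u x"
    using W012_approximation[OF u] by blast
  note um [measurable] = W012_measurable(1,2)[OF u]
  note [measurable] = test_functions_lebesgue_on[OF \<psi>(1)]
  have nz: "\<not> (AE x in ?M. u x = 0)"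
  proof
    assume "AE x in ?M. u x = 0"
    then have "?U = (\<integral>\<^sup>+x. 0 \<partial>?M)" by (intro nn_integral_cong_AE) (auto elim: eventually_mono)
    then show False using U0 by simp
  qed
  \<comment> \<open>A nonzero approximant is what the uniqueness of weak gradients and the
    construction of \<eta> require.\<close>
  have "\<exists>k. \<not> (AE x in ?M. \<psi> k x = 0)"
  proof (rule ccontr)
    assume "\<not> ?thesis"
    then have "AE x in ?M. \<forall>k. \<psi> k x = 0" by (simp add: AE_all_countable)
    with \<psi>(4) have "AE x in ?M. u x = 0"
      by eventually_elim (simp add: LIMSEQ_const_iff)
    then show False using nz by simp
  qed
  then obtain k0 where k0: "\<not> (AE x in ?M. \<psi> k0 x = 0)" by blast
  have k0': "\<not> (AE x in lborel. \<psi> k0 x = 0)"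
  proof
    assume "AE x in lborel. \<psi> k0 x = 0"
    then have "AE x in lebesgue. \<psi> k0 x = 0" by (rule AE_completion)
    then have "AE x in lebesgue. x \<in> D \<longrightarrow> \<psi> k0 x = 0" by eventually_elim simp
    then have "AE x in ?M. \<psi> k0 x = 0" using bD(3) by (subst AE_restrict_space_iff) auto
    then show False using k0 by simp
  qed
  then have "\<exists>p0. \<psi> k0 p0 \<noteq> 0" by (cases "\<forall>x. \<psi> k0 x = 0") auto
  then obtain p0 where p0: "\<psi> k0 p0 \<noteq> 0" by blast
  define \<kappa> where "\<kappa> = enn2real ((sobolev_const (ennreal q) D)\<^sup>2)"
  have "(sobolev_const (ennreal q) D)\<^sup>2 < top" using K by (simp add: power2_eq_square ennreal_mult_less_top)
  then have \<kappa>: "\<kappa> \<ge> 0" "(sobolev_const (ennreal q) D)\<^sup>2 = ennreal \<kappa>" by (auto simp: \<kappa>_def)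
  have Sob: "\<forall>f\<in>test_functions D. epow (powint (2 * q) lborel f) (1 / q) \<le> ennreal \<kappa> * sqint lborel (grad f)"
  proof
    fix f assume f: "f \<in> test_functions D"
    show "epow (powint (2 * q) lborel f) (1 / q) \<le> ennreal \<kappa> * sqint lborel (grad f)"
      using sobolev_const_test_function[OF bD(1) \<psi>(1) p0 f q1 K] unfolding \<kappa>(2) .
  qed
  obtain \<eta> :: "real^'n \<Rightarrow> real" and \<rho> \<delta> p where \<eta>: "cmplx \<eta> \<in> test_functions D" "\<And>x. 0 \<le> \<eta> x"
    "\<rho> > 0" "\<delta> > 0" "ball p \<rho> \<subseteq> D" "\<forall>x\<in>ball p \<rho>. \<delta> \<le> Re (laplacian (cmplx \<eta>) x)"
    by (rule strictly_subharmonic_ball[OF bD(1) \<psi>(1) k0']) (rule that; assumption)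
  obtain \<alpha> \<beta> where \<alpha>: "\<alpha> > 0" "\<beta> \<ge> 0" and improved:
    "\<forall>t\<ge>0. \<forall>w. cmplx w \<in> test_functions D \<longrightarrow> (\<forall>x. 0 \<le> w x) \<longrightarrow>
      epow (powint (2 * q) lborel (cmplx w)) (1 / q)
      \<le> ennreal (\<kappa> * (energy (cmplx w) - t * \<alpha> * (LINT x|lborel. w x) + t\<^sup>2 * \<beta>))"
    using improved_Sobolev[OF n q bD(2) \<kappa>(1) Sob \<eta>] by metis
  have "\<exists>w :: real^'n \<Rightarrow> real. cmplx w \<in> test_functions D \<and> (\<forall>x. 0 \<le> w x) \<and>
    (\<forall>x. \<bar>w x - norm (\<psi> k x)\<bar> \<le> inverse (Suc k)) \<and>
    (\<forall>x. norm (grad (cmplx w) x) \<le> norm (grad (\<psi> k) x))" for k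
    by (rule smoothed_modulus[OF \<psi>(1)]) simp
  then obtain w :: "nat \<Rightarrow> real^'n \<Rightarrow> real" where w: "\<And>k. (\<lambda>x. complex_of_real (w k x)) \<in> test_functions D"
    "\<And>k x. 0 \<le> w k x" "\<And>k x. \<bar>w k x - norm (\<psi> k x)\<bar> \<le> inverse (Suc k)"
    "\<And>k x. norm (grad (\<lambda>x. complex_of_real (w k x)) x) \<le> norm (grad (\<psi> k) x)"
    by metis
  let ?cw = "\<lambda>k x. complex_of_real (w k x)"
  have limw: "AE x in ?M. (\<lambda>k. w k x) \<longlonglongrightarrow> norm (u x)"
    using \<psi>(4)
  proof eventually_elim
    case (elim x)
    have "(\<lambda>k. w k x - norm (\<psi> k x)) \<longlonglongrightarrow> 0"
      by (rule Lim_null_comparison[OF _ LIMSEQ_inverse_real_of_nat]) (use w(3) in auto)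
    from tendsto_add[OF this tendsto_norm[OF elim]] show ?case by simp
  qed
  define G where "G = (LINT x|?M. (norm (?g x))\<^sup>2)"
  have Gfin: "sqint ?M ?g < top" by (rule W012_measurable(4)[OF u])
  have G: "sqint ?M ?g = ennreal G" "G \<ge> 0"
  proof -
    have "integrable ?M (\<lambda>x. (norm (?g x))\<^sup>2)" by (rule integrableI_nonneg) (use Gfin in auto)
    then show "sqint ?M ?g = ennreal G" unfolding G_def by (rule nn_integral_eq_integral) simp
    show "G \<ge> 0" unfolding G_def by (rule Bochner_Integration.integral_nonneg) simp
  qed
  have limg: "(\<lambda>k. LINT x|lborel. (norm (grad (\<psi> k) x))\<^sup>2) \<longlonglongrightarrow> G"
  proof -
    have "(\<lambda>k. LINT x|?M. (norm (grad (\<psi> k) x))\<^sup>2) \<longlonglongrightarrow> G"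
      unfolding G_def using Gfin \<psi>(3) test_functions_sqint(4)[OF \<psi>(1)]
      by (intro tendsto_integral_norm_square) (auto simp: sqint_lebesgue_on(2)[OF bD(3) \<psi>(1)])
    moreover have "(LINT x|?M. (norm (grad (\<psi> k) x))\<^sup>2) = (energy (\<psi> k))" for k
    proof -
      have [measurable]: "grad (\<psi> k) \<in> borel_measurable borel"
        by (intro smooth_measurable_grad test_functions_smooth[OF \<psi>(1)])
      show ?thesis using bD(3) grad_outside[OF \<psi>(1)] by (intro integral_lebesgue_on) auto
    qed
    ultimately show ?thesis by simp
  qed
  \<comment> \<open>The gain is proportional to the integral of \<open>w k\<close>, so it must stay
    away from 0. Fatou's lemma bounds it from below by means of the integral of |u|, which is
    positive.\<close>
  obtain B where B: "B > 0" "\<forall>\<^sub>F k in sequentially. B < (LINT x|lborel. w k x)"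
  proof -
    have [measurable]: "w k \<in> borel_measurable ?M" for k
    proof -
      have "(\<lambda>x. Re (?cw k x)) \<in> borel_measurable ?M"
        using test_functions_lebesgue_on(1)[OF w(1)] by measurable
      then show ?thesis by simp
    qed
    have "(\<integral>\<^sup>+x. ennreal (norm (u x)) \<partial>?M) \<noteq> 0"
      using nz by (subst nn_integral_0_iff_AE) auto
    then obtain b where b: "0 < b" "b < (\<integral>\<^sup>+x. ennreal (norm (u x)) \<partial>?M)"
      using dense zero_less_iff_neq_zero by metis
    have "(\<integral>\<^sup>+x. ennreal (norm (u x)) \<partial>?M) = (\<integral>\<^sup>+x. liminf (\<lambda>k. ennreal (w k x)) \<partial>?M)"
    proof (rule nn_integral_cong_AE)
      show "AE x in ?M. ennreal (norm (u x)) = liminf (\<lambda>k. ennreal (w k x))"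
        using limw
      proof eventually_elim
        case (elim x)
        then show ?case
          by (metis lim_imp_Liminf tendsto_ennrealI trivial_limit_sequentially)
      qed
    qed
    also have "\<dots> \<le> liminf (\<lambda>k. \<integral>\<^sup>+x. ennreal (w k x) \<partial>?M)"
      by (rule nn_integral_liminf) measurable
    finally have "b < liminf (\<lambda>k. \<integral>\<^sup>+x. ennreal (w k x) \<partial>?M)" using b(2) by simp
    then have ev: "\<forall>\<^sub>F k in sequentially. b < (\<integral>\<^sup>+x. ennreal (w k x) \<partial>?M)" by (rule less_LiminfD)
    have eq: "(\<integral>\<^sup>+x. ennreal (w k x) \<partial>?M) = ennreal (LINT x|lborel. w k x)" for k
    proof -
      have iw: "integrable lborel (w k)"
        using integrable_Re[OF test_functions_integrable[OF w(1)[of k]]] by simp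
      then have [measurable]: "w k \<in> borel_measurable borel" by auto
      have "w k x = 0" if "x \<notin> D" for x using test_functions_outside[OF w(1)[of k] that] by simp
      then have "(\<integral>\<^sup>+x. ennreal (w k x) \<partial>?M) = (\<integral>\<^sup>+x. ennreal (w k x) \<partial>lborel)"
        using bD(3) by (intro nn_integral_lebesgue_on) auto
      also have "\<dots> = ennreal (LINT x|lborel. w k x)"
        by (rule nn_integral_eq_integral[OF iw]) (use w(2) in auto)
      finally show ?thesis .
    qed
    from ev obtain k where "b < ennreal (LINT x|lborel. w k x)"
      unfolding eq by (auto simp: eventually_sequentially)
    then obtain B where "b = ennreal B" "B \<ge> 0" by (cases b) auto
    with b(1) ev show thesis
      unfolding eq by (intro that[of B]) (auto simp: ennreal_less_iff elim: eventually_mono)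
  qed
  \<comment> \<open>This solves t (\<beta> + 1) = \<alpha> B, so that the change -t \<alpha> B + t^2
    \<beta> is exactly -t^2. The added 1 covers \<beta> = 0.\<close>
  define t where "t = \<alpha> * B / (\<beta> + 1)"
  define \<tau> where "\<tau> = t\<^sup>2"
  have t: "t > 0" "\<tau> > 0" using \<alpha> B(1) by (auto simp: t_def \<tau>_def power2_eq_square)
  have tb: "- t * \<alpha> * B + t\<^sup>2 * \<beta> = - \<tau>"
  proof -
    have "\<alpha> * B = t * (\<beta> + 1)" using \<alpha> by (simp add: t_def)
    then have "- t * \<alpha> * B + t\<^sup>2 * \<beta> = - t * (t * (\<beta> + 1)) + t\<^sup>2 * \<beta>" by (simp add: mult.assoc)
    then show ?thesis by (simp add: \<tau>_def power2_eq_square algebra_simps)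
  qed
  have "\<forall>\<^sub>F k in sequentially. (energy (\<psi> k)) < G + \<tau> / 2"
    using order_tendstoD(2)[OF limg, of "G + \<tau> / 2"] t by simp
  \<comment> \<open>For large k the energy of the approximant exceeds G by less than \<tau>/2, so
    half of the gain \<tau> remains.\<close>
  with B(2) have "\<forall>\<^sub>F k in sequentially. powint (2 * q) ?M (?cw k) \<le> epow (ennreal (\<kappa> * (G - \<tau> / 2))) q"
  proof eventually_elim
    case (elim k)
    have "epow (powint (2 * q) lborel (?cw k)) (1 / q)
      \<le> ennreal (\<kappa> * ((energy (?cw k)) - t * \<alpha> * (LINT x|lborel. w k x) + t\<^sup>2 * \<beta>))"
      using t w(1,2) improved by simp
    also have "\<dots> \<le> ennreal (\<kappa> * (G - \<tau> / 2))"
    proof (intro ennreal_leI mult_left_mono \<kappa>(1))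
      have "(energy (?cw k)) \<le> (energy (\<psi> k))"
        by (rule Bochner_Integration.integral_mono[OF test_functions_sqint(2)[OF w(1)] test_functions_sqint(2)[OF \<psi>(1)]])
           (intro power_mono w(4), simp)
      moreover have "t * \<alpha> * B \<le> t * \<alpha> * (LINT x|lborel. w k x)"
        using t \<alpha> elim(1) by (intro mult_left_mono) auto
      ultimately show "(energy (?cw k)) - t * \<alpha> * (LINT x|lborel. w k x) + t\<^sup>2 * \<beta> \<le> G - \<tau> / 2"
        using elim(2) tb by linarith
    qed
    finally have "epow (epow (powint (2 * q) lborel (?cw k)) (1 / q)) q \<le> epow (ennreal (\<kappa> * (G - \<tau> / 2))) q"
      using q1 by (intro epow_mono) auto
    then show ?case
      unfolding sqint_lebesgue_on(3)[OF bD(3) w(1)] using q1 by (simp add: epow_epow)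
  qed
  then have "powint (2 * q) ?M (\<lambda>x. complex_of_real (norm (u x))) \<le> epow (ennreal (\<kappa> * (G - \<tau> / 2))) q"
  proof (rule Fatou_powint[rotated 3])
    show "AE x in ?M. (\<lambda>k. ?cw k x) \<longlonglongrightarrow> complex_of_real (norm (u x))"
      using limw by eventually_elim (rule tendsto_of_real)
  qed (use q1 test_functions_lebesgue_on(1)[OF w(1)] in auto)
  then have Ule: "?U \<le> epow (ennreal (\<kappa> * (G - \<tau> / 2))) q" by simp
  \<comment> \<open>\<open>ennreal\<close> truncates negative numbers to 0, so positivity must be
    secured before the final inequality can be read in the reals. It also shows that \<kappa> is
    nonzero.\<close>
  have pos: "\<kappa> * (G - \<tau> / 2) > 0"
  proof (rule ccontr)
    assume "\<not> ?thesis"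
    then have "ennreal (\<kappa> * (G - \<tau> / 2)) = 0" by (simp add: ennreal_eq_0_iff)
    then show False using Ule U0 by simp
  qed
  have "ennreal (\<kappa> * G) = ennreal \<kappa> * ennreal G" using \<kappa>(1) G(2) by (simp add: ennreal_mult)
  also have "\<dots> \<le> epow ?U (1 / q)" using ext by (simp add: \<kappa>(2) G(1))
  also have "\<dots> \<le> epow (epow (ennreal (\<kappa> * (G - \<tau> / 2))) q) (1 / q)"
    using Ule q1 by (intro epow_mono) auto
  also have "\<dots> = ennreal (\<kappa> * (G - \<tau> / 2))" using q1 by (simp add: epow_epow)
  finally have "\<kappa> * G \<le> \<kappa> * (G - \<tau> / 2)" using pos by (simp add: ennreal_le_iff)
  then have "\<kappa> * \<tau> \<le> 0" by (simp add: algebra_simps)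
  then have "\<kappa> \<le> 0" using t(2) by (simp add: mult_le_0_iff)
  then show False using pos \<kappa>(1) by simp
qed

text \<open>The energy inequality and the Sobolev quotient bound G by the product times G, and G
  cancels because it is positive and finite. If the Sobolev constant is infinite, the product is
  infinite as well, since G > 0 forces the norm of V_+ to be nonzero.\<close>

lemma sobolev_const_potential_ge_1:
  fixes D :: "(real^'n) set" and V :: "real^'n \<Rightarrow> real"
  assumes D: "bounded_domain D" and V: "V \<in> Lp_space r D" and E: "E \<le> 0"
    and u: "u \<in> W012 D" and nontriv: "nontrivial_on D u" and sol: "distributional_solution D V E u"
    and rq: "conj_exponents r q"
    and qn: "CARD('n) \<ge> 3 \<Longrightarrow> q \<le> CARD('n) / (real CARD('n) - 2)"
  shows "1 \<le> (sobolev_const (ennreal q) D)\<^sup>2 * Lp_norm r D (\<lambda>x. max (V x) 0)"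
proof -
  let ?K = "sobolev_const (ennreal q) D" and ?N = "Lp_norm r D (\<lambda>x. max (V x) 0)"
  let ?G = "sqint (lebesgue_on D) (weak_gradient D u)" and ?U = "powint (2 * q) (lebesgue_on D) u"
  note en = energy_inequality[OF D V E u nontriv sol rq qn]
  have q: "q \<ge> 1" using rq by auto
  show ?thesis
  proof (cases "?K < top")
    case True
    have "?G \<le> ?N * epow ?U (1 / q)" by (rule en(4))
    also have "\<dots> \<le> ?N * (?K\<^sup>2 * ?G)"
      by (intro mult_left_mono sobolev_quotient_le[OF u nontriv q True]) simp
    finally have "?G / ?G \<le> (?K\<^sup>2 * ?N) * ?G / ?G"
      by (intro divide_right_mono_ennreal) (simp add: mult_ac)
    then show ?thesis
      using en(3) W012_measurable(4)[OF u] by (simp add: ennreal_divide_self ennreal_mult_divide_eq)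
  next
    case False
    then have "?K = top" by (simp add: less_top[symmetric])
    moreover have "?N \<noteq> 0" using en(3,4) by auto
    ultimately show ?thesis by (simp add: power2_eq_square ennreal_top_mult)
  qed
qed

section \<open>The subcritical and the critical exponent\<close>

theorem corollary1p3:
  fixes D :: "(real^'n) set" and V :: "real^'n \<Rightarrow> real" and E :: real
    and r :: ennreal and u :: "real^'n \<Rightarrow> complex"
  assumes "bounded_domain D"
    and "V \<in> Lp_space r D"
    and "E \<le> 0"
    and "u \<in> W012 D"
    and "nontrivial_on D u"
    and "distributional_solution D V E u"
  shows "(\<forall>q::ennreal. max 1 (ennreal (real CARD('n) / 2)) < r \<and> r \<le> \<infinity> \<and> 1 / q + 1 / r = 1 \<longrightarrow>
            (sobolev_const q D)\<^sup>2 * Lp_norm r D (\<lambda>x. max (V x) 0) \<ge> 1) \<and>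
         (CARD('n) \<ge> 3 \<and> r = ennreal (real CARD('n) / 2) \<longrightarrow>
            (sobolev_const (ennreal (real CARD('n) / (real CARD('n) - 2))) D)\<^sup>2
              * Lp_norm r D (\<lambda>x. max (V x) 0) > 1)"
proof (intro conjI allI impI; elim conjE)
  fix q :: ennreal
  assume r: "max 1 (ennreal (real CARD('n) / 2)) < r" and q: "1 / q + 1 / r = 1"
  then obtain q' where q': "q = ennreal q'" "q' \<ge> 1"
    "conj_exponents r q'"
    using conjugate_exponents[of r q] by auto
  \<comment> \<open>Conjugation reverses the order, so r > n/2 places q below n/(n-2), the conjugate
    of n/2.\<close>
  have "q' \<le> CARD('n) / (real CARD('n) - 2)" if n: "CARD('n) \<ge> 3"
    using q'(3)
  proof (elim disjE exE conjE)
    fix \<rho> :: real assume \<rho>: "\<rho> > 1" "r = ennreal \<rho>" "q' > 1" "1 / q' + 1 / \<rho> = 1"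
    have "real CARD('n) / 2 < \<rho>" using r \<rho> by (auto simp: ennreal_less_iff)
    then have "1 / \<rho> < 2 / CARD('n)" using n \<rho>(1) by (simp add: field_simps)
    then have "1 / q' > 1 - 2 / CARD('n)" using \<rho>(4) by linarith
    then have "1 / q' > (real CARD('n) - 2) / CARD('n)" using n by (simp add: field_simps)
    then show ?thesis using n \<rho>(3) by (simp add: field_simps)
  qed (use n in \<open>simp add: field_simps\<close>)
  then show "(sobolev_const q D)\<^sup>2 * Lp_norm r D (\<lambda>x. max (V x) 0) \<ge> 1"
    unfolding q'(1) using sobolev_const_potential_ge_1[OF assms q'(3)] by blast
next
  assume n: "CARD('n) \<ge> 3" and r: "r = ennreal (real CARD('n) / 2)"
  define q where "q = CARD('n) / (real CARD('n) - 2)"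
  let ?K = "sobolev_const (ennreal q) D" and ?N = "Lp_norm r D (\<lambda>x. max (V x) 0)"
  let ?G = "sqint (lebesgue_on D) (weak_gradient D u)" and ?U = "powint (2 * q) (lebesgue_on D) u"
  have q: "q > 1" using n by (simp add: q_def field_simps)
  have "1 / q + 1 / (real CARD('n) / 2) = 1" using n by (simp add: q_def field_simps)
  then have rq: "conj_exponents r q"
    using n r q by (intro disjI2 exI[of _ "real CARD('n) / 2"]) auto
  have qn: "q \<le> CARD('n) / (real CARD('n) - 2)" by (simp add: q_def)
  note en = energy_inequality[OF assms rq qn]
  \<comment> \<open>If the product were at most 1, the energy inequality multiplied by
    \<open>?K\<^sup>2\<close> would make u an extremal of the Sobolev inequality. The Sobolev
    constant is finite in that situation because \<open>?N\<close> is nonzero.\<close>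
  have "1 < ?K\<^sup>2 * ?N"
  proof (rule ccontr)
    assume "\<not> ?thesis"
    then have le: "?K\<^sup>2 * ?N \<le> 1" by simp
    have "?N \<noteq> 0" using en(3,4) by auto
    then have "?K \<noteq> top" using le by (auto simp: power2_eq_square ennreal_top_mult top_unique)
    then have "?K < top" by (simp add: less_top)
    have "?K\<^sup>2 * ?G \<le> ?K\<^sup>2 * (?N * epow ?U (1 / q))"
      by (intro mult_left_mono en(4)) simp
    also have "\<dots> = (?K\<^sup>2 * ?N) * epow ?U (1 / q)" by (simp add: mult.assoc)
    also have "\<dots> \<le> 1 * epow ?U (1 / q)" by (intro mult_right_mono le) simp
    finally show False
      using no_Sobolev_extremal[OF assms(1) n q_def assms(4) en(2) \<open>?K < top\<close>] by simp
  qed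
  then show "1 < (sobolev_const (ennreal (real CARD('n) / (real CARD('n) - 2))) D)\<^sup>2 * ?N"
    by (simp add: q_def)
qed

end
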